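(* Let $n\ge 2$, let $I_n\subset \mathbb{C}[x_{ij} : 1\le i<j\le n]$ be the toric ideal of the second hypersimplex, and let $\prec$ be any circular term order. Then $\prec$ is $2$-delightful for $I_n$, that is, $$\mathrm{in}_\prec\big(I_n^{\{2\}}\big)=\big(\mathrm{in}_\prec(I_n)\big)^{\{2\}}.$$ In particular, the set consisting of all master polynomials $f_{\mathbf{i},\mathbf{j}}$ (over all admissible pairs $(\mathbf{i},\mathbf{j})$ of sequences of length $2k+1$ in $[n]$, $k\ge 1$) together with all $3\times 3$ off-diagonal minors is a Gröbner basis of $I_n^{\{2\}}$ with respect to $\prec$.
   Context: Notation: $[n]=\{1,\dots,n\}$; $\mathbb{C}[x]=\mathbb{C}[x_{ij}:1\le i<j\le n]$, with $x_{ji}:=x_{ij}$. The ideal $I_n$ is the kernel of $\phi_n:\mathbb{C}[x]\to\mathbb{C}[t_1,\dots,t_n]$, $x_{ij}\mapsto t_it_j$. Secant ideal: for an ideal $I$ in a polynomial ring $K[x_1,\dots,x_m]$, $I^{\{2\}}$ is the join of $I$ with itself, i.e. $I^{\{2\}}=\big(I(y)+I(z)+\langle y_s+z_s-x_s: 1\le s\le m\rangle\big)\cap K[x_1,\dots,x_m]$, where $I(y)\subset K[y_1,\dots,y_m]$ and $I(z)\subset K[z_1,\dots,z_m]$ are copies of $I$ in new variables. For $I$ radical and homogeneous over an algebraically closed field this is the vanishing ideal of the secant variety of $V(I)$. Circular term order: place $1,\dots,n$ in this cyclic order at the vertices of a regular $n$-gon. The class of an edge $ab$ is determined by its circular distance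 $\min(|a-b|,\,n-|a-b|)\in\{1,\dots,\lfloor n/2\rfloor\}$ (these classes are the orbits of edges under the dihedral group). A circular term order is any block term order whose blocks are the sets of variables in each class, with variables of smaller circular distance in larger blocks: monomials are compared first on the block of distance $1$ (by some term order on that block), ties are broken on the block of distance $2$, and so on. Admissible pairs: a pair $\mathbf{i}=(i_1,\dots,i_{2k+1})$, $\mathbf{j}=(j_1,\dots,j_{2k+1})$ of elements of $[n]$, $k\ge 1$, is admissible if $i_1\le j_1<i_2\le j_2<\cdots<i_{2k+1}\le j_{2k+1}<i_1$ in circular order, making exactly one full revolution; i.e. there are integers $a_1\le b_1<a_2\le b_2<\cdots<a_{2k+1}\le b_{2k+1}<a_1+n$ with $i_l\equiv a_l$, $j_l\equiv b_l \pmod n$. When $k=1$ it is required moreover that $i_l\ne j_l$ for all $l$. The subscripts $l$ are read modulo $2k+1$. Master polynomial: first regard $i_1,j_1,\dots,i_{2k+1},j_{2k+1}$ as $4k+2$ distinct formal labels. Let $Z_{\mathbf{i},\mathbf{j}}\cong\mathbb{Z}_2^{2k+1}$ be the subgroup of the symmetric group on these labels generated by the disjoint transpositions $(i_l\ j_{l-1})$, $l=1,\dots,2k+1$. For $\sigma\in Z_{\mathbf{i},\mathbf{j}}$, let $\mathbf{x}^\sigma_{\mathbf{i},\mathbf{j}}$ be the product of $x_{ab}$ over the $2$-cycles $(a\,b)$ of the fixed-point-free involution $\sigma\big(\prod_{l=1}^{2k+1}(i_l\ j_{l+k-1})\big)\sigma^{-1}$. Then $f_{\mathbf{i},\mathbf{j}}=\sum_{\sigma\in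 Z_{\mathbf{i},\mathbf{j}}}(-1)^\sigma\,\mathbf{x}^\sigma_{\mathbf{i},\mathbf{j}}$, where $(-1)^\sigma$ is the sign of $\sigma$; when some $i_l=j_l$ in $[n]$, $f_{\mathbf{i},\mathbf{j}}$ is obtained from this polynomial by replacing the formal labels by their values in $[n]$. A $3\times 3$ off-diagonal minor is $\det(x_{ab})_{a\in R,\,b\in C}$ for disjoint $3$-element subsets $R,C\subset[n]$. *)

theory Defs
  imports
    "HOL-Library.Poly_Mapping"
    "HOL-Number_Theory.Cong"
    "HOL-Combinatorics.Permutations"
    "HOL-Algebra.Ideal"
    "HOL-Algebra.Generated_Groups"
    "Jordan_Normal_Form.Determinant"
begin

section \<open>Polynomial rings\<close>

text \<open>A monomial is its exponent vector, and a polynomial maps monomials to coefficients.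
  The polynomial ring in a set \<open>V\<close> of variables is the subring of those elements of the ambient
  type that only involve variables from \<open>V\<close>. Ideals are always taken in such a ring.\<close>

type_synonym 'v monomial = "'v \<Rightarrow>\<^sub>0 nat"
type_synonym ('v, 'a) mpoly = "'v monomial \<Rightarrow>\<^sub>0 'a"

definition monomials :: "'v set \<Rightarrow> 'v monomial set" where
  "monomials V = {m. Poly_Mapping.keys m \<subseteq> V}"

definition poly_ring :: "'v set \<Rightarrow> ('v, 'a::comm_ring_1) mpoly ring" where
  "poly_ring V = \<lparr>carrier = {f. Poly_Mapping.keys f \<subseteq> monomials V},
     mult = (*), one = 1, zero = 0, add = (+)\<rparr>"

definition Var :: "'v \<Rightarrow> ('v, 'a::comm_ring_1) mpoly" where
  "Var v = Poly_Mapping.single (Poly_Mapping.single v 1) 1"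

text \<open>\<open>substitute \<sigma>\<close> is the homomorphism of algebras that sends \<open>Var v\<close> to \<open>\<sigma> v\<close>.\<close>

definition substitute ::
  "('v \<Rightarrow> ('w, 'a) mpoly) \<Rightarrow> ('v, 'a::comm_ring_1) mpoly \<Rightarrow> ('w, 'a) mpoly" where
  "substitute \<sigma> f = (\<Sum>m\<in>Poly_Mapping.keys f.
     Poly_Mapping.single 0 (Poly_Mapping.lookup f m) *
     (\<Prod>v\<in>Poly_Mapping.keys m. \<sigma> v ^ Poly_Mapping.lookup m v))"

text \<open>Since \<open>genideal\<close> is an intersection over all ideals, it is only meaningful in a ring.\<close>

lemma poly_ring_cring: "cring (poly_ring V :: ('v, 'a::comm_ring_1) mpoly ring)"
proof -
  let ?R = "poly_ring V :: ('v, 'a) mpoly ring"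
  have add: "f + g \<in> carrier (?R)"
    if "f \<in> carrier (?R)" "g \<in> carrier (?R)" for f g :: "('v, 'a) mpoly"
    using that Poly_Mapping.keys_add[of f g] by (auto simp: poly_ring_def)
  have mult: "f * g \<in> carrier (?R)"
    if "f \<in> carrier (?R)" "g \<in> carrier (?R)" for f g :: "('v, 'a) mpoly"
  proof -
    have "m + m' \<in> monomials V" if "m \<in> monomials V" "m' \<in> monomials V" for m m'
      using that Poly_Mapping.keys_add[of m m'] by (auto simp: monomials_def)
    then show ?thesis
      using that Poly_Mapping.keys_mult[of f g] by (fastforce simp: poly_ring_def)
  qed
  have one: "(1 :: ('v, 'a) mpoly) \<in> carrier (?R)"
    by (auto simp: poly_ring_def monomials_def)
  have neg: "- f \<in> carrier (?R)" if "f \<in> carrier (?R)" for f :: "('v, 'a) mpoly"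
    using that by (simp add: poly_ring_def)
  show ?thesis
  proof (rule cringI)
    show "abelian_group (?R)"
    proof (rule abelian_groupI)
      fix f :: "('v, 'a) mpoly"
      assume "f \<in> carrier (?R)"
      then show "\<exists>g\<in>carrier (?R). g \<oplus>\<^bsub>?R\<^esub> f = \<zero>\<^bsub>?R\<^esub>"
        using neg by (intro bexI[of _ "- f"]) (auto simp: poly_ring_def)
    qed (use add in \<open>auto simp: poly_ring_def algebra_simps\<close>)
    show "comm_monoid (?R)"
      by (rule comm_monoidI) (use mult one in \<open>auto simp: poly_ring_def algebra_simps\<close>)
  qed (auto simp: poly_ring_def algebra_simps)
qed

section \<open>Joins and secant ideals\<close>

text \<open>The three tags provide the disjoint sets of variables \<open>x\<close>, \<open>y\<close>, \<open>z\<close>.\<close>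

datatype 'v tagged = X 'v | Y 'v | Z 'v

definition join_ideal ::
  "'v set \<Rightarrow> ('v, 'a::field) mpoly set \<Rightarrow> ('v, 'a) mpoly set \<Rightarrow> ('v, 'a) mpoly set" where
  "join_ideal V I J = {f \<in> carrier (poly_ring V).
     substitute (\<lambda>v. Var (X v)) f \<in>
       genideal (poly_ring (X ` V \<union> Y ` V \<union> Z ` V))
         (substitute (\<lambda>v. Var (Y v)) ` I \<union> substitute (\<lambda>v. Var (Z v)) ` J \<union>
          {Var (Y v) + Var (Z v) - Var (X v) | v. v \<in> V})}"

definition secant_ideal :: "'v set \<Rightarrow> ('v, 'a::field) mpoly set \<Rightarrow> ('v, 'a) mpoly set" where
  "secant_ideal V I = join_ideal V I I"

section \<open>Term orders, initial ideals and Groebner bases\<close>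

text \<open>\<open>(m, m') \<in> r\<close> means that \<open>m\<close> is at most \<open>m'\<close>.\<close>

definition term_order :: "'v set \<Rightarrow> 'v monomial rel \<Rightarrow> bool" where
  "term_order V r \<longleftrightarrow> linear_order_on (monomials V) r \<and>
     (\<forall>m\<in>monomials V. (0, m) \<in> r) \<and>
     (\<forall>m m'. \<forall>u\<in>monomials V. (m, m') \<in> r \<longrightarrow> (m + u, m' + u) \<in> r)"

definition lead_monomial :: "'v monomial rel \<Rightarrow> ('v, 'a::field) mpoly \<Rightarrow> 'v monomial" where
  "lead_monomial r f =
     (THE m. m \<in> Poly_Mapping.keys f \<and> (\<forall>m'\<in>Poly_Mapping.keys f. (m', m) \<in> r))"

definition initial :: "'v monomial rel \<Rightarrow> ('v, 'a::field) mpoly \<Rightarrow> ('v, 'a) mpoly" where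
  "initial r f = Poly_Mapping.single (lead_monomial r f) 1"

definition initial_ideal ::
  "'v set \<Rightarrow> 'v monomial rel \<Rightarrow> ('v, 'a::field) mpoly set \<Rightarrow> ('v, 'a) mpoly set" where
  "initial_ideal V r I = genideal (poly_ring V) {initial r f | f. f \<in> I \<and> f \<noteq> 0}"

definition groebner_basis ::
  "'v set \<Rightarrow> 'v monomial rel \<Rightarrow> ('v, 'a::field) mpoly set \<Rightarrow> ('v, 'a) mpoly set \<Rightarrow> bool" where
  "groebner_basis V r G I \<longleftrightarrow> finite G \<and> G \<subseteq> I \<and>
     initial_ideal V r I = genideal (poly_ring V) {initial r g | g. g \<in> G \<and> g \<noteq> 0}"

definition delightful2 ::
  "'v set \<Rightarrow> 'v monomial rel \<Rightarrow> ('v, 'a::field) mpoly set \<Rightarrow> bool" where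
  "delightful2 V r I \<longleftrightarrow>
     initial_ideal V r (secant_ideal V I) = secant_ideal V (initial_ideal V r I)"

definition restrict_monomial :: "'v set \<Rightarrow> 'v monomial \<Rightarrow> 'v monomial" where
  "restrict_monomial B m = Poly_Mapping.mapp (\<lambda>v e. if v \<in> B then e else 0) m"

text \<open>Block order for the blocks \<open>B 1, \<dots>, B p\<close>, where \<open>B 1\<close> is compared first and
  \<open>t d\<close> is the order used on the block \<open>B d\<close>.\<close>

definition block_order ::
  "nat \<Rightarrow> (nat \<Rightarrow> 'v set) \<Rightarrow> (nat \<Rightarrow> 'v monomial rel) \<Rightarrow> 'v monomial rel" where
  "block_order p B t =
     {(m, m'). m \<in> monomials (\<Union>d\<in>{1..p}. B d) \<and> m' \<in> monomials (\<Union>d\<in>{1..p}. B d) \<and>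
        (m = m' \<or>
         (\<exists>d\<in>{1..p}.
            (\<forall>e\<in>{1..<d}. restrict_monomial (B e) m = restrict_monomial (B e) m') \<and>
            restrict_monomial (B d) m \<noteq> restrict_monomial (B d) m' \<and>
            (restrict_monomial (B d) m, restrict_monomial (B d) m') \<in> t d))}"

section \<open>The toric ideal of the second hypersimplex\<close>

text \<open>The variable $x_{ab} = x_{ba}$ is indexed by the two-element set \<open>{a, b}\<close>.\<close>

definition edges :: "nat \<Rightarrow> nat set set" where
  "edges n = {{a, b} | a b. 1 \<le> a \<and> a < b \<and> b \<le> n}"

definition hypersimplex_map :: "(nat set, 'a::comm_ring_1) mpoly \<Rightarrow> (nat, 'a) mpoly" where
  "hypersimplex_map = substitute (\<lambda>E. \<Prod>a\<in>E. Var a)"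

definition hypersimplex_ideal :: "nat \<Rightarrow> (nat set, 'a::field) mpoly set" where
  "hypersimplex_ideal n = a_kernel (poly_ring (edges n)) (poly_ring {1..n}) hypersimplex_map"

definition edge_class :: "nat \<Rightarrow> nat \<Rightarrow> nat set set" where
  "edge_class n d = {{a, b} | a b. 1 \<le> a \<and> a < b \<and> b \<le> n \<and> min (b - a) (n - (b - a)) = d}"

definition circular_term_order :: "nat \<Rightarrow> nat set monomial rel \<Rightarrow> bool" where
  "circular_term_order n r \<longleftrightarrow>
     (\<exists>t. (\<forall>d\<in>{1..n div 2}. term_order (edge_class n d) (t d)) \<and>
          r = block_order (n div 2) (edge_class n) t)"

section \<open>Master polynomials\<close>

text \<open>Sequences of length \<open>2 * k + 1\<close> are indexed by \<open>{..<2 * k + 1}\<close>; indices are read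
  modulo \<open>2 * k + 1\<close>, so in natural numbers \<open>l - 1\<close> becomes \<open>l + 2 * k\<close>.\<close>

definition admissible :: "nat \<Rightarrow> nat \<Rightarrow> (nat \<Rightarrow> nat) \<Rightarrow> (nat \<Rightarrow> nat) \<Rightarrow> bool" where
  "admissible n k i j \<longleftrightarrow> 1 \<le> k \<and>
     (\<forall>l<2 * k + 1. i l \<in> {1..n} \<and> j l \<in> {1..n}) \<and>
     (\<exists>a b :: nat \<Rightarrow> int.
        (\<forall>l<2 * k + 1. [int (i l) = a l] (mod int n) \<and> [int (j l) = b l] (mod int n)) \<and>
        (\<forall>l<2 * k + 1. a l \<le> b l) \<and>
        (\<forall>l<2 * k. b l < a (l + 1)) \<and>
        b (2 * k) < a 0 + int n) \<and>
     (k = 1 \<longrightarrow> (\<forall>l<2 * k + 1. i l \<noteq> j l))"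

datatype label = Li nat | Lj nat

definition labels :: "nat \<Rightarrow> label set" where
  "labels k = Li ` {..<2 * k + 1} \<union> Lj ` {..<2 * k + 1}"

definition label_sym_group :: "nat \<Rightarrow> (label \<Rightarrow> label) monoid" where
  "label_sym_group k = \<lparr>carrier = {p. p permutes labels k}, mult = (\<circ>), one = id\<rparr>"

definition swap_group :: "nat \<Rightarrow> (label \<Rightarrow> label) set" where
  "swap_group k = generate (label_sym_group k)
     {transpose (Li l) (Lj ((l + 2 * k) mod (2 * k + 1))) | l. l < 2 * k + 1}"

definition base_involution :: "nat \<Rightarrow> label \<Rightarrow> label" where
  "base_involution k =
     foldr (\<circ>) (map (\<lambda>l. transpose (Li l) (Lj ((l + k - 1) mod (2 * k + 1)))) [0..<2 * k + 1]) id"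

definition two_cycles :: "nat \<Rightarrow> (label \<Rightarrow> label) \<Rightarrow> label set set" where
  "two_cycles k \<tau> = {{a, \<tau> a} | a. a \<in> labels k \<and> \<tau> a \<noteq> a}"

definition formal_master_poly :: "nat \<Rightarrow> (label set, 'a::comm_ring_1) mpoly" where
  "formal_master_poly k =
     (\<Sum>\<sigma>\<in>swap_group k. of_int (sign \<sigma>) *
        (\<Prod>E\<in>two_cycles k (\<sigma> \<circ> base_involution k \<circ> inv_into UNIV \<sigma>). Var E))"

definition label_value :: "(nat \<Rightarrow> nat) \<Rightarrow> (nat \<Rightarrow> nat) \<Rightarrow> label \<Rightarrow> nat" where
  "label_value i j a = (case a of Li l \<Rightarrow> i l | Lj l \<Rightarrow> j l)"

definition master_poly ::
  "nat \<Rightarrow> (nat \<Rightarrow> nat) \<Rightarrow> (nat \<Rightarrow> nat) \<Rightarrow> (nat set, 'a::comm_ring_1) mpoly" where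
  "master_poly k i j = substitute (\<lambda>E. Var (label_value i j ` E)) (formal_master_poly k)"

definition master_polys :: "nat \<Rightarrow> (nat set, 'a::comm_ring_1) mpoly set" where
  "master_polys n = {master_poly k i j | k i j. admissible n k i j}"

section \<open>Off-diagonal minors\<close>

text \<open>Rows and columns are listed in increasing order.\<close>

definition off_diagonal_minor :: "nat set \<Rightarrow> nat set \<Rightarrow> (nat set, 'a::comm_ring_1) mpoly" where
  "off_diagonal_minor R C = det (mat 3 3 (\<lambda>(p, q).
     Var {sorted_list_of_set R ! p, sorted_list_of_set C ! q}))"

definition off_diagonal_minors :: "nat \<Rightarrow> (nat set, 'a::comm_ring_1) mpoly set" where
  "off_diagonal_minors n = {off_diagonal_minor R C | R C.
     R \<subseteq> {1..n} \<and> C \<subseteq> {1..n} \<and> R \<inter> C = {} \<and> card R = 3 \<and> card C = 3}"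

end

theory Submission
  imports Defs
begin

text \<open>Both sides of the equality are shown to be spanned by monomials, and the two sets of
  monomials are shown to agree.

  Call a monomial standard if it is the smallest one with its image under \<open>x\<^bsub>ab\<^esub> \<mapsto> t\<^bsub>a\<^esub> t\<^bsub>b\<^esub>\<close>.
  As \<open>I\<close> is spanned by differences of monomials with equal image, the initial ideal of \<open>I\<close> is
  spanned by the monomials that are not standard. Expanding \<open>(y + z)\<^bsup>m\<^esup>\<close>, whose coefficients
  are positive integers, shows that the secant ideal of this monomial ideal is spanned by the
  monomials that are not a product of two standard ones (\<open>secant_initial\<close>). On the other side,
  \<open>f\<close> lies in the secant ideal of \<open>I\<close> exactly if it vanishes under
  \<open>x\<^bsub>ab\<^esub> \<mapsto> s\<^bsub>a\<^esub> s\<^bsub>b\<^esub> + t\<^bsub>a\<^esub> t\<^bsub>b\<^esub>\<close> (\<open>secant_toric_iff\<close>), and then its leading monomial is not a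
  product of two standard monomials: a coefficient that cannot be cancelled by smaller terms
  would survive (\<open>lead_secant\<close>). Hence it is enough to find a finite set of elements of the
  secant ideal such that every monomial that is not a product of two standard ones is a
  multiple of one of their leading monomials (\<open>delightful_groebner\<close>).

  For a circular term order the standard monomials are the thrackles, the products of pairwise
  crossing or touching chords. Replacing two disjoint noncrossing chords by the crossing pair
  on the same four points makes a monomial smaller (\<open>crossing_less\<close>), and a thrackle is
  determined by its vertex degrees (\<open>thrackle_unique\<close>). So a monomial is a product of two
  standard ones exactly if the graph on its chords, in which chords are adjacent if they are
  disjoint and do not cross, is bipartite. In a graph that is not bipartite a shortest odd
  cycle is induced, and the geometry of the circle leaves little choice for it. A triangle
  consists of three parallel chords or of three sides of a hexagon. A longer cycle orders its
  chords around the circle like the diagonals of a star polygon, so they form an admissible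
  pair (\<open>not_bipartite_cases\<close>).

  These products of chords are leading monomials. A \<open>3 \<times> 3\<close> off-diagonal minor vanishes on
  matrices of rank two, and starting from the product of the three parallel chords each
  further term arises by crossing pairs. The terms of a master polynomial arise from the
  product of the chords of the admissible pair by exchanging the two labels in some of the
  gaps, and each exchange crosses two chords. For \<open>x\<^bsub>ab\<^esub> = s\<^bsub>a\<^esub> s\<^bsub>b\<^esub> + t\<^bsub>a\<^esub> t\<^bsub>b\<^esub>\<close> one chooses
  \<open>s\<close> or \<open>t\<close> for every chord and factors the alternating sum over the gaps. Since the chords
  form an odd cycle, two consecutive ones carry the same choice, and the factor of the gap
  between them is zero (\<open>alternating_sum_zero\<close>).\<close>

abbreviation "single \<equiv> Poly_Mapping.single"
abbreviation "lookup \<equiv> Poly_Mapping.lookup"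
abbreviation "keys \<equiv> Poly_Mapping.keys"

section \<open>Substitution homomorphisms\<close>

lemma poly_mapping_sum_single: "(\<Sum>m\<in>keys f. single m (lookup f m)) = f"
  by (rule poly_mapping_eqI) (simp add: lookup_sum lookup_single when_def in_keys_iff)

lemma lookup_sum_single:
  "finite S \<Longrightarrow> lookup (\<Sum>u\<in>S. single (R u) (c u)) w = (\<Sum>u\<in>{u\<in>S. R u
      = w}. c u)"
  by (simp add: lookup_sum lookup_single when_def sum.If_cases Int_def conj_commute)

definition mono_subst :: "('v \<Rightarrow> 'b::comm_monoid_mult) \<Rightarrow> 'v monomial \<Rightarrow>
    'b" where
  "mono_subst \<sigma> m = (\<Prod>v\<in>keys m. \<sigma> v ^ lookup m v)"

lemma mono_subst_superset:
  "finite S \<Longrightarrow> keys m \<subseteq> S \<Longrightarrow>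
      mono_subst \<sigma> m = (\<Prod>v\<in>S. \<sigma> v ^ lookup m v)"
  unfolding mono_subst_def by (rule prod.mono_neutral_left) (auto simp: in_keys_iff)

lemma mono_subst_add: "mono_subst \<sigma> (m + m') = mono_subst \<sigma> m * mono_subst \<sigma> m'"
proof -
  let ?S = "keys m \<union> keys m'"
  have "keys (m + m') \<subseteq> ?S" by (rule Poly_Mapping.keys_add)
  then show ?thesis
    by (simp add: mono_subst_superset[of ?S] lookup_add power_add prod.distrib)
qed

lemma mono_subst_0: "mono_subst \<sigma> 0 = 1"
  by (simp add: mono_subst_def)

lemma mono_subst_single: "mono_subst \<sigma> (single v k) = \<sigma> v ^ k"
  by (cases "k = 0") (simp_all add: mono_subst_def)

lemma substitute_superset:
  assumes "finite S" "keys f \<subseteq> S"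
  shows "substitute \<sigma> f = (\<Sum>m\<in>S. single 0 (lookup f m) * mono_subst \<sigma> m)"
  unfolding substitute_def mono_subst_def[symmetric] using assms
  by (intro sum.mono_neutral_left) (auto simp: in_keys_iff)

lemma substitute_single: "substitute \<sigma> (single m c) = single 0 c * mono_subst \<sigma> m"
  by (subst substitute_superset[of "{m}"]) auto

lemma substitute_0 [simp]: "substitute \<sigma> 0 = 0"
  by (simp add: substitute_def)

lemma substitute_add [simp]: "substitute \<sigma> (f + g) = substitute \<sigma> f + substitute \<sigma> g"
proof -
  let ?S = "keys f \<union> keys g"
  have "keys (f + g) \<subseteq> ?S" by (rule Poly_Mapping.keys_add)
  then show ?thesis
    by (simp add: substitute_superset[of ?S] lookup_add single_add algebra_simps sum.distrib)
qed

lemma substitute_sum [simp]: "substitute \<sigma> (\<Sum>i\<in>A. f i)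
    = (\<Sum>i\<in>A. substitute \<sigma> (f i))"
  by (induction A rule: infinite_finite_induct) simp_all

lemma single_0_mult: "single 0 (a * b :: 'a::comm_ring_1) = (single 0 a * single 0 b :: ('v, 'a) mpoly)"
  by (simp add: mult_single)

lemma substitute_mult [simp]: "substitute \<sigma> (f * g) = substitute \<sigma> f * substitute \<sigma> g"
proof -
  let ?F = "\<lambda>m. single m (lookup f m)" and ?G = "\<lambda>m. single m (lookup g m)"
  have *: "substitute \<sigma> (?F m * ?G m')
      = substitute \<sigma> (?F m) * substitute \<sigma> (?G m')" for m m'
  proof -
    have "substitute \<sigma> (?F m * ?G m')
        = single 0 (lookup f m * lookup g m') * mono_subst \<sigma> (m + m')"
      by (simp only: mult_single substitute_single)
    also have "\<dots> = substitute \<sigma> (?F m) * substitute \<sigma> (?G m')"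
      by (simp only: single_0_mult mono_subst_add substitute_single ac_simps)
    finally show ?thesis .
  qed
  have "substitute \<sigma> (f * g) = substitute \<sigma> ((\<Sum>m\<in>keys f. ?F m) * (\<Sum>m\<in>keys
      g. ?G m))"
    by (simp add: poly_mapping_sum_single)
  also have "\<dots> = substitute \<sigma> (\<Sum>m\<in>keys f. ?F m) * substitute \<sigma>
      (\<Sum>m\<in>keys g. ?G m)"
    by (simp only: sum_product substitute_sum *)
  finally show ?thesis by (simp add: poly_mapping_sum_single)
qed

lemma substitute_uminus [simp]: "substitute \<sigma> (- f) = - substitute \<sigma> f"
  using substitute_add[of \<sigma> f "- f"] by (simp add: eq_neg_iff_add_eq_0 add.commute del: substitute_add)

lemma substitute_diff [simp]: "substitute \<sigma> (f - g) = substitute \<sigma> f - substitute \<sigma> g"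
  using substitute_add[of \<sigma> f "- g"] by (simp del: substitute_add)

lemma substitute_1 [simp]: "substitute \<sigma> 1 = 1"
  using substitute_single[of \<sigma> 0 1] by (simp add: mono_subst_0)

lemma substitute_const [simp]: "substitute \<sigma> (single 0 c) = single 0 c"
  by (simp add: substitute_single mono_subst_0)

lemma substitute_prod [simp]: "substitute \<sigma> (\<Prod>i\<in>A. f i)
    = (\<Prod>i\<in>A. substitute \<sigma> (f i))"
  by (induction A rule: infinite_finite_induct) simp_all

lemma substitute_power [simp]: "substitute \<sigma> (f ^ k) = substitute \<sigma> f ^ k"
  by (induction k) simp_all

lemma substitute_Var [simp]: "substitute \<sigma> (Var v) = \<sigma> v"
  by (simp add: Var_def substitute_single mono_subst_single)

lemma substitute_substitute: "substitute \<tau> (substitute \<sigma> f)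
    = substitute (\<lambda>v. substitute \<tau> (\<sigma> v)) f"
  by (simp add: substitute_def[of \<sigma>] substitute_def[of "\<lambda>v. substitute \<tau> (\<sigma> v)"])

section \<open>Ideals of polynomial rings\<close>

lemma carrier_poly_ring: "f \<in> carrier (poly_ring V) \<longleftrightarrow> keys f \<subseteq> monomials V"
  by (simp add: poly_ring_def)

lemma poly_ring_simps [simp]: "f \<oplus>\<^bsub>poly_ring V\<^esub> g = f + g"
    "f \<otimes>\<^bsub>poly_ring V\<^esub> g = f * g" "\<zero>\<^bsub>poly_ring V\<^esub> = 0"
    "\<one>\<^bsub>poly_ring V\<^esub> = 1"
  by (simp_all add: poly_ring_def)

lemma monomials_add: "m \<in> monomials V \<Longrightarrow> m' \<in> monomials V \<Longrightarrow>
    m + m' \<in> monomials V"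
  using Poly_Mapping.keys_add[of m m'] by (auto simp: monomials_def)

lemma monomials_add_iff: "m + m' \<in> monomials V \<longleftrightarrow> m \<in> monomials V \<and>
    m' \<in> monomials V"
  by (auto simp: monomials_def in_keys_iff lookup_add subset_iff)

lemma zero_monomials [simp]: "0 \<in> monomials V"
  by (simp add: monomials_def)

lemma carrier_closed:
  fixes f g :: "('v, 'a::comm_ring_1) mpoly" and c :: 'a
  shows "(0 :: ('v, 'a) mpoly) \<in> carrier (poly_ring V)" "(1 :: ('v, 'a) mpoly) \<in> carrier (poly_ring V)" 
  "f \<in> carrier (poly_ring V) \<Longrightarrow> g \<in> carrier (poly_ring V) \<Longrightarrow>
      f + g \<in> carrier (poly_ring V)"
  "f \<in> carrier (poly_ring V) \<Longrightarrow> g \<in> carrier (poly_ring V) \<Longrightarrow>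
      f * g \<in> carrier (poly_ring V)"
  "f \<in> carrier (poly_ring V) \<Longrightarrow> g \<in> carrier (poly_ring V) \<Longrightarrow>
      f - g \<in> carrier (poly_ring V)"
  "f \<in> carrier (poly_ring V) \<Longrightarrow> - f \<in> carrier (poly_ring V)"
  "m \<in> monomials V \<Longrightarrow> single m c \<in> carrier (poly_ring V)"
  "v \<in> V \<Longrightarrow> (Var v :: ('v, 'a) mpoly) \<in> carrier (poly_ring V)"
proof -
  interpret cring "poly_ring V :: ('v, 'a) mpoly ring" by (rule poly_ring_cring)
  show "(0 :: ('v, 'a) mpoly) \<in> carrier (poly_ring V)" using zero_closed by simp
  show "(1 :: ('v, 'a) mpoly) \<in> carrier (poly_ring V)" using one_closed by simp
  have a: "f \<in> carrier (poly_ring V) \<Longrightarrow> g \<in> carrier (poly_ring V) \<Longrightarrow>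
      f + g \<in> carrier (poly_ring V)"
    for f g :: "('v, 'a) mpoly" using add.m_closed[of f g] by simp
  then show "f \<in> carrier (poly_ring V) \<Longrightarrow>
      g \<in> carrier (poly_ring V) \<Longrightarrow> f + g \<in> carrier (poly_ring V)" .
  show "f \<in> carrier (poly_ring V) \<Longrightarrow> g \<in> carrier (poly_ring V) \<Longrightarrow>
      f * g \<in> carrier (poly_ring V)"
    using m_closed[of f g] by simp
  have n: "f \<in> carrier (poly_ring V) \<Longrightarrow> - f \<in> carrier (poly_ring V)" for f :: "('v,
      'a) mpoly"
    by (simp add: carrier_poly_ring)
  then show "f \<in> carrier (poly_ring V) \<Longrightarrow> - f \<in> carrier (poly_ring V)" .
  show "f \<in> carrier (poly_ring V) \<Longrightarrow> g \<in> carrier (poly_ring V) \<Longrightarrow>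
      f - g \<in> carrier (poly_ring V)"
    using a[OF _ n, of f g] by simp
  show "m \<in> monomials V \<Longrightarrow> single m c \<in> carrier (poly_ring V)"
    by (simp add: carrier_poly_ring)
  show "v \<in> V \<Longrightarrow> (Var v :: ('v, 'a) mpoly) \<in> carrier (poly_ring V)"
    by (simp add: carrier_poly_ring Var_def monomials_def)
qed

lemma carrier_sum: "(\<And>i. i \<in> A \<Longrightarrow> f i \<in> carrier (poly_ring V))
    \<Longrightarrow> (\<Sum>i\<in>A. f i) \<in> carrier (poly_ring V)"
  by (induction A rule: infinite_finite_induct) (auto intro: carrier_closed)

lemma carrier_prod: "(\<And>i. i \<in> A \<Longrightarrow>
    f i \<in> carrier (poly_ring V)) \<Longrightarrow> (\<Prod>i\<in>A. f i) \<in> carrier (poly_ring V)"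
  by (induction A rule: infinite_finite_induct) (auto intro: carrier_closed)

lemma carrier_power: "f \<in> carrier (poly_ring V) \<Longrightarrow> f ^ k \<in> carrier (poly_ring V)"
  by (induction k) (auto intro: carrier_closed)

lemma carrier_substitute:
  assumes "f \<in> carrier (poly_ring V)" "\<And>v. v \<in> V \<Longrightarrow>
      \<sigma> v \<in> carrier (poly_ring W)"
  shows "substitute \<sigma> f \<in> carrier (poly_ring W)"
  unfolding substitute_def
proof (intro carrier_sum carrier_closed carrier_prod carrier_power zero_monomials)
  fix m v assume "m \<in> keys f" "v \<in> keys m"
  then have "v \<in> V" using assms(1) by (auto simp: carrier_poly_ring monomials_def)
  then show "\<sigma> v \<in> carrier (poly_ring W)" by (rule assms(2))
qed

lemma poly_idealI:
  fixes J :: "('v, 'a::comm_ring_1) mpoly set"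
  assumes "J \<subseteq> carrier (poly_ring V)" "0 \<in> J" "\<And>f g. f \<in> J \<Longrightarrow>
      g \<in> J \<Longrightarrow> f + g \<in> J"
    "\<And>f g. f \<in> J \<Longrightarrow> g \<in> carrier (poly_ring V) \<Longrightarrow> g * f \<in> J"
  shows "ideal J (poly_ring V)"
proof -
  interpret cring "poly_ring V :: ('v, 'a) mpoly ring" by (rule poly_ring_cring)
  have neg: "- f \<in> J" if "f \<in> J" for f using assms(4)[OF that, of "- 1"] carrier_closed(2,6) by force
  have inv: "inv\<^bsub>add_monoid (poly_ring V)\<^esub> f = - f" if "f \<in> J" for f
    using that neg assms(1) minus_equality[of "- f" f] by (auto simp: a_inv_def)
  show ?thesis
  proof (rule idealI)
    show "subgroup J (add_monoid (poly_ring V))"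
      by (rule subgroup.intro) (use assms neg inv in auto)
  qed (use assms ring_axioms in \<open>auto simp: mult.commute\<close>)
qed

lemma ideal_closed:
  fixes J :: "('v, 'a::comm_ring_1) mpoly set"
  assumes "ideal J (poly_ring V)"
  shows "J \<subseteq> carrier (poly_ring V)" "0 \<in> J" "f \<in> J \<Longrightarrow>
      g \<in> J \<Longrightarrow> f + g \<in> J"
    "f \<in> J \<Longrightarrow> g \<in> carrier (poly_ring V) \<Longrightarrow> g * f \<in> J"
    "f \<in> J \<Longrightarrow> g \<in> J \<Longrightarrow> f - g \<in> J"
proof -
  interpret ideal J "poly_ring V" by (rule assms)
  show 1: "J \<subseteq> carrier (poly_ring V)" using a_subset .
  show "0 \<in> J" using additive_subgroup.zero_closed[OF is_additive_subgroup] by simp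
  show a: "f \<in> J \<Longrightarrow> g \<in> J \<Longrightarrow>
      f + g \<in> J" for f g using additive_subgroup.a_closed[OF is_additive_subgroup, of f g] by simp
  show m: "f \<in> J \<Longrightarrow> g \<in> carrier (poly_ring V) \<Longrightarrow>
      g * f \<in> J" for f g using I_l_closed[of f g] by simp
  show "f \<in> J \<Longrightarrow> g \<in> J \<Longrightarrow> f - g \<in> J"
    using a[of f "- 1 * g"] m[of g "- 1"] carrier_closed(2,6) by fastforce
qed

lemma ideal_sum: "ideal J (poly_ring V) \<Longrightarrow> (\<And>i. i \<in> A \<Longrightarrow>
    f i \<in> J) \<Longrightarrow> (\<Sum>i\<in>A. f i) \<in> J"
  by (induction A rule: infinite_finite_induct) (auto intro: ideal_closed)

lemma poly_genideal:
  fixes S :: "('v, 'a::comm_ring_1) mpoly set"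
  assumes "S \<subseteq> carrier (poly_ring V)"
  shows "ideal (genideal (poly_ring V) S) (poly_ring V)" "S \<subseteq> genideal (poly_ring V) S"
    "ideal J (poly_ring V) \<Longrightarrow> S \<subseteq> J \<Longrightarrow>
        genideal (poly_ring V) S \<subseteq> J"
proof -
  interpret cring "poly_ring V :: ('v, 'a) mpoly ring" by (rule poly_ring_cring)
  show "ideal (genideal (poly_ring V) S) (poly_ring V)" "S \<subseteq> genideal (poly_ring V) S"
    "ideal J (poly_ring V) \<Longrightarrow> S \<subseteq> J \<Longrightarrow>
        genideal (poly_ring V) S \<subseteq> J"
    using genideal_ideal[OF assms] genideal_self[OF assms] genideal_minimal by auto
qed

lemma ideal_preimage:
  fixes \<sigma> :: "'v \<Rightarrow> ('w, 'a::comm_ring_1) mpoly"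
  assumes "ideal K (poly_ring W)" "\<And>v. v \<in> V \<Longrightarrow> \<sigma> v \<in> carrier (poly_ring W)"
  shows "ideal {f \<in> carrier (poly_ring V). substitute \<sigma> f \<in> K} (poly_ring V)"
proof (rule poly_idealI)
  fix f g :: "('v, 'a) mpoly"
  assume "f \<in> {f \<in> carrier (poly_ring V). substitute \<sigma> f \<in> K}"
      "g \<in> carrier (poly_ring V)"
  then show "g * f \<in> {f \<in> carrier (poly_ring V). substitute \<sigma> f \<in> K}"
    using ideal_closed(4)[OF assms(1)] carrier_substitute[of g V \<sigma> W, OF _ assms(2)]
        by (simp add: carrier_closed)
qed (use ideal_closed(2,3)[OF assms(1)] in \<open>auto intro: carrier_closed\<close>)

lemma ideal_zero: "ideal {0} (poly_ring V)"
  by (rule poly_idealI) (auto simp: carrier_closed)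

section \<open>Linear maps between exponent vectors\<close>

definition scale :: "nat \<Rightarrow> 'w monomial \<Rightarrow> 'w monomial" where
  "scale k x = (\<Sum>i<k. x)"

lemma lookup_scale: "lookup (scale k x) w = k * lookup x w"
  by (simp add: scale_def lookup_sum)

text \<open>The linear extension of a map from variables to exponent vectors. It describes the algebra
  homomorphisms that send variables to monomials.\<close>

definition push :: "('v \<Rightarrow> 'w monomial) \<Rightarrow> 'v monomial \<Rightarrow> 'w monomial" where
  "push h m = (\<Sum>v\<in>keys m. scale (lookup m v) (h v))"

lemma lookup_push: "lookup (push h m) w = (\<Sum>v\<in>keys m. lookup m v * lookup (h v) w)"
  by (simp add: push_def lookup_sum lookup_scale)

lemma lookup_push_superset: "finite S \<Longrightarrow> keys m \<subseteq> S \<Longrightarrow>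
    lookup (push h m) w = (\<Sum>v\<in>S. lookup m v * lookup (h v) w)"
  unfolding lookup_push by (rule sum.mono_neutral_left) (auto simp: in_keys_iff)

lemma push_add: "push h (m + m') = push h m + push h m'"
proof (rule poly_mapping_eqI)
  fix w
  let ?S = "keys m \<union> keys m'"
  have "keys (m + m') \<subseteq> ?S" by (rule Poly_Mapping.keys_add)
  then show "lookup (push h (m + m')) w = lookup (push h m + push h m') w"
    by (simp add: lookup_push_superset[of ?S] lookup_add algebra_simps sum.distrib)
qed

lemma push_0 [simp]: "push h 0 = 0"
  by (simp add: push_def)

lemma push_single [simp]: "push h (single v 1) = h v"
  by (rule poly_mapping_eqI) (simp add: lookup_push)

lemma single_prod: "(\<Prod>i\<in>A. single (m i) 1) = single (\<Sum>i\<in>A. m i) (1 :: 'a::comm_ring_1)"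
  by (induction A rule: infinite_finite_induct) (simp_all add: mult_single)

lemma single_power: "single m 1 ^ k = single (scale k m) (1 :: 'a::comm_ring_1)"
  by (induction k) (simp_all add: mult_single scale_def add.commute)

lemma mono_subst_push: "mono_subst (\<lambda>v. single (h v) 1) m = single (push h m) (1 :: 'a::comm_ring_1)"
  by (simp add: mono_subst_def push_def single_power single_prod)

lemma substitute_push: "substitute (\<lambda>v. single (h v) 1) f
    = (\<Sum>m\<in>keys f. single (push h m) (lookup f m))"
  by (simp add: substitute_def mono_subst_def[symmetric] mono_subst_push mult_single)

section \<open>Splitting each variable into a sum of two\<close>

text \<open>This is the monomial \<open>y\<^bsup>m\<^esup> z\<^bsup>m'\<^esup>\<close>.\<close>

definition pair_mono :: "'v monomial \<Rightarrow> 'v monomial \<Rightarrow> 'v tagged monomial" where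
  "pair_mono m m' = push (\<lambda>v. single (Y v) 1) m + push (\<lambda>v. single (Z v) 1) m'"

lemma lookup_pair_mono [simp]:
  "lookup (pair_mono m m') (X v) = 0"
  "lookup (pair_mono m m') (Y v) = lookup m v"
  "lookup (pair_mono m m') (Z v) = lookup m' v"
  by (simp_all add: pair_mono_def lookup_add lookup_push lookup_single when_def if_distrib[of "(*) _"]
      in_keys_iff cong: if_cong)

lemma pair_mono_inject [simp]: "pair_mono m1 m2 = pair_mono m1' m2' \<longleftrightarrow> m1 = m1' \<and>
    m2 = m2'"
  by (metis lookup_pair_mono(2,3) poly_mapping_eqI)

lemma pair_mono_add: "pair_mono m1 m2 + pair_mono m1' m2' = pair_mono (m1 + m1') (m2 + m2')"
  by (simp add: pair_mono_def push_add add_ac)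

lemma pair_mono_0 [simp]: "pair_mono 0 0 = 0"
  by (simp add: pair_mono_def)

lemma pair_mono_single: "pair_mono (single v 1) 0 = single (Y v) 1"
  "pair_mono 0 (single v 1) = single (Z v) 1"
  by (simp_all only: pair_mono_def push_single push_0 add_0 add_0_right)

lemma pair_mono_monomials: 
  "pair_mono m1 m2 \<in> monomials (Y ` V \<union> Z ` V) \<longleftrightarrow> m1 \<in> monomials V \<and>
      m2 \<in> monomials V"
proof -
  have "t \<in> keys (pair_mono m1 m2) \<longleftrightarrow> (case t of X v \<Rightarrow> False | Y v
      \<Rightarrow> v \<in> keys m1 | Z v \<Rightarrow> v \<in> keys m2)" for t
    by (cases t) (simp_all add: in_keys_iff)
  then show ?thesis unfolding monomials_def subset_iff mem_Collect_eq by (auto split: tagged.splits) 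
qed

lemma monomials_pair_mono:
  assumes "u \<in> monomials (Y ` V \<union> Z ` V)"
  obtains m1 m2 where "u = pair_mono m1 m2" "m1 \<in> monomials V" "m2 \<in> monomials V"
proof -
  have inj: "inj Y" "inj Z" by (auto simp: inj_def)
  define m1 m2 where "m1 = Poly_Mapping.map_key Y u" and "m2 = Poly_Mapping.map_key Z u"
  have "u = pair_mono m1 m2"
  proof (rule poly_mapping_eqI)
    fix t
    have "X v \<notin> keys u" for v using assms by (auto simp: monomials_def)
    then show "lookup u t = lookup (pair_mono m1 m2) t"
      by (cases t) (simp_all add: m1_def m2_def map_key.rep_eq[OF inj(1)] map_key.rep_eq[OF inj(2)] in_keys_iff)
  qed
  with assms that show ?thesis by (simp add: pair_mono_monomials)
qed

lemma lookup_times_single: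
  "lookup (g * single k 1) (u + k) = lookup (g :: ('v, 'a::comm_ring_1) mpoly) u"
  "(\<nexists>u. w = u + k) \<Longrightarrow> lookup (g * single k 1) w = 0"
proof -
  have "g * single k 1 = (\<Sum>m\<in>keys g. single (m + k) (lookup g m))"
    by (subst (1) poly_mapping_sum_single[of g, symmetric]) (simp add: sum_distrib_right mult_single)
  then have *: "lookup (g * single k 1) w = (\<Sum>m\<in>{m\<in>keys g. m + k = w}. lookup g m)" for w
    by (simp add: lookup_sum_single)
  show "lookup (g * single k 1) (u + k) = lookup g u"
  proof (cases "u \<in> keys g")
    case True
    then have "{m\<in>keys g. m + k = u + k} = {u}" by auto
    then show ?thesis unfolding * by simp
  next
    case False
    then have e: "{m\<in>keys g. m + k = u + k} = {}" by auto
    show ?thesis unfolding * e using False by (simp add: in_keys_iff)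
  qed
  show "lookup (g * single k 1) w = 0" if "\<nexists>u. w = u + k"
  proof -
    have e: "{m\<in>keys g. m + k = w} = {}" using that by auto
    show ?thesis unfolding * e by simp
  qed
qed

lemma monomial_induct [case_names zero add]:
  assumes "P (0 :: 'v monomial)" "\<And>m v. P m \<Longrightarrow> P (m + single v 1)"
  shows "P m"
proof (induction "\<Sum>v\<in>keys m. lookup m v" arbitrary: m)
  case 0
  then have "m = 0" by (intro poly_mapping_eqI) (auto simp: in_keys_iff)
  then show ?case using assms(1) by simp
next
  case (Suc n)
  then obtain v where v: "v \<in> keys m" by fastforce
  define m' where "m' = m - single v 1"
  have m: "m = m' + single v 1"
    using v by (intro poly_mapping_eqI) (auto simp: m'_def lookup_add lookup_minus lookup_single when_def
        in_keys_iff)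
  have "(\<Sum>x\<in>keys m. lookup m x) = (\<Sum>x\<in>keys m. lookup m' x) + 1"
    using v by (simp add: m lookup_add sum.distrib lookup_single when_def)
  also have "(\<Sum>x\<in>keys m. lookup m' x) = (\<Sum>x\<in>keys m'. lookup m' x)"
    by (rule sum.mono_neutral_right) (auto simp: in_keys_iff m lookup_add)
  finally have "P m'" using Suc by simp
  then show ?case using assms(2) m by simp
qed

abbreviation split_poly :: "('v, 'a::comm_ring_1) mpoly \<Rightarrow> ('v tagged, 'a) mpoly" where
  "split_poly \<equiv> substitute (\<lambda>v. Var (Y v) + Var (Z v))"

text \<open>The coefficient is a product of binomial coefficients, but only its positivity is used, and
  that is immediate by induction: multiplying by one more factor \<open>y + z\<close> adds two natural
  numbers, at least one of which is positive if \<open>m1 + m2 = m\<close>.\<close>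

lemma lookup_split_monomial:
  "\<exists>N. lookup (mono_subst (\<lambda>v. Var (Y v)
      + Var (Z v) :: ('v tagged, 'a::comm_ring_1) mpoly) m) (pair_mono m1 m2) = of_nat N
     \<and> (0 < N \<longleftrightarrow> m1 + m2 = m)"
proof (induction m arbitrary: m1 m2 rule: monomial_induct)
  case zero
  have "m1 + m2 = 0 \<longleftrightarrow> pair_mono m1 m2 = 0"
    unfolding pair_mono_0[symmetric] pair_mono_inject by (auto simp: poly_mapping_eq_iff fun_eq_iff lookup_add)
  then show ?case
    by (intro exI[of _ "if m1 + m2 = 0 then 1 else 0"]) (auto simp: mono_subst_0 lookup_one when_def)
next
  case (add m v)
  let ?E = "\<lambda>m. mono_subst (\<lambda>v. Var (Y v) + Var (Z v) :: ('v tagged, 'a) mpoly) m"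
  let ?e = "single v 1 :: 'v monomial"
  have E: "?E (m + ?e) = ?E m * single (pair_mono ?e 0) 1 + ?E m * single (pair_mono 0 ?e) 1"
    by (simp only: mono_subst_add mono_subst_single power_one_right Var_def distrib_left pair_mono_single)
  have sub: "\<exists>m'. n = m' + ?e" if "lookup n v \<noteq> 0" for n
    using that by (intro exI[of _ "n - ?e"] poly_mapping_eqI) (auto simp: lookup_add lookup_minus
        lookup_single when_def)
  have 1: "\<exists>N. lookup (?E m * single (pair_mono ?e 0) 1) (pair_mono m1 m2) = of_nat N
     \<and> (0 < N \<longleftrightarrow> m1 + m2 = m + ?e \<and> lookup m1 v \<noteq> 0)"
  proof (cases "lookup m1 v = 0")
    case True
    have "\<nexists>u. pair_mono m1 m2 = u + pair_mono ?e 0"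
    proof
      assume "\<exists>u. pair_mono m1 m2 = u + pair_mono ?e 0"
      then obtain u where "pair_mono m1 m2 = u + pair_mono ?e 0" ..
      from arg_cong[OF this, of "\<lambda>w. lookup w (Y v)"] True show False by (simp add: lookup_add)
    qed
    from lookup_times_single(2)[OF this] True show ?thesis by (intro exI[of _ 0]) simp
  next
    case False
    then obtain m' where m': "m1 = m' + ?e" using sub by blast
    have "pair_mono m1 m2 = pair_mono m' m2 + pair_mono ?e 0" by (simp add: pair_mono_add m')
    moreover have "m1 + m2 = m + ?e \<longleftrightarrow> m' + m2 = m"
      using add_right_cancel[of "m' + m2" ?e m] by (simp only: m' ac_simps)
    ultimately show ?thesis using add.IH[of m' m2] False by (simp only: lookup_times_single) simp
  qed
  have 2: "\<exists>N. lookup (?E m * single (pair_mono 0 ?e) 1) (pair_mono m1 m2) = of_nat N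
     \<and> (0 < N \<longleftrightarrow> m1 + m2 = m + ?e \<and> lookup m2 v \<noteq> 0)"
  proof (cases "lookup m2 v = 0")
    case True
    have "\<nexists>u. pair_mono m1 m2 = u + pair_mono 0 ?e"
    proof
      assume "\<exists>u. pair_mono m1 m2 = u + pair_mono 0 ?e"
      then obtain u where "pair_mono m1 m2 = u + pair_mono 0 ?e" ..
      from arg_cong[OF this, of "\<lambda>w. lookup w (Z v)"] True show False by (simp add: lookup_add)
    qed
    from lookup_times_single(2)[OF this] True show ?thesis by (intro exI[of _ 0]) simp
  next
    case False
    then obtain m' where m': "m2 = m' + ?e" using sub by blast
    have "pair_mono m1 m2 = pair_mono m1 m' + pair_mono 0 ?e" by (simp add: pair_mono_add m')
    moreover have "m1 + m2 = m + ?e \<longleftrightarrow> m1 + m' = m" by (simp add: m' flip: add.assoc)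
    ultimately show ?thesis using add.IH[of m1 m'] False by (simp only: lookup_times_single) simp
  qed
  from 1 obtain N1 where N1: "lookup (?E m * single (pair_mono ?e 0) 1) (pair_mono m1 m2) = of_nat N1"
     "0 < N1 \<longleftrightarrow> m1 + m2 = m + ?e \<and> lookup m1 v \<noteq> 0" by blast
  from 2 obtain N2 where N2: "lookup (?E m * single (pair_mono 0 ?e) 1) (pair_mono m1 m2) = of_nat N2"
     "0 < N2 \<longleftrightarrow> m1 + m2 = m + ?e \<and> lookup m2 v \<noteq> 0" by blast
  have "lookup m1 v \<noteq> 0 \<or> lookup m2 v \<noteq> 0" if "m1 + m2 = m + ?e"
    using arg_cong[OF that, of "\<lambda>w. lookup w v"] by (auto simp: lookup_add)
  then have "0 < N1 + N2 \<longleftrightarrow> m1 + m2 = m + ?e" using N1(2) N2(2) by auto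
  moreover have "lookup (?E (m + ?e)) (pair_mono m1 m2) = of_nat (N1 + N2)"
    unfolding E lookup_add N1(1) N2(1) by simp
  ultimately show ?case by blast
qed

lemma lookup_const_times: "lookup (single 0 c * (g :: ('v, 'a::comm_ring_1) mpoly)) u = c * lookup g u"
  by (simp flip: mult_map_scale_conv_mult add: Poly_Mapping.map.rep_eq when_def)

lemma lookup_split_poly:
  "\<exists>N>0. \<forall>f :: ('v, 'a::comm_ring_1) mpoly. lookup (split_poly f) (pair_mono m1 m2)
      = lookup f (m1 + m2) * of_nat N"
proof -
  let ?E = "\<lambda>m. mono_subst (\<lambda>v. Var (Y v) + Var (Z v) :: ('v tagged, 'a) mpoly) m"
  obtain N where N: "lookup (?E (m1 + m2)) (pair_mono m1 m2) = of_nat N" "0 < N"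
    using lookup_split_monomial[of "m1 + m2" m1 m2] by blast
  have 0: "lookup (?E m) (pair_mono m1 m2) = 0" if "m \<noteq> m1 + m2" for m
    using lookup_split_monomial[of m m1 m2] that by fastforce
  have "lookup (split_poly f) (pair_mono m1 m2) = lookup f (m1 + m2) * of_nat N" for f :: "('v, 'a) mpoly"
  proof -
    have "lookup (split_poly f) (pair_mono m1 m2)
        = (\<Sum>m\<in>keys f. lookup f m * lookup (?E m) (pair_mono m1 m2))"
      by (simp add: substitute_def mono_subst_def[symmetric] lookup_sum lookup_const_times)
    also have "\<dots> = (\<Sum>m\<in>keys f. if m = m1 + m2 then lookup f m * of_nat N else 0)"
      by (rule sum.cong) (auto simp: 0 N(1))
    also have "\<dots> = lookup f (m1 + m2) * of_nat N"
      by (simp add: in_keys_iff)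
    finally show ?thesis .
  qed
  then show ?thesis using N(2) by blast
qed

lemma split_poly_carrier: "f \<in> carrier (poly_ring V) \<Longrightarrow>
    split_poly f \<in> carrier (poly_ring (Y ` V \<union> Z ` V))"
  by (erule carrier_substitute) (auto intro!: carrier_closed)

section \<open>Membership in a secant ideal\<close>

context
  fixes V :: "'v set" and I :: "('v, 'a::field) mpoly set"
  assumes I: "I \<subseteq> carrier (poly_ring V)"
begin

definition join_gens :: "('v tagged, 'a) mpoly set" where
  "join_gens = substitute (\<lambda>v. Var (Y v)) ` I \<union> substitute (\<lambda>v. Var (Z v)) ` I \<union>
     {Var (Y v) + Var (Z v) - Var (X v) | v. v \<in> V}"

abbreviation "XYZ \<equiv> X ` V \<union> Y ` V \<union> Z ` V"
abbreviation "YZ \<equiv> Y ` V \<union> Z ` V"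

lemma join_gens_carrier: "join_gens \<subseteq> carrier (poly_ring XYZ)"
proof -
  have "substitute (\<lambda>v. Var (Y v)) f \<in> carrier (poly_ring XYZ)"
      "substitute (\<lambda>v. Var (Z v)) f \<in> carrier (poly_ring XYZ)" if "f \<in> I" for f
    by (rule carrier_substitute[of _ V]; use that I in \<open>auto intro: carrier_closed\<close>)+
  moreover have "Var (Y v) + Var (Z v) - Var (X v) \<in> carrier (poly_ring XYZ)" if "v \<in> V" for v
    by (intro carrier_closed) (use that in auto)
  ultimately show ?thesis by (auto simp: join_gens_def)
qed

abbreviation "ambient_join \<equiv> genideal (poly_ring XYZ) join_gens"

lemma secant_iff: "f \<in> secant_ideal V I \<longleftrightarrow> f \<in> carrier (poly_ring V) \<and>
    substitute (\<lambda>v. Var (X v)) f \<in> ambient_join"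
  by (simp add: secant_ideal_def join_ideal_def join_gens_def)

lemma ambient_join_ideal: "ideal ambient_join (poly_ring XYZ)" and ambient_join_gens: "join_gens
    \<subseteq> ambient_join"
  using poly_genideal[OF join_gens_carrier] by auto

text \<open>Modulo the linear generators of the join every \<open>x\<close> equals \<open>y + z\<close>, so membership can be
  tested after eliminating the variables \<open>x\<close>.\<close>

lemma X_minus_split: 
  assumes "f \<in> carrier (poly_ring V)" shows "split_poly f - substitute (\<lambda>v. Var (X v)) f \<in>
      ambient_join"
proof -
  note J = ideal_closed[OF ambient_join_ideal]
  let ?A = "\<lambda>v. Var (Y v) + Var (Z v) :: ('v tagged, 'a) mpoly" and ?B
      = "\<lambda>v. Var (X v) :: ('v tagged, 'a) mpoly"
  have car: "?A v \<in> carrier (poly_ring XYZ)" "?B v \<in> carrier (poly_ring XYZ)" if "v \<in> V" for v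
    by (intro carrier_closed; use that in auto)+
  have m1: "mono_subst ?B m \<in> carrier (poly_ring XYZ)" if "m \<in> monomials V" for m
    unfolding mono_subst_def by (intro carrier_prod carrier_power car(2)) (use that in \<open>auto simp:
        monomials_def\<close>)
  have "m \<in> monomials V \<longrightarrow> mono_subst ?A m - mono_subst ?B m \<in> ambient_join" for m
  proof (induction m rule: monomial_induct)
    case zero
    then show ?case using J(2) by (simp add: mono_subst_0)
  next
    case (add m v)
    show ?case
    proof
      assume "m + single v 1 \<in> monomials V"
      then have m: "m \<in> monomials V" and v: "v \<in> V"
          by (auto simp: monomials_add_iff) (simp add: monomials_def)
      have "?A v - ?B v \<in> ambient_join" using ambient_join_gens v by (auto simp: join_gens_def)
      then have "mono_subst ?B m * (?A v - ?B v)
          + ?A v * (mono_subst ?A m - mono_subst ?B m) \<in> ambient_join"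
        using add.IH m by (intro J(3,4) m1 car v) auto
      moreover have "mono_subst ?A (m + single v 1) - mono_subst ?B (m + single v 1)
          = mono_subst ?B m * (?A v - ?B v) + ?A v * (mono_subst ?A m - mono_subst ?B m)"
        by (simp only: mono_subst_add mono_subst_single power_one_right) (simp add: algebra_simps)
      ultimately show "mono_subst ?A (m + single v 1) - mono_subst ?B (m
          + single v 1) \<in> ambient_join" by simp
    qed
  qed
  then have *: "mono_subst ?A m - mono_subst ?B m \<in> ambient_join" if "m \<in> monomials V" for m
      using that by blast
  have "split_poly f - substitute ?B f = (\<Sum>m\<in>keys f. single 0 (lookup f m) * (mono_subst ?A m -
      mono_subst ?B m))"
    by (simp add: substitute_def mono_subst_def[symmetric] right_diff_distrib sum_subtractf)
  also have "\<dots> \<in> ambient_join"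
    using assms by (intro ideal_sum[OF ambient_join_ideal] J(4) * carrier_closed) (auto simp: carrier_poly_ring)
  finally show ?thesis .
qed

lemma secant_split:
  assumes "f \<in> carrier (poly_ring V)"
  shows "f \<in> secant_ideal V I \<longleftrightarrow> split_poly f \<in> ambient_join"
proof -
  note J = ideal_closed[OF ambient_join_ideal]
  let ?D = "split_poly f - substitute (\<lambda>v. Var (X v)) f"
  have D: "?D \<in> ambient_join" by (rule X_minus_split[OF assms])
  have "split_poly f - ?D = substitute (\<lambda>v. Var (X v)) f"
      "?D + substitute (\<lambda>v. Var (X v)) f = split_poly f" by simp_all
  then show ?thesis 
    using J(3)[OF D, of "substitute (\<lambda>v. Var (X v)) f"] J(5)[OF _ D, of "split_poly f"] assms
    unfolding secant_iff by (simp only:) blast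
qed

text \<open>Retracting \<open>x\<close> onto \<open>y + z\<close> kills the linear generators. What remains takes place in the
  variables \<open>y\<close> and \<open>z\<close> alone.\<close>

lemma secant_split_in:
  assumes "f \<in> secant_ideal V I" and K: "ideal K (poly_ring YZ)"
    and IK: "\<And>g. g \<in> I \<Longrightarrow> substitute (\<lambda>v. Var (Y v)) g \<in> K"
        "\<And>g. g \<in> I \<Longrightarrow> substitute (\<lambda>v. Var (Z v)) g \<in> K"
  shows "split_poly f \<in> K"
proof -
  define \<kappa> :: "'v tagged \<Rightarrow> ('v tagged, 'a) mpoly" where
    "\<kappa> t = (case t of X v \<Rightarrow> Var (Y v) + Var (Z v) | t' \<Rightarrow> Var t')" for t
  have \<kappa>: "\<kappa> t \<in> carrier (poly_ring YZ)" if "t \<in> XYZ" for t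
    using that by (auto simp: \<kappa>_def intro!: carrier_closed)
  let ?K = "{g \<in> carrier (poly_ring XYZ). substitute \<kappa> g \<in> K}"
  have "ambient_join \<subseteq> ?K"
  proof (rule poly_genideal(3)[OF join_gens_carrier ideal_preimage[OF K \<kappa>]])
    have "substitute \<kappa> g \<in> K" if "g \<in> join_gens" for g
      using that IK ideal_closed(2)[OF K] unfolding join_gens_def
      by (auto simp: substitute_substitute \<kappa>_def)
    then show "join_gens \<subseteq> ?K" using join_gens_carrier by blast
  qed
  then have "substitute \<kappa> (substitute (\<lambda>v. Var (X v)) f) \<in> K"
      using assms(1) unfolding secant_iff by blast
  then show ?thesis by (simp add: substitute_substitute \<kappa>_def)
qed

end

lemma push_push: "push h (push g m) = push (\<lambda>v. push h (g v)) m"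
proof (induction m rule: monomial_induct)
  case (add m v)
  then show ?case by (simp only: push_add push_single)
qed simp

lemma push_pair: "push (\<lambda>v. pair_mono (h v) 0) m = pair_mono (push h m) 0"
    "push (\<lambda>v. pair_mono 0 (h v)) m = pair_mono 0 (push h m)"
proof (induction m rule: monomial_induct)
  case (add m v)
  {
    case 1
    then show ?case using add by (simp only: push_add push_single pair_mono_add add_0)
  next
    case 2
    then show ?case using add by (simp only: push_add push_single pair_mono_add add_0)
  }
qed simp_all

section \<open>Leading monomials\<close>

locale monomial_order =
  fixes V :: "'v set" and r :: "'v monomial rel"
  assumes order: "term_order V r"
begin

lemma order_props: "refl_on (monomials V) r" "trans r" "antisym r" "total_on (monomials V) r"
  using order unfolding term_order_def linear_order_on_def partial_order_on_def preorder_on_def by blast+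

lemma order_refl: "m \<in> monomials V \<Longrightarrow> (m, m) \<in> r"
  using order_props(1) by (rule refl_onD)

lemma order_antisym: "(m, m') \<in> r \<Longrightarrow> (m', m) \<in> r \<Longrightarrow> m = m'"
  using order_props(3) by (rule antisymD)

lemma order_trans: "(m, m') \<in> r \<Longrightarrow> (m', m'') \<in> r \<Longrightarrow> (m, m'') \<in> r"
  using order_props(2) by (rule transD)

lemma order_add: "u \<in> monomials V \<Longrightarrow> (m, m') \<in> r \<Longrightarrow>
    (m + u, m' + u) \<in> r"
  using order unfolding term_order_def by blast

lemma order_total: "m \<in> monomials V \<Longrightarrow> m' \<in> monomials V \<Longrightarrow>
    (m, m') \<in> r \<or> (m', m) \<in> r"
  using order_refl[of m] order_props(4)[unfolded total_on_def, rule_format, of m m']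
      by (cases "m = m'") simp_all

lemma lead_monomialI:
  "m \<in> keys f \<Longrightarrow> (\<And>m'. m' \<in> keys f \<Longrightarrow>
      (m', m) \<in> r) \<Longrightarrow> lead_monomial r f = m"
  unfolding lead_monomial_def
proof (rule the_equality)
  assume m: "m \<in> keys f" "\<And>m'. m' \<in> keys f \<Longrightarrow> (m', m) \<in> r"
  then show "m \<in> keys f \<and> (\<forall>m'\<in>keys f. (m', m) \<in> r)" by blast
  fix x assume x: "x \<in> keys f \<and> (\<forall>m'\<in>keys f. (m', x) \<in> r)"
  show "x = m" by (rule order_antisym[OF m(2)]) (use x m in blast)+
qed

lemma finite_max:
  assumes "finite S" "S \<noteq> {}" "S \<subseteq> monomials V"
  shows "\<exists>m\<in>S. \<forall>m'\<in>S. (m', m) \<in> r"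
  using assms
proof (induction rule: finite_ne_induct)
  case (singleton x)
  then show ?case using order_refl by simp
next
  case (insert x F)
  then obtain m where m: "m \<in> F" "\<forall>m'\<in>F. (m', m) \<in> r" by auto
  consider "(x, m) \<in> r" | "(m, x) \<in> r" using order_total[of x m] insert.prems m(1) by auto
  then show ?case
  proof cases
    case 1
    then show ?thesis using m by auto
  next
    case 2
    then show ?thesis using m order_trans[OF _ 2] order_refl insert.prems by auto
  qed
qed

lemma finite_min:
  assumes "finite S" "S \<noteq> {}" "S \<subseteq> monomials V"
  shows "\<exists>m\<in>S. \<forall>m'\<in>S. (m, m') \<in> r"
  using assms
proof (induction rule: finite_ne_induct)
  case (singleton x)
  then show ?case using order_refl by simp
next
  case (insert x F)
  then obtain m where m: "m \<in> F" "\<forall>m'\<in>F. (m, m') \<in> r" by auto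
  consider "(m, x) \<in> r" | "(x, m) \<in> r" using order_total[of x m] insert.prems m(1) by auto
  then show ?case
  proof cases
    case 1
    then show ?thesis using m by auto
  next
    case 2
    then show ?thesis using m order_trans[OF 2] order_refl insert.prems by auto
  qed
qed

lemma lead_monomial:
  assumes "f \<in> carrier (poly_ring V)" "f \<noteq> 0"
  shows "lead_monomial r f \<in> keys f" "m \<in> keys f \<Longrightarrow> (m, lead_monomial r f) \<in> r"
proof -
  obtain m where m: "m \<in> keys f" "\<forall>m'\<in>keys f. (m', m) \<in> r"
    using finite_max[of "keys f"] assms by (auto simp: carrier_poly_ring)
  then have "lead_monomial r f = m" by (intro lead_monomialI) auto
  with m show "lead_monomial r f \<in> keys f" "m \<in> keys f \<Longrightarrow>
      (m, lead_monomial r f) \<in> r" for m by auto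
qed

lemma initial_gens_carrier:
  "J \<subseteq> carrier (poly_ring V) \<Longrightarrow> {initial r f | f. f \<in> J \<and>
      f \<noteq> 0} \<subseteq> carrier (poly_ring V)"
  using lead_monomial(1) by (fastforce simp: initial_def carrier_poly_ring)

lemma initial_ideal_ideal: "J \<subseteq> carrier (poly_ring V) \<Longrightarrow>
    ideal (initial_ideal V r J) (poly_ring V)"
  and initial_in_initial_ideal: "J \<subseteq> carrier (poly_ring V) \<Longrightarrow>
      f \<in> J \<Longrightarrow> f \<noteq> 0 \<Longrightarrow> initial r f \<in> initial_ideal V r J"
  using poly_genideal[OF initial_gens_carrier[of J]] unfolding initial_ideal_def by auto

end

section \<open>Secants of toric ideals\<close>

locale toric = monomial_order V r for V :: "'v set" and r :: "'v monomial rel" +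
  fixes h :: "'v \<Rightarrow> 'w monomial"
begin

definition toric_ideal :: "('v, 'a::field_char_0) mpoly set" where
  "toric_ideal = {f \<in> carrier (poly_ring V). substitute (\<lambda>v. single (h v) 1) f = 0}"

text \<open>Monomials with the same image under \<open>push h\<close> agree modulo the toric ideal, and the standard
  ones are the smallest representatives.\<close>

definition standard :: "'v monomial \<Rightarrow> bool" where
  "standard m \<longleftrightarrow> m \<in> monomials V \<and>
      (\<forall>m'\<in>monomials V. push h m' = push h m \<longrightarrow> (m, m') \<in> r)"

definition standard_sum :: "'v monomial \<Rightarrow> bool" where
  "standard_sum m \<longleftrightarrow> (\<exists>m1 m2. standard m1 \<and> standard m2 \<and> m = m1 + m2)"

lemma standard_monomials: "standard m \<Longrightarrow> m \<in> monomials V"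
  by (simp add: standard_def)

lemma toric_ideal_carrier: "toric_ideal \<subseteq> carrier (poly_ring V)"
  by (auto simp: toric_ideal_def)

lemma nonstandard_add:
  assumes "\<not> standard m" "m \<in> monomials V" "u \<in> monomials V" shows "\<not> standard (m + u)"
proof -
  obtain m' where m': "m' \<in> monomials V" "push h m' = push h m"
      "(m, m') \<notin> r" using assms by (auto simp: standard_def)
  then have "(m', m) \<in> r" "m' \<noteq> m" using order_total order_refl assms by auto
  then have "(m' + u, m + u) \<in> r" "m' + u \<noteq> m + u" using order_add assms by auto
  then have "(m + u, m' + u) \<notin> r" using order_antisym by blast
  moreover have "m' + u \<in> monomials V" "push h (m' + u) = push h (m + u)"
      using m' assms by (auto simp: monomials_add push_add)
  ultimately show ?thesis by (auto simp: standard_def)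
qed

lemma binomial_in_toric:
  "m \<in> monomials V \<Longrightarrow> m' \<in> monomials V \<Longrightarrow>
      push h m' = push h m \<Longrightarrow> 
    single m c - single m' c \<in> toric_ideal"
  by (simp add: toric_ideal_def carrier_closed substitute_single mono_subst_push mult_single)

text \<open>The difference of a nonstandard monomial and a smaller one with the same image lies in the
  toric ideal.\<close>

lemma nonstandard_initial:
  assumes "m \<in> monomials V" "\<not> standard m"
  shows "single m (1::'a::field_char_0) \<in> initial_ideal V r toric_ideal"
proof -
  obtain m' where m': "m' \<in> monomials V" "push h m' = push h m"
      "(m, m') \<notin> r" using assms by (auto simp: standard_def)
  then have *: "(m', m) \<in> r" "m' \<noteq> m" using order_total order_refl assms by auto
  define f :: "('v, 'a) mpoly" where "f = single m 1 - single m' 1"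
  have l: "lookup f x = (if x = m then 1 else if x = m' then - 1 else 0)" for x
    using *(2) by (simp add: f_def lookup_minus lookup_single when_def)
  have k: "keys f = {m, m'}" using l by (auto simp: in_keys_iff split: if_splits)
  have "lead_monomial r f = m" by (rule lead_monomialI) (use k * order_refl assms in auto)
  moreover have "f \<in> toric_ideal" unfolding f_def using binomial_in_toric assms m' by blast
  moreover have "f \<noteq> 0" using k by auto
  ultimately show ?thesis using initial_in_initial_ideal[OF toric_ideal_carrier, of f]
      by (simp add: initial_def)
qed

text \<open>The coefficients of \<open>f\<close> on the monomials with a given image add up to zero. So the leading
  monomial shares its image with another monomial of \<open>f\<close>, which is smaller.\<close>

lemma lead_nonstandard:
  assumes "f \<in> toric_ideal" "f \<noteq> 0" shows "\<not> standard (lead_monomial r f)"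
proof
  let ?m = "lead_monomial r f"
  assume s: "standard ?m"
  have f: "f \<in> carrier (poly_ring V)" using assms toric_ideal_carrier by auto
  note lm = lead_monomial[OF f assms(2)]
  have "u = ?m" if "u \<in> keys f" "push h u = push h ?m" for u
    using lm(2)[OF that(1)] s that f order_antisym by (auto simp: standard_def carrier_poly_ring)
  then have e: "{u \<in> keys f. push h u = push h ?m} = {?m}" using lm(1) by auto
  have "0 = lookup (\<Sum>m\<in>keys f. single (push h m) (lookup f m)) (push h ?m)"
    using assms(1) by (simp add: toric_ideal_def substitute_push)
  also have "\<dots> = lookup f ?m" by (simp add: lookup_sum_single e)
  finally show False using lm(1) by (simp add: in_keys_iff)
qed

lemma substitute_YZ_single:
  "substitute (\<lambda>v. Var (Y v)) (single m 1) = single (pair_mono m 0) (1 :: 'a::comm_ring_1)"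
  "substitute (\<lambda>v. Var (Z v)) (single m 1) = single (pair_mono 0 m) (1 :: 'a::comm_ring_1)"
  by (simp_all add: Var_def substitute_single mono_subst_push mult_single pair_mono_def)

text \<open>A monomial \<open>m\<close> lies in the secant ideal iff each term \<open>y\<^bsup>m1\<^esup> z\<^bsup>m2\<^esup>\<close> of \<open>(y + z)\<^bsup>m\<^esup>\<close> has a
  nonstandard factor, because all these terms occur with positive coefficients.\<close>

lemma secant_initial:
  "secant_ideal V (initial_ideal V r (toric_ideal :: ('v, 'a::field_char_0) mpoly set)) =
     {f \<in> carrier (poly_ring V). \<forall>m\<in>keys f. \<not> standard_sum m}"
proof (intro equalityI subsetI)
  let ?I = "initial_ideal V r (toric_ideal :: ('v, 'a) mpoly set)"
  have Iid: "ideal ?I (poly_ring V)" by (rule initial_ideal_ideal[OF toric_ideal_carrier])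
  have I: "?I \<subseteq> carrier (poly_ring V)" by (rule ideal_closed(1)[OF Iid])
  note J = ideal_closed[OF ambient_join_ideal[OF I]]
  {
    fix f :: "('v, 'a) mpoly" assume f: "f \<in> {f \<in> carrier (poly_ring V). \<forall>m\<in>keys f.
        \<not> standard_sum m}"
    have "single u (lookup (split_poly f) u) \<in> genideal (poly_ring (X ` V \<union> Y ` V \<union> Z `
        V)) (join_gens V ?I)"
      if u: "u \<in> keys (split_poly f)" for u
    proof -
      let ?c = "lookup (split_poly f) u"
      have "u \<in> monomials (Y ` V \<union> Z ` V)"
          using u f split_poly_carrier[of f V] by (auto simp: carrier_poly_ring)
      then obtain m1 m2 where m: "u = pair_mono m1 m2" "m1 \<in> monomials V"
          "m2 \<in> monomials V" by (rule monomials_pair_mono)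
      have "m1 + m2 \<in> keys f"
        using u lookup_split_poly[where 'a = 'a, of m1 m2] m(1) by (auto simp: in_keys_iff)
      then have "\<not> standard_sum (m1 + m2)" using f by auto
      then consider "\<not> standard m1" | "\<not> standard m2" by (auto simp: standard_sum_def)
      then show ?thesis
      proof cases
        case 1
        then have "substitute (\<lambda>v. Var (Y v)) (single m1 1) \<in> join_gens V ?I"
          using nonstandard_initial[OF m(2), where 'a = 'a] by (auto simp: join_gens_def[OF I])
        then have "single (pair_mono m1 0) 1 \<in> genideal (poly_ring (X ` V \<union> Y ` V \<union> Z `
            V)) (join_gens V ?I)"
          using ambient_join_gens[OF I] by (auto simp: substitute_YZ_single)
        moreover have "pair_mono 0 m2 \<in> monomials (X ` V \<union> Y ` V \<union> Z ` V)"
          using pair_mono_monomials[of 0 m2 V] m(3) by (auto simp: monomials_def)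
        ultimately have "single (pair_mono 0 m2) ?c * single (pair_mono m1 0) 1 \<in> genideal (poly_ring
            (X ` V \<union> Y ` V \<union> Z ` V)) (join_gens V ?I)"
          by (intro J(4) carrier_closed)
        then show ?thesis by (simp add: mult_single pair_mono_add m(1))
      next
        case 2
        then have "substitute (\<lambda>v. Var (Z v)) (single m2 1) \<in> join_gens V ?I"
          using nonstandard_initial[OF m(3), where 'a = 'a] by (auto simp: join_gens_def[OF I])
        then have "single (pair_mono 0 m2) 1 \<in> genideal (poly_ring (X ` V \<union> Y ` V \<union> Z `
            V)) (join_gens V ?I)"
          using ambient_join_gens[OF I] by (auto simp: substitute_YZ_single)
        moreover have "pair_mono m1 0 \<in> monomials (X ` V \<union> Y ` V \<union> Z ` V)"
          using pair_mono_monomials[of m1 0 V] m(2) by (auto simp: monomials_def)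
        ultimately have "single (pair_mono m1 0) ?c * single (pair_mono 0 m2) 1 \<in> genideal (poly_ring
            (X ` V \<union> Y ` V \<union> Z ` V)) (join_gens V ?I)"
          by (intro J(4) carrier_closed)
        then show ?thesis by (simp add: mult_single pair_mono_add m(1))
      qed
    qed
    then have "(\<Sum>u\<in>keys (split_poly f). single u (lookup (split_poly f) u))
        \<in> genideal (poly_ring (X ` V \<union> Y ` V \<union> Z ` V)) (join_gens V ?I)"
      by (rule ideal_sum[OF ambient_join_ideal[OF I]])
    then show "f \<in> secant_ideal V ?I"
      using secant_split[OF I] f by (simp add: poly_mapping_sum_single)
  next
    fix f :: "('v, 'a) mpoly" assume f: "f \<in> secant_ideal V ?I"
    have fc: "f \<in> carrier (poly_ring V)" using f by (simp add: secant_iff[OF I])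
    define K :: "('v tagged, 'a) mpoly set" where
      "K = {g \<in> carrier (poly_ring (Y ` V \<union> Z ` V)). \<forall>m1 m2. pair_mono m1 m2 \<in> keys
          g \<longrightarrow> \<not> (standard m1 \<and> standard m2)}"
    have K: "ideal K (poly_ring (Y ` V \<union> Z ` V))"
    proof (rule poly_idealI)
      show "K \<subseteq> carrier (poly_ring (Y ` V \<union> Z ` V))"
          "0 \<in> K" by (auto simp: K_def carrier_closed)
      show "f + g \<in> K" if "f \<in> K" "g \<in> K" for f g
        using that Poly_Mapping.keys_add[of f g] by (auto simp: K_def carrier_closed)
      show "g * f \<in> K" if "f \<in> K" and g: "g \<in> carrier (poly_ring (Y ` V \<union> Z ` V))" for f g
      proof -
        have f: "f \<in> carrier (poly_ring (Y ` V \<union> Z ` V))" using that by (simp add: K_def)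
        have "\<not> (standard m1 \<and> standard m2)" if m: "pair_mono m1 m2 \<in> keys (g * f)" for m1 m2
        proof -
          obtain a b where ab: "pair_mono m1 m2 = a + b" "a \<in> keys g" "b \<in> keys f"
            using m Poly_Mapping.keys_mult[of g f] by blast
          then obtain a1 a2 where a: "a = pair_mono a1 a2" "a1 \<in> monomials V" "a2 \<in> monomials V"
            using g monomials_pair_mono[of a V] by (auto simp: carrier_poly_ring)
          obtain b1 b2 where b: "b = pair_mono b1 b2" "b1 \<in> monomials V" "b2 \<in> monomials V"
            using f ab monomials_pair_mono[of b V] by (auto simp: carrier_poly_ring)
          have "\<not> (standard b1 \<and> standard b2)"
              using \<open>f \<in> K\<close> ab(3) b(1) by (auto simp: K_def)
          moreover have "m1 = b1 + a1" "m2 = b2 + a2"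
              using ab(1) by (simp_all add: a b pair_mono_add add.commute)
          ultimately show ?thesis using nonstandard_add a b by auto
        qed
        then show ?thesis using carrier_closed(4)[OF g f] by (auto simp: K_def)
      qed
    qed
    have sub: "?I \<subseteq> {g \<in> carrier (poly_ring V). substitute \<sigma> g \<in> K}"
      if \<sigma>: "\<sigma> = (\<lambda>v. Var (Y v)) \<or> \<sigma> = (\<lambda>v. Var (Z v))" for \<sigma>
      unfolding initial_ideal_def
    proof (rule poly_genideal(3)[OF initial_gens_carrier[OF toric_ideal_carrier]])
      show "ideal {g \<in> carrier (poly_ring V). substitute \<sigma> g \<in> K} (poly_ring V)"
        by (rule ideal_preimage[OF K]) (use \<sigma> in \<open>auto intro!: carrier_closed\<close>)
      show "{initial r f | f. f \<in> toric_ideal \<and>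
          f \<noteq> 0} \<subseteq> {g \<in> carrier (poly_ring V). substitute \<sigma> g \<in> K}"
      proof
        fix g :: "('v, 'a) mpoly" assume "g \<in> {initial r f | f. f \<in> toric_ideal \<and> f \<noteq> 0}"
        then obtain f :: "('v, 'a) mpoly" where f: "g = initial r f" "f \<in> toric_ideal"
            "f \<noteq> 0" by auto
        have "lead_monomial r f \<in> keys f" using lead_monomial(1) f toric_ideal_carrier by blast
        moreover have "f \<in> carrier (poly_ring V)" using f(2) toric_ideal_carrier by blast
        ultimately have "lead_monomial r f \<in> monomials V" by (auto simp: carrier_poly_ring)
        then show "g \<in> {g \<in> carrier (poly_ring V). substitute \<sigma> g \<in> K}"
          using \<sigma> lead_nonstandard[OF f(2,3)]
          by (auto simp: f(1) initial_def K_def substitute_YZ_single pair_mono_monomials intro!: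
              carrier_closed split: if_splits)
      qed
    qed
    have "split_poly f \<in> K"
      by (rule secant_split_in[OF I f K]) (use sub[of "\<lambda>v. Var (Y v)"] sub[of "\<lambda>v. Var (Z
          v)"] in auto)
    have "\<not> standard_sum m" if m: "m \<in> keys f" for m
    proof
      assume "standard_sum m"
      then obtain m1 m2 where s: "standard m1" "standard m2" "m = m1 + m2" by (auto simp: standard_sum_def)
      then have "pair_mono m1 m2 \<in> keys (split_poly f)"
        using lookup_split_poly[where 'a = 'a, of m1 m2] m by (auto simp: in_keys_iff)
      then show False using \<open>split_poly f \<in> K\<close> s by (auto simp: K_def)
    qed
    with fc show "f \<in> {f \<in> carrier (poly_ring V). \<forall>m\<in>keys f. \<not> standard_sum m}" by auto
  }
qed

abbreviation secant_map :: "('v, 'a::field_char_0) mpoly \<Rightarrow> ('w tagged, 'a) mpoly" where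
  "secant_map \<equiv> substitute (\<lambda>v. single (pair_mono (h v) 0) 1 + single (pair_mono 0 (h v)) 1)"

text \<open>The exponent vectors of the images of \<open>y\<close> and \<open>z\<close> under the parametrization of the secant
  variety, with separate copies \<open>Y a\<close> and \<open>Z a\<close> of the parameters. The value at \<open>X v\<close> is
  arbitrary.\<close>

definition tagged_deg :: "'v tagged \<Rightarrow> 'w tagged monomial" where
  "tagged_deg t = (case t of X v \<Rightarrow> 0 | Y v \<Rightarrow> pair_mono (h v) 0 | Z v \<Rightarrow>
      pair_mono 0 (h v))"

lemma push_tagged_deg: "push tagged_deg (pair_mono m1 m2) = pair_mono (push h m1) (push h m2)"
  unfolding pair_mono_def[of m1 m2] push_add push_push push_single
  by (simp add: tagged_deg_def push_pair pair_mono_add)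

lemma secant_map_split: "secant_map f = substitute (\<lambda>t. single (tagged_deg t) 1) (split_poly f)"
  by (simp add: substitute_substitute tagged_deg_def)

text \<open>A linear combination of monomials that cancels still cancels after relabelling the
  monomials.\<close>

lemma sum_single_collapse:
  assumes "(\<Sum>u\<in>S. single (g u) (c u :: 'a::comm_ring_1)) = 0" "finite S"
  shows "(\<Sum>u\<in>S. single (R (g u)) (c u)) = 0"
proof (rule poly_mapping_eqI)
  fix w
  have z: "(\<Sum>u\<in>{u\<in>S. g u = t}. c u) = 0" for t
    using arg_cong[OF assms(1), of "\<lambda>p. lookup p t"] by (simp add: lookup_sum_single assms(2))
  have "(\<Sum>u\<in>{u\<in>S. R (g u) = w}. c u) = (\<Sum>t\<in>g ` {u\<in>S. R (g u)
      = w}. \<Sum>u\<in>{x\<in>{u\<in>S. R (g u) = w}. g x = t}. c u)"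
    by (rule sum.image_gen) (simp add: assms(2))
  also have "\<dots> = 0"
  proof (rule sum.neutral, safe)
    fix u assume "u \<in> S"
    have "{x\<in>{v\<in>S. R (g v) = R (g u)}. g x = g u} = {x\<in>S. g x = g u}" by auto
    then show "(\<Sum>u\<in>{x\<in>{v\<in>S. R (g v) = R (g u)}. g x = g u}. c u) = 0" using z by simp
  qed
  finally show "lookup (\<Sum>u\<in>S. single (R (g u)) (c u)) w = lookup 0 w"
    by (simp add: lookup_sum_single assms(2))
qed

text \<open>One direction holds because the substitution kills the generators. For the converse, replace
  every term \<open>y\<^bsup>m1\<^esup> z\<^bsup>m2\<^esup>\<close> of \<open>f(y + z)\<close> by a chosen representative with the same image. This
  does not change the class modulo the ideal, and the representatives of terms with the same
  image cancel.\<close>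

lemma secant_toric_iff:
  "f \<in> secant_ideal V (toric_ideal :: ('v, 'a::field_char_0) mpoly set) \<longleftrightarrow> f \<in>
      carrier (poly_ring V) \<and> secant_map f = 0"
proof -
  let ?I = "toric_ideal :: ('v, 'a) mpoly set"
  note I = toric_ideal_carrier[where 'a = 'a]
  note J = ideal_closed[OF ambient_join_ideal[OF I]]
  let ?J = "genideal (poly_ring (X ` V \<union> Y ` V \<union> Z ` V)) (join_gens V ?I)"
  show ?thesis
  proof (intro iffI conjI)
    assume f: "f \<in> secant_ideal V ?I"
    then show "f \<in> carrier (poly_ring V)" by (simp add: secant_iff[OF I])
    let ?K = "{g \<in> carrier (poly_ring (Y ` V \<union> Z ` V)). substitute (\<lambda>t. single
        (tagged_deg t) (1::'a)) g \<in> {0}}"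
    have K: "ideal ?K (poly_ring (Y ` V \<union> Z ` V))"
      by (rule ideal_preimage[OF ideal_zero[of UNIV]]) (simp add: carrier_poly_ring monomials_def)
    have s: "substitute (\<lambda>v. Var (Y v)) g \<in> ?K"
        "substitute (\<lambda>v. Var (Z v)) g \<in> ?K" if "g \<in> ?I" for g
    proof -
      have g: "g \<in> carrier (poly_ring V)" "substitute (\<lambda>v. single (h v) 1) g = 0"
        using that by (auto simp: toric_ideal_def)
      have "substitute (\<lambda>t. single (tagged_deg t) (1::'a)) (substitute (\<lambda>v. Var (Y v)) g)
          = substitute (\<lambda>v. Var (Y v)) (substitute (\<lambda>v. single (h v) 1) g)"
        "substitute (\<lambda>t. single (tagged_deg t) (1::'a)) (substitute (\<lambda>v. Var (Z v)) g)
          = substitute (\<lambda>v. Var (Z v)) (substitute (\<lambda>v. single (h v) 1) g)"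
        by (simp_all add: substitute_substitute substitute_YZ_single tagged_deg_def)
      moreover have "substitute (\<lambda>v. Var (Y v)) g \<in> carrier (poly_ring (Y ` V \<union> Z ` V))"
        "substitute (\<lambda>v. Var (Z v)) g \<in> carrier (poly_ring (Y ` V \<union> Z ` V))"
        by (rule carrier_substitute[OF g(1)]; auto intro!: carrier_closed)+
      ultimately show "substitute (\<lambda>v. Var (Y v)) g \<in> ?K"
          "substitute (\<lambda>v. Var (Z v)) g \<in> ?K" using g by auto
    qed
    from secant_split_in[OF I f K s] show "secant_map f = 0" by (simp add: secant_map_split)
  next
    assume f: "f \<in> carrier (poly_ring V) \<and> secant_map f = 0"
    let ?F = "split_poly f"
    define \<rho> where "\<rho> d = (SOME m. m \<in> monomials V \<and> push h m = d)" for d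
    have \<rho>: "\<rho> (push h m) \<in> monomials V"
        "push h (\<rho> (push h m)) = push h m" if "m \<in> monomials V" for m
      using someI[of "\<lambda>m'. m' \<in> monomials V \<and> push h m' = push h m" m] that
          by (auto simp: \<rho>_def)
    \<comment> \<open>the chosen representative of all terms with the image \<open>t\<close>\<close>
    define R where "R t = (THE u. \<exists>d1 d2. t = pair_mono d1 d2 \<and>
        u = pair_mono (\<rho> d1) (\<rho> d2))" for t
    have R: "R (pair_mono d1 d2) = pair_mono (\<rho> d1) (\<rho> d2)" for d1 d2
      unfolding R_def by (rule the_equality) auto
    have Y: "single (pair_mono m1 0) 1 - single (pair_mono m1' 0) 1 \<in> ?J" 
      "single (pair_mono 0 m1) 1 - single (pair_mono 0 m1') 1 \<in> ?J"
      if "m1 \<in> monomials V" "m1' \<in> monomials V" "push h m1' = push h m1" for m1 m1'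
    proof -
      have b: "single m1 1 - single m1' 1 \<in> ?I" using binomial_in_toric that by blast
      have "substitute (\<lambda>v. Var (Y v)) (single m1 1 - single m1' 1) \<in> join_gens V ?I"
        "substitute (\<lambda>v. Var (Z v)) (single m1 1 - single m1' 1) \<in> join_gens V ?I"
        unfolding join_gens_def[OF I] using b by blast+
      then show "single (pair_mono m1 0) 1 - single (pair_mono m1' 0) 1 \<in> ?J" 
        "single (pair_mono 0 m1) 1 - single (pair_mono 0 m1') 1 \<in> ?J"
        using ambient_join_gens[OF I] by (auto simp: substitute_YZ_single)
    qed
    have "single u c - single (R (push tagged_deg u)) c \<in> ?J" if u: "u \<in> keys ?F" for u c
    proof -
      have "u \<in> monomials (Y ` V \<union> Z ` V)"
          using u f split_poly_carrier[of f V] by (auto simp: carrier_poly_ring)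
      then obtain m1 m2 where m: "u = pair_mono m1 m2" "m1 \<in> monomials V"
          "m2 \<in> monomials V" by (rule monomials_pair_mono)
      let ?m1 = "\<rho> (push h m1)" and ?m2 = "\<rho> (push h m2)"
      have in1: "pair_mono 0 m2 \<in> monomials (X ` V \<union> Y ` V \<union> Z ` V)"
          "pair_mono ?m1 0 \<in> monomials (X ` V \<union> Y ` V \<union> Z ` V)"
        using pair_mono_monomials[of 0 m2 V] pair_mono_monomials[of ?m1 0 V] m \<rho>(1)
            by (auto simp: monomials_def)
      have "single (pair_mono 0 m2) c * (single (pair_mono m1 0) 1 - single (pair_mono ?m1 0) 1)
         + single (pair_mono ?m1 0) c * (single (pair_mono 0 m2) 1 - single (pair_mono 0 ?m2) 1) \<in> ?J"
        by (intro J(3,4) Y carrier_closed in1 m \<rho>)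
      moreover have "single (pair_mono 0 m2) c * (single (pair_mono m1 0) 1 - single (pair_mono ?m1 0) 1)
         + single (pair_mono ?m1 0) c * (single (pair_mono 0 m2) 1 - single (pair_mono 0 ?m2) 1)
         = single u c - single (R (push tagged_deg u)) c"
        by (simp add: right_diff_distrib mult_single pair_mono_add m(1) push_tagged_deg R)
      ultimately show ?thesis by simp
    qed
    then have 1: "(\<Sum>u\<in>keys ?F. single u (lookup ?F u) - single (R (push tagged_deg u)) (lookup ?F
        u)) \<in> ?J"
      by (intro ideal_sum[OF ambient_join_ideal[OF I]])
    have "(\<Sum>u\<in>keys ?F. single (push tagged_deg u) (lookup ?F u)) = 0"
      using f by (simp add: secant_map_split substitute_push)
    then have "(\<Sum>u\<in>keys ?F. single (R (push tagged_deg u)) (lookup ?F u)) = 0"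
      by (rule sum_single_collapse) simp
    with 1 have "?F \<in> ?J" by (simp add: sum_subtractf poly_mapping_sum_single)
    then show "f \<in> secant_ideal V ?I" using secant_split[OF I] f by blast
  qed
qed

text \<open>Suppose that the leading monomial is \<open>m1 + m2\<close> with standard summands, and consider the
  coefficient of the image of \<open>y\<^bsup>m1\<^esup> z\<^bsup>m2\<^esup>\<close>. Any other term \<open>y\<^bsup>u1\<^esup> z\<^bsup>u2\<^esup>\<close> with this image has
  \<open>u1 \<ge> m1\<close> and \<open>u2 \<ge> m2\<close>, so \<open>u1 + u2\<close> would exceed the leading monomial. Hence this
  coefficient cannot cancel.\<close>

lemma lead_secant:
  assumes f: "f \<in> secant_ideal V (toric_ideal :: ('v, 'a::field_char_0) mpoly set)" and "f \<noteq> 0"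
  shows "\<not> standard_sum (lead_monomial r f)"
proof
  let ?m = "lead_monomial r f" and ?F = "split_poly f"
  assume "standard_sum ?m"
  then obtain m1 m2 where s: "standard m1" "standard m2" "?m = m1 + m2" by (auto simp: standard_sum_def)
  have fc: "f \<in> carrier (poly_ring V)" and T: "secant_map f = 0" using f secant_toric_iff by auto
  note lm = lead_monomial[OF fc \<open>f \<noteq> 0\<close>]
  obtain N where N: "0 < N" "\<And>f :: ('v, 'a) mpoly. lookup (split_poly f) (pair_mono m1 m2)
      = lookup f (m1 + m2) * of_nat N"
    using lookup_split_poly by blast
  have ne: "lookup ?F (pair_mono m1 m2) \<noteq> 0" using N lm(1) s(3) by (simp add: in_keys_iff)
  have uniq: "u = pair_mono m1 m2" if u: "u \<in> keys ?F"
      "push tagged_deg u = pair_mono (push h m1) (push h m2)" for u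
  proof -
    have "u \<in> monomials (Y ` V \<union> Z ` V)"
        using u fc split_poly_carrier[of f V] by (auto simp: carrier_poly_ring)
    then obtain u1 u2 where uu: "u = pair_mono u1 u2" "u1 \<in> monomials V"
        "u2 \<in> monomials V" by (rule monomials_pair_mono)
    have "push h u1 = push h m1" "push h u2 = push h m2" using u(2) by (simp_all add: uu(1) push_tagged_deg)
    then have le: "(m1, u1) \<in> r" "(m2, u2) \<in> r" using s uu by (auto simp: standard_def)
    have "u1 + u2 \<in> keys f"
      using u(1) lookup_split_poly[where 'a = 'a, of u1 u2] uu(1) by (auto simp: in_keys_iff)
    then have 1: "(u1 + u2, m1 + m2) \<in> r" using lm(2) s(3) by metis
    have 2: "(m1 + m2, m1 + u2) \<in> r" using order_add[OF standard_monomials[OF s(1)] le(2)]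
        by (simp add: add.commute)
    have 3: "(m1 + u2, u1 + u2) \<in> r" using order_add[OF uu(3) le(1)] .
    have "m1 + m2 = m1 + u2" using 2 order_trans[OF 3 1] order_antisym by blast
    moreover have "m1 + u2 = u1 + u2" using 3 order_trans[OF 1 2] order_antisym by blast
    ultimately show ?thesis using uu(1) by simp
  qed
  have "pair_mono m1 m2 \<in> keys ?F" using ne by (simp add: in_keys_iff)
  then have e: "{u \<in> keys ?F. push tagged_deg u = pair_mono (push h m1) (push h m2)} = {pair_mono m1 m2}"
    using uniq push_tagged_deg[of m1 m2] by blast
  have "0 = lookup (\<Sum>u\<in>keys ?F. single (push tagged_deg u) (lookup ?F u)) (pair_mono (push h m1)
      (push h m2))"
    using T by (simp add: secant_map_split substitute_push)
  also have "\<dots> = lookup ?F (pair_mono m1 m2)" by (simp add: lookup_sum_single e)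
  finally show False using ne by simp
qed

text \<open>The initial terms of \<open>G\<close> generate a subideal of the initial ideal of the secant ideal, which
  by \<open>lead_secant\<close> lies in the span of the monomials that are not sums of two standard ones.
  The hypothesis \<open>cover\<close> closes this circle of inclusions.\<close>

theorem delightful_groebner:
  fixes G :: "('v, 'a::field_char_0) mpoly set"
  assumes G: "finite G" "G \<subseteq> secant_ideal V toric_ideal"
    and cover: "\<And>m. m \<in> monomials V \<Longrightarrow> \<not> standard_sum m \<Longrightarrow>
        \<exists>g\<in>G. g \<noteq> 0 \<and> (\<exists>u. m = u + lead_monomial r g)"
  shows "delightful2 V r (toric_ideal :: ('v, 'a) mpoly set) \<and>
      groebner_basis V r G (secant_ideal V toric_ideal)"
proof -
  let ?I = "toric_ideal :: ('v, 'a) mpoly set"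
  let ?S = "secant_ideal V ?I"
  let ?N = "{f \<in> carrier (poly_ring V). \<forall>m\<in>keys f. \<not> standard_sum m} :: ('v, 'a) mpoly set"
  let ?inG = "{initial r g | g. g \<in> G \<and> g \<noteq> 0}"
  have Sc: "?S \<subseteq> carrier (poly_ring V)" using secant_iff[OF toric_ideal_carrier] by blast
  have standard_sum_add: "\<not> standard_sum (u + m)" if "\<not> standard_sum m"
      "u + m \<in> monomials V" for u m
  proof
    assume "standard_sum (u + m)"
    then obtain m1 m2 where s: "standard m1" "standard m2" "u + m = m1 + m2" by (auto simp: standard_sum_def)
    \<comment> \<open>divide \<open>m = k1 + (m - k1)\<close> such that the two parts divide
        \<open>m1\<close> and \<open>m2\<close>\<close>
    define k1 where "k1 = Poly_Mapping.mapp (\<lambda>v e. min e (lookup m1 v)) m"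
    have k1: "lookup k1 v = min (lookup m v) (lookup m1 v)" for v
      by (simp add: k1_def lookup_mapp when_def in_keys_iff)
    have l: "lookup u v + lookup m v = lookup m1 v + lookup m2 v" for v
      using arg_cong[OF s(3), of "\<lambda>p. lookup p v"] by (simp add: lookup_add)
    have e1: "m = k1 + (m - k1)" by (rule poly_mapping_eqI) (simp add: lookup_add lookup_minus k1)
    have e2: "m1 = k1 + (m1 - k1)" by (rule poly_mapping_eqI) (simp add: lookup_add lookup_minus k1)
    have e3: "m2 = (m - k1) + (m2 - (m - k1))"
    proof (rule poly_mapping_eqI)
      fix v show "lookup m2 v = lookup ((m - k1) + (m2 - (m - k1))) v"
        using l[of v] by (simp add: lookup_add lookup_minus k1)
    qed
    have "k1 \<in> monomials V" "m1 - k1 \<in> monomials V" "m - k1 \<in> monomials V"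
        "m2 - (m - k1) \<in> monomials V"
      using e2 e3 s(1,2) standard_monomials monomials_add_iff by metis+
    then have "standard k1" "standard (m - k1)"
      using nonstandard_add e2 e3 s(1,2) by metis+
    then show False using that(1) e1 by (auto simp: standard_sum_def)
  qed
  have Nid: "ideal ?N (poly_ring V)"
  proof (rule poly_idealI)
    show "f + g \<in> ?N" if "f \<in> ?N" "g \<in> ?N" for f g
      using that Poly_Mapping.keys_add[of f g] by (auto simp: carrier_closed)
    show "g * f \<in> ?N" if f: "f \<in> ?N" and g: "g \<in> carrier (poly_ring V)" for f g
    proof -
      have gf: "g * f \<in> carrier (poly_ring V)" using f g by (auto intro: carrier_closed)
      have "\<not> standard_sum m" if m: "m \<in> keys (g * f)" for m
      proof -
        obtain a b where ab: "m = a + b" "b \<in> keys f" using m Poly_Mapping.keys_mult[of g f] by blast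
        have "a + b \<in> monomials V" using gf m ab by (auto simp: carrier_poly_ring)
        then show ?thesis using standard_sum_add f ab by auto
      qed
      with gf show ?thesis by auto
    qed
  qed (auto simp: carrier_closed)
  have Gc: "?inG \<subseteq> carrier (poly_ring V)" by (rule initial_gens_carrier) (use G Sc in auto)
  have 1: "genideal (poly_ring V) ?inG \<subseteq> initial_ideal V r ?S"
    using initial_in_initial_ideal[OF Sc] G by (intro poly_genideal(3)[OF Gc initial_ideal_ideal[OF Sc]]) auto
  have 2: "initial_ideal V r ?S \<subseteq> ?N"
    unfolding initial_ideal_def
  proof (rule poly_genideal(3)[OF initial_gens_carrier[OF Sc] Nid])
    show "{initial r f | f. f \<in> ?S \<and> f \<noteq> 0} \<subseteq> ?N"
    proof
      fix g assume g: "g \<in> {initial r f | f. f \<in> ?S \<and> f \<noteq> 0}"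
      then obtain f where f: "g = initial r f" "f \<in> ?S" "f \<noteq> 0" by blast
      have "\<not> standard_sum (lead_monomial r f)" by (rule lead_secant[OF f(2,3)])
      then have "\<forall>m\<in>keys g. \<not> standard_sum m" by (simp add: f(1) initial_def)
      with g initial_gens_carrier[OF Sc] show "g \<in> ?N" by blast
    qed
  qed
  have 3: "?N \<subseteq> genideal (poly_ring V) ?inG"
  proof
    fix f assume f: "f \<in> ?N"
    have "single m (lookup f m) \<in> genideal (poly_ring V) ?inG" if m: "m \<in> keys f" for m
    proof -
      have mV: "m \<in> monomials V" "\<not> standard_sum m" using f m by (auto simp: carrier_poly_ring)
      then obtain g u where g: "g \<in> G" "g \<noteq> 0" "m = u + lead_monomial r g" using cover by blast
      have "initial r g \<in> genideal (poly_ring V) ?inG" using poly_genideal(2)[OF Gc] g by blast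
      moreover have "u \<in> monomials V" using mV g(3) monomials_add_iff by blast
      ultimately have "single u (lookup f m) * initial r g \<in> genideal (poly_ring V) ?inG"
        by (intro ideal_closed(4)[OF poly_genideal(1)[OF Gc]] carrier_closed)
      then show ?thesis by (simp add: initial_def mult_single g(3))
    qed
    then have "(\<Sum>m\<in>keys f. single m (lookup f m)) \<in> genideal (poly_ring V) ?inG"
      by (rule ideal_sum[OF poly_genideal(1)[OF Gc]])
    then show "f \<in> genideal (poly_ring V) ?inG" by (simp add: poly_mapping_sum_single)
  qed
  from 1 2 3 have "initial_ideal V r ?S = ?N" "initial_ideal V r ?S = genideal (poly_ring V) ?inG" by auto
  then show ?thesis unfolding delightful2_def groebner_basis_def secant_initial using G by auto
qed

end

section \<open>Block orders\<close>

lemma lookup_restrict: "lookup (restrict_monomial B m) v = (if v \<in> B then lookup m v else 0)"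
  by (simp add: restrict_monomial_def lookup_mapp when_def in_keys_iff)

lemma restrict_add: "restrict_monomial B (m + m') = restrict_monomial B m + restrict_monomial B m'"
  by (rule poly_mapping_eqI) (simp add: lookup_restrict lookup_add)

lemma restrict_monomials: "restrict_monomial B m \<in> monomials B"
  by (auto simp: monomials_def in_keys_iff lookup_restrict split: if_splits)

lemma restrict_inject:
  assumes "m \<in> monomials (\<Union>d\<in>D. B d)" "m' \<in> monomials (\<Union>d\<in>D. B d)" 
    and "\<And>d. d \<in> D \<Longrightarrow> restrict_monomial (B d) m = restrict_monomial (B d) m'"
  shows "m = m'"
proof (rule poly_mapping_eqI)
  fix v
  show "lookup m v = lookup m' v"
  proof (cases "v \<in> (\<Union>d\<in>D. B d)")
    case True
    then obtain d where d: "d \<in> D" "v \<in> B d" by auto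
    from arg_cong[OF assms(3)[OF d(1)], of "\<lambda>u. lookup u v"] d(2) show ?thesis
      by (simp add: lookup_restrict)
  next
    case False
    then have "v \<notin> keys m" "v \<notin> keys m'" using assms(1,2) unfolding monomials_def by blast+
    then show ?thesis by (simp add: in_keys_iff)
  qed
qed

locale blocks =
  fixes p :: nat and B :: "nat \<Rightarrow> 'v set" and t :: "nat \<Rightarrow> 'v monomial rel"
  assumes t: "\<And>d. d \<in> {1..p} \<Longrightarrow> term_order (B d) (t d)"
begin

abbreviation "V \<equiv> (\<Union>d\<in>{1..p}. B d)"

definition above :: "nat \<Rightarrow> 'v monomial \<Rightarrow> 'v monomial \<Rightarrow> bool" where
  "above d m m' \<longleftrightarrow> d \<in> {1..p} \<and>
      (\<forall>e\<in>{1..<d}. restrict_monomial (B e) m = restrict_monomial (B e) m') \<and>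
     restrict_monomial (B d) m \<noteq> restrict_monomial (B d) m' \<and>
         (restrict_monomial (B d) m, restrict_monomial (B d) m') \<in> t d"

lemma block_order_iff:
  "(m, m') \<in> block_order p B t \<longleftrightarrow> m \<in> monomials V \<and>
      m' \<in> monomials V \<and> (m = m' \<or> (\<exists>d. above d m m'))"
  unfolding block_order_def above_def by blast

lemma block_props: 
  assumes "d \<in> {1..p}"
  shows "antisym (t d)" "trans (t d)" "total_on (monomials (B d)) (t d)"
      "m \<in> monomials (B d) \<Longrightarrow> (0, m) \<in> t d"
    "u \<in> monomials (B d) \<Longrightarrow> (m, m') \<in> t d \<Longrightarrow> (m + u, m' + u) \<in> t d"
  using t[OF assms] unfolding term_order_def linear_order_on_def partial_order_on_def preorder_on_def by blast+

lemma above_trans: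
  assumes "above d m m'" "above e m' m''" shows "above (min d e) m m''"
proof -
  consider "d < e" | "d = e" | "e < d" by linarith
  then show ?thesis
  proof cases
    case 1
    then show ?thesis using assms unfolding above_def by auto
  next
    case 2
    have d: "d \<in> {1..p}" using assms by (simp add: above_def)
    have "(restrict_monomial (B d) m, restrict_monomial (B d) m'') \<in> t d" 
      using assms 2 transD[OF block_props(2)[OF d]] unfolding above_def by blast
    moreover have "restrict_monomial (B d) m \<noteq> restrict_monomial (B d) m''"
      using assms 2 antisymD[OF block_props(1)[OF d]] unfolding above_def by metis
    ultimately show ?thesis using assms 2 unfolding above_def by auto
  next
    case 3
    then show ?thesis using assms unfolding above_def by auto
  qed
qed

lemma above_asym: "above d m m' \<Longrightarrow> \<not> above e m' m"
proof
  assume "above d m m'" "above e m' m"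
  from above_trans[OF this] show False unfolding above_def by simp
qed

lemma above_total:
  assumes "m \<in> monomials V" "m' \<in> monomials V" "m \<noteq> m'"
  shows "\<exists>d. above d m m' \<or> above d m' m"
proof -
  let ?P = "\<lambda>d. d \<in> {1..p} \<and> restrict_monomial (B d) m \<noteq> restrict_monomial (B d) m'"
  have "\<exists>d. ?P d" using restrict_inject[where D = "{1..p}" and B = B and m = m and m'
      = m'] assms by blast
  define d where "d = (LEAST d. ?P d)"
  have d: "?P d" unfolding d_def by (rule LeastI_ex) fact
  have "\<not> ?P e" if "e < d" for e using that unfolding d_def by (rule not_less_Least)
  then have e: "restrict_monomial (B e) m = restrict_monomial (B e) m'" if "e \<in> {1..<d}" for e
    using that d by auto
  have "(restrict_monomial (B d) m, restrict_monomial (B d) m') \<in> t d \<or>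
      (restrict_monomial (B d) m', restrict_monomial (B d) m) \<in> t d"
  proof -
    have "\<forall>x\<in>monomials (B d). \<forall>y\<in>monomials (B d). x \<noteq> y \<longrightarrow>
        (x, y) \<in> t d \<or> (y, x) \<in> t d"
      using block_props(3)[OF conjunct1[OF d]] unfolding total_on_def .
    from bspec[OF bspec[OF this restrict_monomials] restrict_monomials] d show ?thesis by simp
  qed
  then have "above d m m' \<or> above d m' m"
  proof
    assume "(restrict_monomial (B d) m, restrict_monomial (B d) m') \<in> t d"
    then have "above d m m'" unfolding above_def using d e by blast
    then show ?thesis ..
  next
    assume "(restrict_monomial (B d) m', restrict_monomial (B d) m) \<in> t d"
    moreover have "\<forall>x\<in>{1..<d}. restrict_monomial (B x) m' = restrict_monomial (B x) m"
        using e by simp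
    ultimately have "above d m' m" unfolding above_def using conjunct1[OF d] not_sym[OF conjunct2[OF d]] by simp
    then show ?thesis ..
  qed
  then show ?thesis ..
qed

lemma above_add:
  assumes "above d m m'" shows "above d (m + u) (m' + u)"
  using assms block_props(5)[of d "restrict_monomial (B d) u"] restrict_monomials
      unfolding above_def by (auto simp: restrict_add)

lemma block_term_order: "term_order V (block_order p B t)"
  unfolding term_order_def linear_order_on_def partial_order_on_def preorder_on_def
proof (intro conjI ballI allI impI)
  let ?r = "block_order p B t"
  show "?r \<subseteq> monomials V \<times> monomials V" by (auto simp: block_order_iff)
  show "refl_on (monomials V) ?r" by (auto simp: refl_on_def block_order_iff)
  show "trans ?r" 
  proof (rule transI)
    fix a b c assume "(a, b) \<in> ?r" "(b, c) \<in> ?r"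
    then show "(a, c) \<in> ?r" unfolding block_order_iff using above_trans by blast
  qed
  show "antisym ?r"
  proof (rule antisymI)
    fix a b assume "(a, b) \<in> ?r" "(b, a) \<in> ?r"
    then show "a = b" unfolding block_order_iff using above_asym by blast
  qed
  show "total_on (monomials V) ?r"
    unfolding total_on_def block_order_iff using above_total by blast
  show "(0, m) \<in> ?r" if m: "m \<in> monomials V" for m
  proof (cases "m = 0")
    case True
    then show ?thesis using m by (simp add: block_order_iff)
  next
    case False
    have z: "(0::'v monomial) \<in> monomials V" by (simp add: monomials_def)
    have "\<not> above d m 0" for d
    proof
      assume a: "above d m 0"
      have "restrict_monomial (B d) 0 = (0 :: 'v monomial)"
          by (rule poly_mapping_eqI) (simp add: lookup_restrict)
      then show False using a block_props(1,4)[of d] restrict_monomials[of "B d" m]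
          unfolding above_def by (metis antisymD)
    qed
    then have "\<exists>d. above d 0 m" using above_total[OF m z False] by blast
    then show ?thesis using m z by (simp add: block_order_iff)
  qed
  show "(m + u, m' + u) \<in> ?r" if "u \<in> monomials V" "(m, m') \<in> ?r" for m m' u
    using that above_add Poly_Mapping.keys_add[of m u] Poly_Mapping.keys_add[of m' u] unfolding block_order_iff
    by (auto simp: monomials_def subset_iff) blast+
qed

text \<open>The blocks are compared in order, so it is enough that every variable of \<open>b\<close> is preceded by
  a variable of \<open>a\<close> from an earlier block: the first block that \<open>a\<close> meets then decides.\<close>

lemma block_order_greater:
  assumes "a \<in> monomials V" "b \<in> monomials V" "a \<noteq> 0" 
    and disj: "\<And>d e. d \<in> {1..p} \<Longrightarrow> e \<in> {1..p} \<Longrightarrow>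
        d \<noteq> e \<Longrightarrow> B d \<inter> B e = {}"
    and less: "\<And>w d. w \<in> keys b \<Longrightarrow> d \<in> {1..p} \<Longrightarrow>
        w \<in> B d \<Longrightarrow> \<exists>v\<in>keys a. \<exists>e\<in>{1..<d}. v \<in> B e"
  shows "(b, a) \<in> block_order p B t" "b \<noteq> a"
proof -
  let ?P = "\<lambda>d. d \<in> {1..p} \<and> keys a \<inter> B d \<noteq> {}"
  obtain v where "v \<in> keys a" using assms(3) by (metis all_not_in_conv keys_eq_empty)
  then have "\<exists>d. ?P d" using assms(1) unfolding monomials_def by blast
  define d where "d = (LEAST d. ?P d)"
  have d: "?P d" unfolding d_def by (rule LeastI_ex) fact
  have min: "\<not> ?P e" if "e < d" for e using that unfolding d_def by (rule not_less_Least)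
  have bz: "restrict_monomial (B e) b = 0" if e: "e \<in> {1..p}" "e \<le> d" for e
  proof (rule poly_mapping_eqI)
    fix w
    have "\<not> (w \<in> keys b \<and> w \<in> B e)"
    proof
      assume "w \<in> keys b \<and> w \<in> B e"
      then obtain v e' where "v \<in> keys a" "e' \<in> {1..<e}" "v \<in> B e'" using less e by blast
      then show False using min[of e'] e by auto
    qed
    then show "lookup (restrict_monomial (B e) b) w = lookup 0 w"
      by (auto simp: lookup_restrict in_keys_iff)
  qed
  have az: "restrict_monomial (B e) a = 0" if e: "e \<in> {1..<d}" for e
  proof (rule poly_mapping_eqI)
    fix w
    have "\<not> ?P e" using min e by simp
    then have "\<not> (w \<in> keys a \<and> w \<in> B e)" using e d by auto
    then show "lookup (restrict_monomial (B e) a) w = lookup 0 w"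
      by (auto simp: lookup_restrict in_keys_iff)
  qed
  obtain v where v: "v \<in> keys a" "v \<in> B d" using d by blast
  have "lookup (restrict_monomial (B d) a) v \<noteq> 0" using v by (simp add: lookup_restrict in_keys_iff)
  then have anz: "restrict_monomial (B d) a \<noteq> 0" by auto
  have "above d b a" unfolding above_def
  proof (intro conjI ballI)
    show "d \<in> {1..p}" using d by blast
    show "restrict_monomial (B e) b = restrict_monomial (B e) a" if "e \<in> {1..<d}" for e
      using bz[of e] az[OF that] that d by simp
    show "restrict_monomial (B d) b \<noteq> restrict_monomial (B d) a" using bz[of d] anz d by simp
    show "(restrict_monomial (B d) b, restrict_monomial (B d) a) \<in> t d"
        using bz[of d] block_props(4)[of d, OF _ restrict_monomials[of "B d" a]] d by simp
  qed
  then show "(b, a) \<in> block_order p B t"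
      "b \<noteq> a" using assms(1,2) by (auto simp: block_order_iff above_def)
qed

end

section \<open>Circular term orders\<close>

lemma edge_class_Union: 
  assumes "2 \<le> n" shows "(\<Union>d\<in>{1..n div 2}. edge_class n d) = edges n"
proof (intro equalityI subsetI)
  fix E assume "E \<in> edges n"
  then obtain a b where ab: "E = {a, b}" "1 \<le> a" "a < b" "b \<le> n" unfolding edges_def by blast
  define x where "x = b - a"
  have x: "1 \<le> x" "x < n" using ab by (auto simp: x_def)
  have "1 \<le> min x (n - x)" "2 * min x (n - x) \<le> n" using x by linarith+
  then have "min x (n - x) \<in> {1..n div 2}" by simp
  then have "min (b - a) (n - (b - a)) \<in> {1..n div 2}" by (simp add: x_def)
  moreover have "E \<in> edge_class n (min (b - a) (n - (b - a)))" using ab unfolding edge_class_def by blast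
  ultimately show "E \<in> (\<Union>d\<in>{1..n div 2}. edge_class n d)" by blast
qed (auto simp: edge_class_def edges_def)

definition cdist :: "nat \<Rightarrow> nat \<Rightarrow> nat \<Rightarrow> nat" where
  "cdist n a b = min (max a b - min a b) (n - (max a b - min a b))"

lemma edge_class_iff_less:
  assumes "1 \<le> a" "a < b" "b \<le> n"
  shows "{a, b} \<in> edge_class n d \<longleftrightarrow> cdist n a b = d"
proof
  assume "{a, b} \<in> edge_class n d"
  then obtain a' b' where ab: "{a, b} = {a', b'}" "a' < b'"
      "min (b' - a') (n - (b' - a')) = d" unfolding edge_class_def by blast
  then have "a' = a" "b' = b" using assms(2) by (auto simp: doubleton_eq_iff)
  then show "cdist n a b = d" using ab(3) assms(2) by (simp add: cdist_def)
next
  assume "cdist n a b = d"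
  then have "min (b - a) (n - (b - a)) = d" using assms(2) by (simp add: cdist_def)
  then show "{a, b} \<in> edge_class n d" using assms unfolding edge_class_def by blast
qed

lemma cdist_commute: "cdist n a b = cdist n b a"
  by (simp add: cdist_def max.commute min.commute)

lemma edge_class_iff:
  assumes "a \<in> {1..n}" "b \<in> {1..n}" "a \<noteq> b"
  shows "{a, b} \<in> edge_class n d \<longleftrightarrow> cdist n a b = d"
  using assms edge_class_iff_less[of a b n d] edge_class_iff_less[of b a n d] cdist_commute[of n a b]
  by (cases "a < b") (auto simp: insert_commute)

lemma edge_class_disjoint: "d \<noteq> e \<Longrightarrow> edge_class n d \<inter> edge_class n e = {}"
  by (auto simp: edge_class_def doubleton_eq_iff)

section \<open>Arcs and chords of a circle\<close>

text \<open>The closed arc that runs from \<open>p\<close> to \<open>q\<close> in increasing direction, through the largest point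
  to the smallest one if \<open>q < p\<close>. All geometric facts below are statements about the linear
  order of the points, with case distinctions for such arcs.\<close>

definition arc :: "nat \<Rightarrow> nat \<Rightarrow> nat \<Rightarrow> bool" where
  "arc p q x \<longleftrightarrow> p \<le> q \<and> p \<le> x \<and> x \<le> q \<or> q < p \<and>
      (p \<le> x \<or> x \<le> q)"

definition noncrossing :: "nat \<Rightarrow> nat \<Rightarrow> nat \<Rightarrow> nat \<Rightarrow> bool" where
  "noncrossing p q u v \<longleftrightarrow> u \<noteq> p \<and> u \<noteq> q \<and> v \<noteq> p \<and>
      v \<noteq> q \<and> (arc p q u \<longleftrightarrow> arc p q v)"

definition disjoint_arcs :: "nat \<Rightarrow> nat \<Rightarrow> nat \<Rightarrow> nat \<Rightarrow> bool" where
  "disjoint_arcs p q u v \<longleftrightarrow> \<not> arc p q u \<and> \<not> arc p q v \<and>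
      \<not> arc u v p \<and> \<not> arc u v q"

text \<open>This describes two arcs in the complement of a third one that overlap, where \<open>[u, v]\<close> is
  shifted backwards against \<open>[p, q]\<close>. Coinciding first or last points are allowed.\<close>

definition lags :: "nat \<Rightarrow> nat \<Rightarrow> nat \<Rightarrow> nat \<Rightarrow> bool" where
  "lags p q u v \<longleftrightarrow> arc u v p \<and> arc p q v \<and> \<not> (p = u \<and> q = v)"

definition touching :: "nat \<Rightarrow> nat \<Rightarrow> nat \<Rightarrow> nat \<Rightarrow> bool" where
  "touching p q u v \<longleftrightarrow> \<not> noncrossing p q u v \<and> {p, q} \<noteq> {u, v}"

lemma touching_chords_same_side: "noncrossing p q u v \<Longrightarrow> \<not> arc p q u \<Longrightarrow>
    noncrossing p q x y \<Longrightarrow> touching u v x y \<Longrightarrow> p \<noteq> q \<Longrightarrow>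
    u \<noteq> v \<Longrightarrow> x \<noteq> y
   \<Longrightarrow> \<not> arc p q x"
  unfolding noncrossing_def touching_def doubleton_eq_iff arc_def using [[smt_nat_as_int]] by (smt (z3))

text \<open>Two arcs that avoid a third one lie on a common line segment. As their chords cross or
  touch, neither arc lies in the interior of the other, so one is shifted against the other.\<close>

lemma lags_total: "disjoint_arcs p0 q0 p1 q1 \<Longrightarrow> disjoint_arcs p1 q1 p2 q2 \<Longrightarrow>
    touching p0 q0 p2 q2 \<Longrightarrow> p0 \<noteq> q0 \<Longrightarrow>
    p1 \<noteq> q1 \<Longrightarrow> p2 \<noteq> q2
  \<Longrightarrow> lags p0 q0 p2 q2 \<or> lags p2 q2 p0 q0"
  unfolding noncrossing_def touching_def doubleton_eq_iff disjoint_arcs_def lags_def arc_def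
      using [[smt_nat_as_int]] by (smt (z3))

text \<open>The fourth arc avoids the third and meets the first, so it must begin in the part of the
  first arc that the third one leaves free. This part precedes the second arc, whence the
  direction of the shift is passed on.\<close>

lemma lags_propagate: "lags p0 q0 p2 q2 \<Longrightarrow> disjoint_arcs p0 q0 p1 q1 \<Longrightarrow>
    disjoint_arcs p1 q1 p2 q2 \<Longrightarrow> disjoint_arcs p2 q2 p3 q3
  \<Longrightarrow> touching p0 q0 p2 q2 \<Longrightarrow> touching p1 q1 p3 q3 \<Longrightarrow>
      touching p0 q0 p3 q3
  \<Longrightarrow> p0 \<noteq> q0 \<Longrightarrow> p1 \<noteq> q1 \<Longrightarrow>
      p2 \<noteq> q2 \<Longrightarrow> p3 \<noteq> q3
  \<Longrightarrow> lags p1 q1 p3 q3 \<and> arc p3 p1 q0 \<and> q0 \<noteq> p1 \<and> p1 \<noteq> p3"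
  unfolding noncrossing_def touching_def doubleton_eq_iff disjoint_arcs_def lags_def arc_def
      using [[smt_nat_as_int]] by (smt (z3))

lemma no_winding_next: "disjoint_arcs p2 q2 p3 q3 \<Longrightarrow> lags p0 q0 p2 q2 \<Longrightarrow>
    lags p1 q1 p3 q3 \<Longrightarrow> \<not> (arc p3 p1 p0 \<and> p0 \<noteq> p3)"
  unfolding noncrossing_def touching_def doubleton_eq_iff disjoint_arcs_def lags_def arc_def
      using [[smt_nat_as_int]] by (smt (z3))

lemma no_winding_second: "disjoint_arcs p0 q0 p1 q1 \<Longrightarrow>
    disjoint_arcs p1 q1 p2 q2 \<Longrightarrow> disjoint_arcs p2 q2 p3 q3 \<Longrightarrow>
    disjoint_arcs p3 q3 p4 q4 \<Longrightarrow> lags p0 q0 p2 q2 \<Longrightarrow> lags p2 q2 p4 q4 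
  \<Longrightarrow> touching p1 q1 p3 q3 \<Longrightarrow> p1 \<noteq> q1 \<Longrightarrow>
      p3 \<noteq> q3 \<Longrightarrow> p0 \<noteq> p2 \<Longrightarrow>
      \<not> (arc p4 p2 p0 \<and> p0 \<noteq> p4)"
  unfolding noncrossing_def touching_def doubleton_eq_iff disjoint_arcs_def lags_def arc_def
      using [[smt_nat_as_int]] by (smt (z3))

lemma no_winding_adjacent: "lags pu qu pw qw \<Longrightarrow> disjoint_arcs p0 q0 pw qw \<Longrightarrow>
    \<not> (arc pw pu p0)"
  unfolding noncrossing_def touching_def doubleton_eq_iff disjoint_arcs_def lags_def arc_def
      using [[smt_nat_as_int]] by (smt (z3))

text \<open>The arc \<open>[p0, q0]\<close> begins inside \<open>[pw, qw]\<close> and must reach \<open>[pv, qv]\<close>, so it contains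
  \<open>[pu, qu]\<close>. But then \<open>[p1, q1]\<close>, which is disjoint from \<open>[p0, q0]\<close>, cannot meet \<open>[pu, qu]\<close>.\<close>

lemma no_winding_far: "lags pu qu pw qw \<Longrightarrow> disjoint_arcs pu qu pv qv \<Longrightarrow>
    disjoint_arcs pv qv pw qw 
  \<Longrightarrow> disjoint_arcs p0 q0 p1 q1 \<Longrightarrow> disjoint_arcs p1 q1 p2 q2 \<Longrightarrow>
      lags p0 q0 p2 q2
  \<Longrightarrow> touching p0 q0 pv qv \<Longrightarrow> touching p1 q1 pu qu
  \<Longrightarrow> p0 \<noteq> q0 \<Longrightarrow> p1 \<noteq> q1 \<Longrightarrow>
      pu \<noteq> qu \<Longrightarrow> pv \<noteq> qv \<Longrightarrow> pw \<noteq> qw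
  \<Longrightarrow> \<not> (arc pw pu p0 \<and> p0 \<noteq> pw)"
  unfolding noncrossing_def touching_def doubleton_eq_iff disjoint_arcs_def lags_def arc_def
      using [[smt_nat_as_int]] by (smt (z3))

text \<open>This is adjacency of two chords: they have no common end and do not cross.\<close>

definition apart :: "nat set \<Rightarrow> nat set \<Rightarrow> bool" where
  "apart E F \<longleftrightarrow> (\<exists>p q u v. E = {p, q} \<and> F = {u, v} \<and>
      p \<noteq> q \<and> u \<noteq> v \<and> disjoint_arcs p q u v)"

lemma disjoint_arcs_commute: "disjoint_arcs p q u v = disjoint_arcs u v p q"
  unfolding disjoint_arcs_def by auto

lemma apart_commute: "apart E F \<longleftrightarrow> apart F E"
  unfolding apart_def using disjoint_arcs_commute by metis

lemma apart_iff_noncrossing: 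
  assumes "p \<noteq> q" "u \<noteq> v" shows "apart {p, q} {u, v} \<longleftrightarrow> noncrossing p q u v"
proof
  assume "apart {p, q} {u, v}"
  then show "noncrossing p q u v"
    using assms
    unfolding apart_def noncrossing_def doubleton_eq_iff disjoint_arcs_def arc_def
        using [[smt_nat_as_int]] by (smt (z3))
next
  have "disjoint_arcs p q u v \<or> disjoint_arcs p q v u \<or> disjoint_arcs q p u v \<or>
      disjoint_arcs q p v u"
    if "noncrossing p q u v"
    using assms that
    unfolding apart_def noncrossing_def doubleton_eq_iff disjoint_arcs_def arc_def
        using [[smt_nat_as_int]] by (smt (z3))
  then show "apart {p, q} {u, v}" if "noncrossing p q u v"
    using that assms unfolding apart_def by (metis insert_commute)
qed

lemma not_apart_iff_touching:
  assumes "p \<noteq> q" "u \<noteq> v" shows "\<not> apart {p, q} {u, v} \<and>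
      {p, q} \<noteq> {u, v} \<longleftrightarrow> touching p q u v"
  unfolding touching_def using apart_iff_noncrossing[OF assms] by auto

lemma orient_chord: 
  assumes "apart E F" "apart E G" "\<not> apart F G" "F \<noteq> G"
  obtains p q where "E = {p, q}" "p \<noteq> q" "\<And>x. x \<in> F \<union> G \<Longrightarrow>
      \<not> arc p q x"
proof -
  obtain p q u v where 1: "E = {p, q}" "F = {u, v}" "p \<noteq> q" "u \<noteq> v" "disjoint_arcs p q u v"
    using assms(1) unfolding apart_def by blast
  obtain x y where 2: "G = {x, y}" "x \<noteq> y" using assms(2) unfolding apart_def by blast
  have "noncrossing p q u v" "noncrossing p q x y" 
    using assms 1 2 apart_iff_noncrossing by metis+
  moreover have "touching u v x y" using assms 1 2 not_apart_iff_touching by metis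
  moreover have "\<not> arc p q u" "\<not> arc p q v" using 1(5) by (auto simp: disjoint_arcs_def)
  ultimately have "\<not> arc p q x" using touching_chords_same_side 1 2 by blast
  then have "\<not> arc p q y" using \<open>noncrossing p q x y\<close> by (auto simp: noncrossing_def)
  show ?thesis using that[of p q] 1 2 \<open>\<not> arc p q u\<close> \<open>\<not> arc p q v\<close>
      \<open>\<not> arc p q x\<close> \<open>\<not> arc p q y\<close> by auto
qed

lemma disjoint_arcsI: "disjoint_arcs p q u v" if "\<not> arc p q u" "\<not> arc p q v" "\<not> arc u v p"
    "\<not> arc u v q"
  using that by (simp add: disjoint_arcs_def)

section \<open>Shortest odd cycles\<close>

text \<open>A shortest closed walk of odd length has no chord and repeats no vertex, since either would
  split it into two shorter closed walks, one of them odd. If there is no odd closed walk, the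
  parity of the walks from a chosen vertex of each component is a colouring.\<close>

lemma odd_cycle:
  fixes R :: "'a \<Rightarrow> 'a \<Rightarrow> bool"
  assumes sym: "\<And>x y. R x y \<Longrightarrow> R y x"
    and not_bip: "\<not> (\<exists>C. \<forall>x\<in>W. \<forall>y\<in>W. R x y \<longrightarrow> (x \<in>
        C) \<noteq> (y \<in> C))"
  obtains L :: int and f :: "int \<Rightarrow> 'a" where "odd L" "0 < L" "\<And>s. f s \<in> W"
      "\<And>s. f (s + L) = f s" "\<And>s. R (f s) (f (s + 1))"
    "\<And>s t. (s - t) mod L \<noteq> 0 \<Longrightarrow> (s - t) mod L \<noteq> 1 \<Longrightarrow>
        (s - t) mod L \<noteq> L - 1 \<Longrightarrow> f s \<noteq> f t \<and> \<not> R (f s) (f t)"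
    "\<And>s t. (s - t) mod L \<noteq> 0 \<Longrightarrow> f s \<noteq> f t"
proof -
  define S where "S = {(x, y). x \<in> W \<and> y \<in> W \<and> R x y}"
  have symS: "(y, x) \<in> S" if "(x, y) \<in> S" for x y using that sym by (auto simp: S_def)
  have symP: "(y, x) \<in> S ^^ k" if "(x, y) \<in> S ^^ k" for x y k
    using that
  proof (induction k arbitrary: y)
    case (Suc k)
    then obtain z where "(x, z) \<in> S ^^ k" "(z, y) \<in> S" by auto
    then show ?case using Suc.IH symS by (metis relpow_Suc_I2)
  qed auto
  have trP: "(x, z) \<in> S ^^ (a + b)" if "(x, y) \<in> S ^^ a" "(y, z) \<in> S ^^ b" for x y z a b
    using that by (auto simp: relpow_add)
  have "\<exists>L. odd L \<and> (\<exists>x. (x, x) \<in> S ^^ L)"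
  proof (rule ccontr)
    assume no: "\<not> ?thesis"
    \<comment> \<open>vertices of one component have the same set of choices, hence the same root\<close>
    define root where "root x = (SOME y. (x, y) \<in> S\<^sup>*)" for x
    have rt: "(x, root x) \<in> S\<^sup>*" for x unfolding root_def by (rule someI[of _ x]) simp
    define C where "C = {x. \<exists>k. even k \<and> (root x, x) \<in> S ^^ k}"
    have "(x \<in> C) \<noteq> (y \<in> C)" if "x \<in> W" "y \<in> W" "R x y" for x y
    proof -
      have xy: "(x, y) \<in> S" "(y, x) \<in> S" using that sym by (auto simp: S_def)
      then have "(x, z) \<in> S\<^sup>* \<longleftrightarrow> (y, z) \<in> S\<^sup>*" for z
        by (meson converse_rtrancl_into_rtrancl)
      then have r: "root x = root y" by (simp add: root_def)
      obtain a where a: "(root x, x) \<in> S ^^ a" using rt[of x] symP by (meson rtrancl_imp_relpow)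
      have 1: "(root x, x) \<in> S ^^ b \<Longrightarrow> (root x, y) \<in> S ^^ c \<Longrightarrow>
          even (Suc (b + c))" for b c
        using no trP[OF symP trP[OF _ , of "root x" x b y 1]] xy
        by (metis (no_types, opaque_lifting) add.commute add_Suc_right relpow_1 plus_1_eq_Suc)
      have 2: "(root x, y) \<in> S ^^ Suc a" using a xy by auto
      have "x \<in> C \<or> y \<in> C"
      proof (cases "even a")
        case True
        then show ?thesis using a by (auto simp: C_def)
      next
        case False
        then have "even (Suc a)" by simp
        moreover have "(root y, y) \<in> S ^^ Suc a" using 2 unfolding r .
        ultimately have "y \<in> C" unfolding C_def by blast
        then show ?thesis ..
      qed
      moreover have False if xyC: "x \<in> C" "y \<in> C"
      proof -
        from xyC(1) obtain b where b: "even b" "(root x, x) \<in> S ^^ b" by (auto simp: C_def)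
        from xyC(2) obtain c where c: "even c" "(root y, y) \<in> S ^^ c" by (auto simp: C_def)
        have "even (Suc (b + c))" using 1[OF b(2)] c(2) unfolding r .
        then show False using b(1) c(1) by simp
      qed
      ultimately show ?thesis by blast
    qed
    then have "\<exists>C. \<forall>x\<in>W. \<forall>y\<in>W. R x y \<longrightarrow> (x \<in> C) \<noteq>
        (y \<in> C)"
      by (intro exI[of _ C] ballI impI)
    with not_bip show False ..
  qed
  then obtain L where L: "odd L \<and> (\<exists>x. (x, x) \<in> S ^^ L)"
      and least: "\<And>l. l < L \<Longrightarrow> \<not> (odd l \<and> (\<exists>x. (x, x) \<in> S ^^ l))"
    unfolding exists_least_iff[of "\<lambda>L. odd L \<and> (\<exists>x. (x, x) \<in> S ^^ L)"] by auto
  have min: "even l" if "(x, x) \<in> S ^^ l" "l < L" for x l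
    using that least by blast
  have L0: "0 < L" using L by (cases L) simp_all
  obtain x where "(x, x) \<in> S ^^ L" using L by auto
  then obtain g where "g 0 = x" "g L = x" and gS: "\<And>i. i < L \<Longrightarrow> (g i, g (Suc i)) \<in> S"
    unfolding relpow_fun_conv by auto
  then have g0: "g L = g 0" by simp
  have seg: "(g a, g b) \<in> S ^^ (b - a)" if "a \<le> b" "b \<le> L" for a b
    unfolding relpow_fun_conv using that by (intro exI[of _ "\<lambda>i. g (a + i)"]) (simp add: gS)
  have sp: "g a \<noteq> g b \<and> (b - a \<noteq> 1 \<longrightarrow> b - a \<noteq> L - 1
      \<longrightarrow> \<not> R (g a) (g b))" if ab: "a < b" "b < L" for a b
  proof -
    have in1: "(g a, g b) \<in> S ^^ (b - a)" using seg[of a b] ab by simp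
    have "(g b, g 0) \<in> S ^^ (L - b)" using seg[of b L] ab by (simp add: g0)
    moreover have "(g 0, g a) \<in> S ^^ a" using seg[of 0 a] ab by simp
    ultimately have in2: "(g b, g a) \<in> S ^^ (L - b + a)" by (rule trP)
    have "g a \<noteq> g b"
    proof
      assume "g a = g b"
      then have "even (b - a)" "even (L - b + a)" using min[of "g b" "b - a"] min[of "g b"
          "L - b + a"] in1 in2 ab by simp_all
      then have "even ((b - a) + (L - b + a))" by simp
      then show False using conjunct1[OF L] ab by simp
    qed
    moreover have False if "b - a \<noteq> 1" "b - a \<noteq> L - 1" "R (g a) (g b)"
    proof -
      have W: "g a \<in> W" "g b \<in> W" using gS[of a] gS[of b] ab by (auto simp: S_def)
      then have S: "(g a, g b) \<in> S ^^ 1" "(g b, g a) \<in> S ^^ 1" using that sym by (auto simp: S_def)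
      have "even (b - a + 1)" using min[OF trP[OF in1 S(2)]] ab that by auto
      moreover have "even (L - b + a + 1)" using min[OF trP[OF in2 S(1)]] ab that by auto
      ultimately have "even ((b - a + 1) + (L - b + a + 1))" by (metis odd_add)
      then show False using conjunct1[OF L] ab by simp
    qed
    ultimately show ?thesis by blast
  qed
  define f where "f s = g (nat (s mod int L))" for s
  have nb: "nat (s mod int L) < L" for s using L0 by (simp add: nat_less_iff)
  show ?thesis
  proof (rule that[of "int L" f])
    show "odd (int L)" "0 < int L" using L L0 by auto
    show "f s \<in> W" for s using gS[OF nb[of s]] by (auto simp: f_def S_def)
    show "f (s + int L) = f s" for s by (simp add: f_def)
    show "R (f s) (f (s + 1))" for s
    proof (cases "s mod int L = int L - 1")
      case True
      then have "(s + 1) mod int L = 0" using mod_add_left_eq[of s "int L" 1] by simp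
      then have "f (s + 1) = g L" using g0 by (simp add: f_def)
      moreover have "f s = g (L - 1)" using True L0 by (simp add: f_def nat_diff_distrib)
      ultimately show ?thesis using gS[of "L - 1"] L0 by (auto simp: S_def)
    next
      case False
      have "s mod int L < int L" "0 \<le> s mod int L" using L0 by auto
      then have "(s + 1) mod int L = s mod int L + 1"
        using False mod_pos_pos_trivial[of "s mod int L + 1" "int L"] mod_add_left_eq[of s "int L" 1] by simp
      then have "nat ((s + 1) mod int L) = Suc (nat (s mod int L))"
          using \<open>0 \<le> s mod int L\<close> by simp
      then show ?thesis using gS[OF nb[of s]] by (auto simp: f_def S_def)
    qed
    have md: "(s - t) mod int L = (s mod int L - t mod int L) mod int L" for s t by (simp add: mod_diff_eq)
    have md2: "(s - t) mod int L = (if t mod int L \<le> s mod int L then s mod int L - t mod int L else s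
        mod int L - t mod int L + int L)" for s t
    proof -
      define x y where "x = s mod int L" and "y = t mod int L"
      have b: "0 \<le> x" "x < int L" "0 \<le> y" "y < int L" using L0 by (auto simp: x_def y_def)
      have "(x - y) mod int L = (x - y + int L) mod int L" by simp
      also have "\<dots> = x - y + int L" if "x < y" using that b by (intro mod_pos_pos_trivial) auto
      finally have "(x - y) mod int L = x - y + int L" if "x < y" using that .
      moreover have "(x - y) mod int L = x - y" if "y \<le> x" using that b by (intro mod_pos_pos_trivial) auto
      ultimately show ?thesis unfolding md[of s t] x_def[symmetric] y_def[symmetric] by simp
    qed
    show *: "f s \<noteq> f t" if "(s - t) mod int L \<noteq> 0" for s t
    proof -
      have "s mod int L \<noteq> t mod int L" using that md2 by auto
      then have "nat (s mod int L) \<noteq> nat (t mod int L)" using L0 by (simp add: eq_nat_nat_iff)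
      then consider "nat (s mod int L) < nat (t mod int L)" | "nat (t mod int L) < nat (s mod int L)" by
          linarith
      then show ?thesis
        using sp[OF _ nb[of t], of "nat (s mod int L)"] sp[OF _ nb[of s], of "nat (t mod int L)"] 
        unfolding f_def by cases auto
    qed
    show "f s \<noteq> f t \<and> \<not> R (f s) (f t)" if "(s - t) mod int L \<noteq> 0"
        "(s - t) mod int L \<noteq> 1" "(s - t) mod int L \<noteq> int L - 1" for s t
    proof -
      define a b where "a = nat (s mod int L)" and "b = nat (t mod int L)"
      have ab: "int a = s mod int L" "int b = t mod int L" "a < L"
          "b < L" using L0 nb by (auto simp: a_def b_def)
      have e: "(s - t) mod int L = (if b \<le> a then int a - int b else int a - int b + int L)"
        using md2[of s t] unfolding ab(1,2)[symmetric] by simp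
      note far = that[unfolded e]
      consider "a < b" | "b < a" using far(1) by force
      then have "\<not> R (g a) (g b)"
      proof cases
        case 1
        then have "int a - int b + int L \<noteq> 1"
            "int a - int b + int L \<noteq> int L - 1" using far by auto
        then have "b - a \<noteq> 1" "b - a \<noteq> L - 1" using 1 ab(3,4) by linarith+
        then show ?thesis using sp[of a b] 1 ab(4) by blast
      next
        case 2
        then have "int a - int b \<noteq> 1" "int a - int b \<noteq> int L - 1" using far by auto
        then have "a - b \<noteq> 1" "a - b \<noteq> L - 1" using 2 ab(3,4) by linarith+
        then show ?thesis using sp[of b a] 2 ab(3) sym[of "g a" "g b"] by blast
      qed
      then have "\<not> R (f s) (f t)" unfolding f_def a_def b_def .
      with *[OF that(1)] show ?thesis ..
    qed
  qed
qed

section \<open>Cyclic sequences of arcs\<close>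

text \<open>An induced odd cycle of chords, each of which is oriented such that its closed arc avoids
  the two neighbouring chords.\<close>

locale arc_cycle =
  fixes m :: int and p q :: "int \<Rightarrow> nat"
  assumes m: "2 \<le> m"
    and per: "p (s + (2 * m + 1)) = p s" "q (s + (2 * m + 1)) = q s"
    and neq: "p s \<noteq> q s"
    and disj: "disjoint_arcs (p s) (q s) (p (s + 1)) (q (s + 1))"
    and touch: "(s - t) mod (2 * m + 1) \<notin> {0, 1, 2 * m} \<Longrightarrow>
        touching (p s) (q s) (p t) (q t)"
begin

abbreviation "L \<equiv> 2 * m + 1"

lemma periodic: 
  assumes "s mod L = t mod L" shows "p s = p t" "q s = q t"
proof -
  have *: "p (s + L * k) = p s \<and> q (s + L * k) = q s" for s k
  proof (induction k rule: int_induct[of _ 0])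
    case (step1 i)
    then show ?case using per[of "s + L * i"] by (simp add: algebra_simps)
  next
    case (step2 i)
    then show ?case using per[of "s + L * (i - 1)"] by (simp add: algebra_simps)
  qed simp
  obtain k where "s = t + L * k" using assms by (metis mod_eqE)
  then show "p s = p t" "q s = q t" using * by auto
qed

lemma touch_offset: "touching (p s) (q s) (p (s + d)) (q (s + d))" if "2 \<le> d" "d < 2 * m"
proof (rule touch)
  have "(s - (s + d)) mod L = (- d + L) mod L" by simp
  also have "\<dots> = - d + L" using that m by (intro mod_pos_pos_trivial) auto
  finally show "(s - (s + d)) mod L \<notin> {0, 1, 2 * m}" using that by auto
qed

lemma lag_step:
  assumes "lags (p s) (q s) (p (s + 2)) (q (s + 2))"
  shows "lags (p (s + 1)) (q (s + 1)) (p (s + 3)) (q (s + 3))"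
    and "arc (p (s + 3)) (p (s + 1)) (q s)" "q s \<noteq> p (s + 1)" "p (s + 1) \<noteq> p (s + 3)"
proof -
  have "touching (p s) (q s) (p (s + 2)) (q (s + 2))" "touching (p s) (q s) (p (s + 3)) (q (s + 3))"
      "touching (p (s + 1)) (q (s + 1)) (p (s + 3)) (q (s + 3))"
    using touch_offset[of 2 s] touch_offset[of 3 s] touch_offset[of 2 "s + 1"] m by (auto simp: add.commute)
  moreover have "disjoint_arcs (p s) (q s) (p (s + 1)) (q (s + 1))"
      "disjoint_arcs (p (s + 1)) (q (s + 1)) (p (s + 2)) (q (s + 2))"
      "disjoint_arcs (p (s + 2)) (q (s + 2)) (p (s + 3)) (q (s + 3))"
    using disj[of s] disj[of "s + 1"] disj[of "s + 2"] by (auto simp: add.commute)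
  ultimately show "lags (p (s + 1)) (q (s + 1)) (p (s + 3)) (q (s + 3))"
    and "arc (p (s + 3)) (p (s + 1)) (q s)" "q s \<noteq> p (s + 1)" "p (s + 1) \<noteq> p (s + 3)"
    using lags_propagate[OF assms] neq by auto
qed

text \<open>By \<open>lag_step\<close> all arcs are shifted in the same direction. The opposite direction is obtained
  by traversing the cycle backwards.\<close>

lemma lag_all: 
  assumes "lags (p s0) (q s0) (p (s0 + 2)) (q (s0 + 2))"
  shows "lags (p s) (q s) (p (s + 2)) (q (s + 2))"
proof -
  have *: "lags (p (s0 + int k)) (q (s0 + int k)) (p (s0 + int k + 2)) (q (s0 + int k + 2))" for k
  proof (induction k)
    case (Suc k)
    then show ?case using lag_step(1)[of "s0 + int k"] by (simp add: algebra_simps)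
  qed (use assms in simp)
  define k where "k = nat ((s - s0) mod L)"
  have "int k = (s - s0) mod L" using m by (simp add: k_def)
  then have 1: "(s0 + int k) mod L = s mod L" by (simp add: mod_simps)
  have 2: "(s0 + int k + 2) mod L = (s + 2) mod L"
    using mod_add_left_eq[of "s0 + int k" L 2] mod_add_left_eq[of s L 2] unfolding 1 by simp
  show ?thesis using *[of k] periodic[OF 1] periodic[OF 2] by simp
qed

lemma exists_lag:
  "lags (p s) (q s) (p (s + 2)) (q (s + 2)) \<or> lags (p (s + 2)) (q (s + 2)) (p s) (q s)"
  using lags_total[OF disj[of s] _ touch_offset[of 2 s]] disj[of "s + 1"] neq m by (simp add: add.commute)

lemma reverse: "arc_cycle m (\<lambda>s. p (- s)) (\<lambda>s. q (- s))"
proof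
  show "touching (p (- s)) (q (- s)) (p (- t)) (q (- t))" if "(s - t) mod L \<notin> {0, 1, 2 * m}" for s t
  proof (rule touch)
    have "(- s - - t) mod L = (- ((s - t) mod L)) mod L" by (simp add: mod_simps)
    moreover have "(- ((s - t) mod L) + L) mod L = - ((s - t) mod L) + L" 
    proof (rule mod_pos_pos_trivial)
      show "0 \<le> - ((s - t) mod L) + L" using m pos_mod_bound[of L "s - t"] by simp
      have "0 \<le> (s - t) mod L" by (rule pos_mod_sign) (use m in simp)
      then show "- ((s - t) mod L) + L < L" using that by simp
    qed
    ultimately have "(- s - - t) mod L = L - (s - t) mod L" by simp
    then show "(- s - - t) mod L \<notin> {0, 1, 2 * m}" using that m pos_mod_bound[of L "s - t"] by auto
  qed
  show "p (- (s + L)) = p (- s)" "q (- (s + L)) = q (- s)" for s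
    using per[of "- (s + L)"] by simp_all
  show "disjoint_arcs (p (- s)) (q (- s)) (p (- (s + 1))) (q (- (s + 1)))" for s
    using disj[of "- (s + 1)"] by (simp add: disjoint_arcs_commute)
qed (use m neq in auto)

text \<open>The steps from \<open>p (u + 2)\<close> to \<open>p u\<close> together go around the circle exactly once: the point
  just before \<open>p 0\<close> is passed only by the step that ends in \<open>p 0\<close>. If another step passed it,
  its three arcs \<open>u\<close>, \<open>u + 1\<close>, \<open>u + 2\<close> would have to be met by the disjoint arcs \<open>0\<close> and \<open>1\<close>,
  for which there is no room. When \<open>u\<close> is close to \<open>0\<close> some of these chords are adjacent,
  which requires the separate cases.\<close>

lemma winding:
  assumes lag: "\<And>s. lags (p s) (q s) (p (s + 2)) (q (s + 2))"
    and u: "u mod L \<noteq> 0"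
  shows "\<not> (arc (p (u + 2)) (p u) (p 0) \<and> p 0 \<noteq> p (u + 2))"
proof -
  define v where "v = u mod L"
  have v: "0 < v" "v < L" using u m pos_mod_sign[of L u] pos_mod_bound[of L u] unfolding v_def by linarith+
  have L2: "lags (p s) (q s) (p (2 + s)) (q (2 + s))" for s using lag by (simp add: add.commute)
  have pv: "p (u + 2) = p (v + 2)" "p u = p v" by (auto intro!: periodic simp: v_def mod_simps)
  have pL: "p L = p 0" "q L = q 0" using periodic[of L 0] by auto
  have p1: "p (L + 1) = p 1" "q (L + 1) = q 1" using periodic[OF mod_add_self1[of L 1]] by simp_all
  consider "v = 1" | "v = 2" | "v = 2 * m" | "v = 2 * m - 1" | "v = 2 * m - 2" | "2 < v" "v < 2 * m - 2"
    using v by linarith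
  then have "\<not> (arc (p (v + 2)) (p v) (p 0) \<and> p 0 \<noteq> p (v + 2))"
  proof cases
    case 1
    then show ?thesis
      using no_winding_next[OF _ lag[of 0] lag[of 1]] disj[of 2] by simp
  next
    case 2
    then show ?thesis
      using no_winding_second[of "p 0" "q 0" "p 1" "q 1" "p 2" "q 2" "p 3" "q 3" "p 4"
          "q 4"] disj[of 0] disj[of 1] disj[of 2] disj[of 3] 
        lag[of 0] lag[of 2] touch_offset[of 2 1] neq m lag_step(4)[OF lag, of "-1"] by auto
  next
    case 3
    then have "\<not> arc (p (v + 2)) (p v) (p 0)" 
      using no_winding_adjacent[OF lag[of v], of "p 0" "q 0"] disj[of 0] p1 by (simp add: algebra_simps)
    then show ?thesis by simp
  next
    case 4
    then have "v + 2 = L" by simp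
    then have "p (v + 2) = p 0" using pL(1) by (simp only:)
    then show ?thesis by simp
  next
    case 5
    have "disjoint_arcs (p 0) (q 0) (p (v + 2)) (q (v + 2))"
      using disj[of "v + 2"] 5 pL disjoint_arcs_commute by (simp add: algebra_simps)
    then show ?thesis using no_winding_adjacent[OF lag[of v]] by blast
  next
    case 6
    have "touching (p 0) (q 0) (p (v + 1)) (q (v + 1))" "touching (p 1) (q 1) (p v) (q v)"
      using touch_offset[of "v + 1" 0] touch_offset[of "v - 1" 1] 6 by auto
    then show ?thesis
      using no_winding_far[OF lag[of v] disj[of v] _ disj[of 0] _ _ ] disj[of "v + 1"] disj[of 1] lag[of 0] neq
      by (simp add: add.commute)
  qed
  then show ?thesis using pv by simp
qed

end

section \<open>Chord configurations that are not unions of two thrackles\<close>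

text \<open>The circle is cut just before \<open>r\<close>.\<close>

definition unroll :: "nat \<Rightarrow> nat \<Rightarrow> nat \<Rightarrow> int" where
  "unroll n r x = (if r \<le> x then int x else int x + int n)"

lemma unroll_arc:
  assumes "arc a c b" "b \<noteq> c" "a \<noteq> c" "\<not> (arc a c r \<and> r \<noteq> a)"
      "a \<in> {1..n}" "b \<in> {1..n}" "c \<in> {1..n}" "r \<in> {1..n}"
  shows "unroll n r a \<le> unroll n r b" "unroll n r b < unroll n r c"
  using assms unfolding arc_def unroll_def using [[smt_nat_as_int]] by (auto split: if_splits)

lemma unroll_arc_last:
  assumes "arc a r b" "b \<noteq> r" "a \<noteq> r" "a \<in> {1..n}" "b \<in> {1..n}" "r \<in> {1..n}"
  shows "unroll n r a \<le> unroll n r b" 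
  using assms unfolding arc_def unroll_def by (auto split: if_splits)

lemma unroll_less: "x \<in> {1..n} \<Longrightarrow> r \<in> {1..n} \<Longrightarrow>
    unroll n r x < int r + int n"
  unfolding unroll_def by auto

lemma unroll_cong: "[int x = unroll n r x] (mod int n)"
  unfolding unroll_def by (simp add: cong_def)

lemma admissibleI:
  assumes "1 \<le> k" "\<And>l. l < 2 * k + 1 \<Longrightarrow> i l \<in> {1..n} \<and> j l \<in> {1..n}"
    "\<And>l. l < 2 * k + 1 \<Longrightarrow> unroll n r (i l) \<le> unroll n r (j l)"
    "\<And>l. l < 2 * k \<Longrightarrow> unroll n r (j l) < unroll n r (i (l + 1))"
    "unroll n r (j (2 * k)) < unroll n r (i 0) + int n"
    "\<And>l. k = 1 \<Longrightarrow> l < 2 * k + 1 \<Longrightarrow> i l \<noteq> j l"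
  shows "admissible n k i j"
  unfolding admissible_def using assms unroll_cong
  by (intro conjI exI[of _ "\<lambda>l. unroll n r (j l)"] exI[of _ "\<lambda>l. unroll n r (i l)"] ) blast+

lemma (in arc_cycle) admissible_cycle:
  assumes lag: "\<And>s. lags (p s) (q s) (p (s + 2)) (q (s + 2))"
    and rng: "\<And>s. p s \<in> {1..n}" "\<And>s. q s \<in> {1..n}"
    and k: "m = int k"
  shows "admissible n k (\<lambda>l. p (- 2 * int l)) (\<lambda>l. q (- 2 * int l - 3))"
    and "l < 2 * k + 1 \<Longrightarrow> q (- 2 * int ((l + k - 1) mod (2 * k + 1)) - 3) = q (- 2 * int l)"
proof -
  have k2: "2 \<le> k" using m k by simp
  have st: "arc (p t) (p (t - 2)) (q (t - 3))" "q (t - 3) \<noteq> p (t - 2)" "p t \<noteq> p (t - 2)" for t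
    using lag_step(2-4)[OF lag[of "t - 3"]] by (simp_all add: algebra_simps)
  have p2: "p (- 2 * int (2 * k) - 2) = p 0"
  proof (rule periodic(1))
    have "(- 2 * int (2 * k) - 2) = - 2 * L" using k by simp
    then show "(- 2 * int (2 * k) - 2) mod L = 0 mod L"
        by (simp only: mod_mult_self1_is_0 mod_mult_self2_is_0 mod_0)
  qed
  let ?u = "unroll n (p 0)"
  have chain: "?u (p (- 2 * int l)) \<le> ?u (q (- 2 * int l - 3)) \<and>
      ?u (q (- 2 * int l - 3)) < ?u (p (- 2 * int (l + 1)))" if "l < 2 * k" for l
  proof -
    have "(- 2 * int l - 2) mod L \<noteq> 0"
    proof
      assume "(- 2 * int l - 2) mod L = 0"
      then have "L dvd - 2 * int l - 2" by (simp add: dvd_eq_mod_eq_0)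
      then have "L dvd 2 * (int l + 1)" by (metis (no_types, opaque_lifting) dvd_minus_iff minus_diff_eq
          minus_mult_left
          distrib_left diff_minus_eq_add mult_1_right add.commute)
      moreover have "coprime L 2" by simp
      ultimately have "L dvd int l + 1" using coprime_dvd_mult_right_iff by blast
      then have "L \<le> int l + 1" by (rule zdvd_imp_le) simp
      then show False using that k by simp
    qed
    from winding[OF lag this] have "\<not> (arc (p (- 2 * int l)) (p (- 2 * int l - 2)) (p 0) \<and>
        p 0 \<noteq> p (- 2 * int l))"
      by simp
    note w = this
    have e: "- 2 * int (l + 1) = - 2 * int l - 2" by simp
    show ?thesis unfolding e
      using unroll_arc[OF st[of "- 2 * int l"] w rng(1) rng(2) rng(1) rng(1)] by (rule conjI)
  qed
  have last: "?u (p (- 2 * int (2 * k))) \<le> ?u (q (- 2 * int (2 * k) - 3))"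
    using unroll_arc_last[of "p (- 2 * int (2 * k))" "p 0"
        "q (- 2 * int (2 * k) - 3)"] st[of "- 2 * int (2 * k)"] rng 
    unfolding p2 by auto
  show "admissible n k (\<lambda>l. p (- 2 * int l)) (\<lambda>l. q (- 2 * int l - 3))"
  proof (rule admissibleI[where r = "p 0"])
    show "?u (p (- 2 * int l)) \<le> ?u (q (- 2 * int l - 3))" if "l < 2 * k + 1" for l
    proof (cases "l = 2 * k")
      case True
      show ?thesis unfolding True by (rule last)
    next
      case False
      then show ?thesis using chain[of l] that by auto
    qed
    show "?u (q (- 2 * int (2 * k) - 3)) < ?u (p (- 2 * int 0)) + int n"
      using unroll_less[OF rng(2) rng(1)[of 0]] by (simp add: unroll_def)
    show "?u (q (- 2 * int l - 3)) < ?u (p (- 2 * int (l + 1)))" if "l < 2 * k" for l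
      using chain[OF that] by (rule conjunct2)
  qed (use rng k2 in auto)
  show "q (- 2 * int ((l + k - 1) mod (2 * k + 1)) - 3) = q (- 2 * int l)" if "l < 2 * k + 1"
  proof (rule periodic(2))
    have "int ((l + k - 1) mod (2 * k + 1)) = (int l + m - 1) mod L"
        using k k2 by (simp add: zmod_int of_nat_diff add.commute)
    then have "(- 2 * int ((l + k - 1) mod (2 * k + 1)) - 3) mod L = (- 2 * (int l + m - 1) - 3) mod L"
      by (metis (no_types, lifting) mod_diff_left_eq mod_mult_right_eq)
    also have "- 2 * (int l + m - 1) - 3 = - 2 * int l + (- 1) * L" by simp
    also have "\<dots> mod L = (- 2 * int l) mod L" by (rule mod_mult_self1)
    finally show "(- 2 * int ((l + k - 1) mod (2 * k + 1)) - 3) mod L = (- 2 * int l) mod L" .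
  qed
qed

definition cyc :: "nat \<Rightarrow> nat \<Rightarrow> nat \<Rightarrow> bool" where
  "cyc a b c \<longleftrightarrow> a < b \<and> b < c \<or> b < c \<and> c < a \<or> c < a \<and> a < b"

text \<open>The six points are distinct and occur in this order around the circle.\<close>

definition cyc6 :: "nat \<Rightarrow> nat \<Rightarrow> nat \<Rightarrow> nat \<Rightarrow> nat
    \<Rightarrow> nat \<Rightarrow> bool" where
  "cyc6 a b c d e f \<longleftrightarrow> cyc a b c \<and> cyc a c d \<and> cyc a d e \<and> cyc a e f"

text \<open>Three disjoint chords without crossings are alternate sides of a hexagon or parallel; in the
  second case each of them may be the middle one.\<close>

lemma three_apart:
  assumes "disjoint_arcs p0 q0 p1 q1" "noncrossing p0 q0 p2 q2" "noncrossing p1 q1 p2 q2" "p0 \<noteq> q0"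
      "p1 \<noteq> q1" "p2 \<noteq> q2"
  shows "cyc6 p0 q0 p1 q1 p2 q2 \<or> cyc6 p0 q0 p1 q1 q2 p2 \<or> cyc6 p0 q0 p2 q2 p1 q1 \<or>
      cyc6 p0 q0 q2 p2 p1 q1 \<or>
    cyc6 q0 p2 p1 q1 q2 p0 \<or> cyc6 q0 q2 p1 q1 p2 p0 \<or> 
    cyc6 q1 p0 p2 q2 q0 p1 \<or> cyc6 q1 p0 q2 p2 q0 p1 \<or> 
    cyc6 q0 p1 p2 q2 q1 p0 \<or> cyc6 q0 p1 q2 p2 q1 p0"
  using assms unfolding cyc6_def cyc_def disjoint_arcs_def noncrossing_def arc_def
      using [[smt_nat_as_int]] by (smt (z3))

lemma unroll_cyc:
  assumes "cyc r x y" "r \<in> {1..n}" "x \<in> {1..n}" "y \<in> {1..n}"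
  shows "unroll n r r < unroll n r x" "unroll n r x < unroll n r y" "unroll n r y < unroll n r r + int n"
  using assms unfolding cyc_def unroll_def by auto

lemma admissible_sides:
  assumes "cyc6 p0 q0 p1 q1 p2 q2" "{p0, q0, p1, q1, p2, q2} \<subseteq> {1..n}"
  shows "admissible n 1 (\<lambda>l. if l = 0 then p0 else if l = 1 then p1 else p2) (\<lambda>l.
      if l = 0 then q0 else if l = 1 then q1 else q2)"
proof -
  let ?u = "unroll n p0"
  have 1: "?u p0 < ?u q0 \<and> ?u q0 < ?u p1 \<and> ?u p1 < ?u q1 \<and> ?u q1 < ?u p2 \<and>
      ?u p2 < ?u q2 \<and> ?u q2 < ?u p0 + int n"
    using assms unroll_cyc[of p0 q0 p1 n] unroll_cyc[of p0 p1 q1 n] unroll_cyc[of p0 q1 p2 n] unroll_cyc[of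
        p0 p2 q2 n]
    unfolding cyc6_def by simp
  then have 2: "p0 \<noteq> q0 \<and> p1 \<noteq> q1 \<and> p2 \<noteq> q2" by auto
  show ?thesis
  proof (rule admissibleI[where r = p0])
    show "unroll n p0 (if l = 0 then p0 else
        if l = 1 then p1 else p2) \<le> unroll n p0 (if l = 0 then q0 else if l = 1 then q1 else q2)"
      for l :: nat using 1 by simp
    show "unroll n p0 (if l = 0 then q0 else
        if l = 1 then q1 else q2) < unroll n p0 (if l + 1 = 0 then p0 else if l + 1 = 1 then p1 else p2)"
      if "l < 2 * 1" for l :: nat
    proof -
      have "l = 0 \<or> l = 1" using that by linarith
      then show ?thesis using 1 by auto
    qed
  qed (use 1 2 assms(2) in auto)
qed

lemma inj_on_three: "e 0 \<noteq> e 1 \<Longrightarrow> e 0 \<noteq> e 2 \<Longrightarrow>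
    e 1 \<noteq> e 2 \<Longrightarrow> inj_on e {0, 1, 2::nat}"
  by (auto simp: inj_on_def)

text \<open>A shortest odd cycle is a triangle, which \<open>three_apart\<close> describes, or an \<open>arc_cycle\<close>. In the
  second case the chord \<open>l\<close> of the admissible pair is the chord \<open>-2 l\<close> of the cycle.\<close>

lemma not_bipartite_cases:
  assumes W: "W \<subseteq> edges n"
    and nb: "\<not> (\<exists>C. \<forall>E\<in>W. \<forall>F\<in>W. apart E F \<longrightarrow> (E \<in>
        C) \<noteq> (F \<in> C))"
  obtains (master) k i j where "admissible n k i j"
      "inj_on (\<lambda>l. {i l, j ((l + k - 1) mod (2 * k + 1))}) {..<2 * k + 1}"
      "\<And>l. l < 2 * k + 1 \<Longrightarrow> {i l, j ((l + k - 1) mod (2 * k + 1))} \<in> W"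
  | (minor) a0 a1 a2 b2 b1 b0 where "cyc6 a0 a1 a2 b2 b1 b0" "{a0, b0} \<in> W" "{a1, b1} \<in> W"
      "{a2, b2} \<in> W"
proof -
  have sym: "apart F E" if "apart E F" for E F using that apart_commute by blast
  obtain L :: int and f :: "int \<Rightarrow> nat set" where f: "odd L" "0 < L" "\<And>s. f s \<in> W"
      "\<And>s. f (s + L) = f s" "\<And>s. apart (f s) (f (s + 1))"
    "\<And>s t. (s - t) mod L \<noteq> 0 \<Longrightarrow> (s - t) mod L \<noteq> 1 \<Longrightarrow>
        (s - t) mod L \<noteq> L - 1 \<Longrightarrow> f s \<noteq> f t \<and> \<not> apart (f s) (f t)"
    "\<And>s t. (s - t) mod L \<noteq> 0 \<Longrightarrow> f s \<noteq> f t"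
  proof (rule odd_cycle[OF sym nb], goal_cases)
    case (2 L f)
    from 2(2-) show ?case by (rule 2(1))
  qed
  have rng: "f s \<subseteq> {1..n}" for s using f(3)[of s] W unfolding edges_def by fastforce
  have irr: "\<not> apart E E" for E
  proof
    assume "apart E E"
    then obtain p q u v where "{p, q} = {u, v}" "disjoint_arcs p q u v" unfolding apart_def by blast
    moreover have "arc p q p" "arc p q q" by (auto simp: arc_def)
    ultimately show False unfolding disjoint_arcs_def doubleton_eq_iff by blast
  qed
  have "L \<noteq> 1"
  proof
    assume "L = 1"
    have "f (0 + 1) = f 0" using f(4)[of 0] unfolding \<open>L = 1\<close> .
    then show False using f(5)[of 0] irr[of "f 0"] by (simp only:)
  qed
  moreover obtain b where "L = 2 * b + 1" using f(1) by (rule oddE)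
  ultimately have "L = 3 \<or> 5 \<le> L" using f(2) by presburger
  then consider "L = 3" | "5 \<le> L" by blast
  then show thesis
  proof cases
    case 1
    have ap: "apart (f 0) (f 2)" "apart (f 0) (f 1)" "apart (f 1) (f 2)"
      using f(5)[of 0] f(5)[of 1] f(5)[of 2] f(4)[of 0] 1 sym by simp_all
    obtain p0 q0 p1 q1 where
      pq: "f 0 = {p0, q0}" "f 1 = {p1, q1}" "p0 \<noteq> q0" "p1 \<noteq> q1"
          "disjoint_arcs p0 q0 p1 q1" using ap(2) unfolding apart_def by blast
    obtain p2 q2 where pq2: "f 2 = {p2, q2}" "p2 \<noteq> q2" using ap(1) unfolding apart_def by blast
    have nc: "noncrossing p0 q0 p2 q2" "noncrossing p1 q1 p2 q2"
      using ap(1,3) apart_iff_noncrossing[OF pq(3) pq2(2)] apart_iff_noncrossing[OF pq(4) pq2(2)]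
          unfolding pq(1,2) pq2(1) by simp_all
    have W0: "{p0, q0} \<in> W" "{p1, q1} \<in> W" "{p2, q2} \<in> W"
      using f(3)[of 0] f(3)[of 1] f(3)[of 2] unfolding pq pq2 by blast+
    have W': "{p0, q0} \<in> W" "{p1, q1} \<in> W" "{p2, q2} \<in> W" "{q0, p0} \<in> W"
        "{q1, p1} \<in> W" "{q2, p2} \<in> W"
      using W0 unfolding insert_commute[of q0 p0] insert_commute[of q1 p1] insert_commute[of q2 p2] by blast+
    have R: "p0 \<in> {1..n}" "q0 \<in> {1..n}" "p1 \<in> {1..n}" "q1 \<in> {1..n}" "p2 \<in> {1..n}"
        "q2 \<in> {1..n}"
      using rng[of 0] rng[of 1] rng[of 2] pq pq2 by simp_all
    have three: "{..<2 * 1 + 1} = {0, 1, 2::nat}" by auto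
    have sides: thesis if c: "cyc6 x0 y0 x1 y1 x2 y2" "x0 \<in> {1..n}" "y0 \<in> {1..n}"
        "x1 \<in> {1..n}" "y1 \<in> {1..n}" "x2 \<in> {1..n}" "y2 \<in> {1..n}" 
      "{x0, y0} \<in> W" "{x1, y1} \<in> W" "{x2, y2} \<in> W" for x0 y0 x1 y1 x2 y2
    proof (rule master[OF admissible_sides[OF c(1), of n]])
      have "{x0, y0} \<noteq> {x1, y1}" "{x0, y0} \<noteq> {x2, y2}" "{x1, y1} \<noteq> {x2, y2}"
        using c(1) unfolding cyc6_def cyc_def doubleton_eq_iff using [[smt_nat_as_int]] by (smt (z3))+
      note ne = this
      define E where "E = (\<lambda>l. {if l = 0 then x0 else if l = 1 then x1 else x2,
          if (l + 1 - 1) mod (2 * 1 + 1) = 0 then y0 else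
              if (l + 1 - 1) mod (2 * 1 + 1) = (1::nat) then y1 else y2})"
      have E: "E 0 = {x0, y0}" "E 1 = {x1, y1}" "E 2 = {x2, y2}" by (simp_all add: E_def)
      have "inj_on E {0, 1, 2}" by (rule inj_on_three; unfold E; fact ne)
      then show "inj_on (\<lambda>l::nat. {if l = 0 then x0 else if l = 1 then x1 else x2,
          if (l + 1 - 1) mod (2 * 1 + 1) = 0 then y0 else
              if (l + 1 - 1) mod (2 * 1 + 1) = 1 then y1 else y2}) {..<2 * 1 + 1}"
        unfolding three E_def .
      show "{if l = 0 then x0 else if l = 1 then x1 else x2,
          if (l + 1 - 1) mod (2 * 1 + 1) = 0 then y0 else
              if (l + 1 - 1) mod (2 * 1 + 1) = 1 then y1 else y2} \<in> W" 
        if "l < 2 * 1 + 1" for l :: nat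
      proof -
        have "l = 0 \<or> l = 1 \<or> l = 2" using that by linarith
        then show ?thesis using c(8-10) by (elim disjE) simp_all
      qed
    qed (use c in simp)
    from three_apart[OF pq(5) nc pq(3,4) pq2(2)] show thesis
    proof (elim disjE)
      assume "cyc6 p0 q0 p1 q1 p2 q2"
      then show thesis by (rule sides) (rule R W')+
    next
      assume "cyc6 p0 q0 p1 q1 q2 p2"
      then show thesis by (rule sides) (rule R W')+
    next
      assume "cyc6 p0 q0 p2 q2 p1 q1"
      then show thesis by (rule sides) (rule R W')+
    next
      assume "cyc6 p0 q0 q2 p2 p1 q1"
      then show thesis by (rule sides) (rule R W')+
    next
      assume "cyc6 q0 p2 p1 q1 q2 p0"
      then show thesis by (rule minor) (rule W')+
    next
      assume "cyc6 q0 q2 p1 q1 p2 p0"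
      then show thesis by (rule minor) (rule W')+
    next
      assume "cyc6 q1 p0 p2 q2 q0 p1"
      then show thesis by (rule minor) (rule W')+
    next
      assume "cyc6 q1 p0 q2 p2 q0 p1"
      then show thesis by (rule minor) (rule W')+
    next
      assume "cyc6 q0 p1 p2 q2 q1 p0"
      then show thesis by (rule minor) (rule W')+
    next
      assume "cyc6 q0 p1 q2 p2 q1 p0"
      then show thesis by (rule minor) (rule W')+
    qed
  next
    case 2
    define m where "m = (L - 1) div 2"
    have m: "L = 2 * m + 1" "2 \<le> m" using 2 f(1) by (auto simp: m_def elim!: oddE)
    have far2: "f (s + 1) \<noteq> f (s - 1) \<and> \<not> apart (f (s + 1)) (f (s - 1))" for s
      by (rule f(6)) (use 2 in auto)
    define good where "good s a b \<longleftrightarrow> f s = {a, b} \<and> a \<noteq> b \<and>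
        (\<forall>x \<in> f (s + 1) \<union> f (s - 1). \<not> arc a b x)" for s a b
    have "\<exists>a b. good s a b" for s
    proof -
      have "apart (f s) (f (s - 1))" using f(5)[of "s - 1"] apart_commute by simp
      from orient_chord[OF f(5) this] far2[of s] obtain a b
        where "f s = {a, b}" "a \<noteq> b" "\<And>x. x \<in> f (s
            + 1) \<union> f (s - 1) \<Longrightarrow> \<not> arc a b x" by blast
      then show ?thesis unfolding good_def by blast
    qed
    then obtain P Q where PQ: "\<And>s. good s (P s) (Q s)" by metis
    \<comment> \<open>choices at the residues modulo \<open>L\<close>, to make the orientation periodic\<close>
    define p q where "p s = P (s mod L)" and "q s = Q (s mod L)" for s
    have fm: "f (s mod L + d) = f (s + d)" for s d
    proof -
      have "f (s + L * k) = f s" for s and k :: int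
      proof (induction k rule: int_induct[of _ 0])
        case (step1 i)
        then show ?case using f(4)[of "s + L * i"] by (simp add: algebra_simps)
      next
        case (step2 i)
        then show ?case using f(4)[of "s + L * (i - 1)"] by (simp add: algebra_simps)
      qed simp
      from this[of "s mod L + d" "s div L"] show ?thesis by (simp add: algebra_simps)
    qed
    have fpq: "f s = {p s, q s}" and neq: "p s \<noteq> q s" for s
      using PQ[of "s mod L"] fm[of s 0] by (simp_all add: p_def q_def good_def)
    have out: "\<not> arc (p s) (q s) x" if "x \<in> f (s + 1) \<union> f (s - 1)" for s x
      using PQ[of "s mod L"] that fm[of s 0] fm[of s 1] fm[of s "- 1"] by (simp add: p_def q_def good_def)
    have cyc: "arc_cycle m p q"
    proof
      show "2 \<le> m" by (rule m)
      show "p (s + (2 * m + 1)) = p s" "q (s + (2 * m + 1)) = q s" for s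
        using f(4)[of s] unfolding m(1)[symmetric] p_def q_def by simp_all
      show "p s \<noteq> q s" for s by (rule neq)
      show "disjoint_arcs (p s) (q s) (p (s + 1)) (q (s + 1))" for s
        by (rule disjoint_arcsI) (use out[of _ s] out[of _ "s + 1"] fpq in auto)
      show "touching (p s) (q s) (p t) (q t)" if "(s - t) mod (2 * m + 1) \<notin> {0, 1, 2 * m}" for s t
        using f(6)[of s t] that not_apart_iff_touching[OF neq[of s] neq[of t]] fpq unfolding m(1) by auto
    qed
    have main: thesis if cyc: "arc_cycle m u v" and f': "\<And>s. f (e * s) = {u s, v s}" and e: "e
        = 1 \<or> e = -1" 
       and lag: "lags (u 0) (v 0) (u 2) (v 2)" for u v e
    proof -
      have lagall: "lags (u s) (v s) (u (s + 2)) (v (s + 2))" for s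
        using arc_cycle.lag_all[OF cyc, of 0] lag by simp
      define k where "k = nat m"
      have k: "m = int k" using m by (simp add: k_def)
      have rng': "u s \<in> {1..n}" "v s \<in> {1..n}" for s using rng[of "e * s"] f' by auto
      note adm = arc_cycle.admissible_cycle[OF cyc lagall rng' k]
      have eq: "{u (- 2 * int l), v (- 2 * int ((l + k - 1) mod (2 * k + 1)) - 3)}
          = f (e * (- 2 * int l))" if "l < 2 * k + 1" for l
        unfolding adm(2)[OF that] f' ..
      show thesis
      proof (rule master[OF adm(1)])
        show "inj_on (\<lambda>l. {u (- 2 * int l), v (- 2 * int ((l + k - 1) mod (2 * k
            + 1)) - 3)}) {..<2 * k + 1}"
        proof (rule inj_onI)
          fix l l' assume l: "l \<in> {..<2 * k + 1}" "l' \<in> {..<2 * k + 1}"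
            "{u (- 2 * int l), v (- 2 * int ((l + k - 1) mod (2 * k + 1)) - 3)}
                = {u (- 2 * int l'), v (- 2 * int ((l' + k - 1) mod (2 * k + 1)) - 3)}"
          then have "f (e * (- 2 * int l)) = f (e * (- 2 * int l'))" using eq[of l] eq[of l'] by simp
          then have "(e * (- 2 * int l) - e * (- 2 * int l')) mod L = 0" using f(7) by blast
          then have "L dvd e * (2 * (int l' - int l))" by (simp add: dvd_eq_mod_eq_0 algebra_simps)
          then have "L dvd 2 * (int l' - int l)" using e by (metis dvd_minus_iff mult_1 mult_minus1)
          moreover have "coprime L 2" using f(1) by simp
          ultimately have "L dvd int l' - int l" using coprime_dvd_mult_right_iff by blast
          moreover have "\<bar>int l' - int l\<bar> < L" using l m k by auto
          ultimately have "int l' - int l = 0" using dvd_imp_le_int[of "int l' - int l" L] f(2) by auto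
          then show "l = l'" by simp
        qed
        show "{u (- 2 * int l), v (- 2 * int ((l + k - 1) mod (2 * k + 1)) - 3)} \<in> W"
            if "l < 2 * k + 1" for l
          unfolding eq[OF that] by (rule f(3))
      qed
    qed
    from arc_cycle.exists_lag[OF cyc, of 0] show thesis
    proof
      assume "lags (p 0) (q 0) (p (0 + 2)) (q (0 + 2))"
      then show thesis using main[OF cyc, of 1] fpq by simp
    next
      assume "lags (p (0 + 2)) (q (0 + 2)) (p 0) (q 0)"
      then have "lags (p (- (- 2))) (q (- (- 2))) (p (- (- 2 + 2))) (q (- (- 2 + 2)))" by simp
      from arc_cycle.lag_all[OF arc_cycle.reverse[OF cyc], OF this, of 0] show thesis
        using main[OF arc_cycle.reverse[OF cyc], of "-1"] fpq by simp
    qed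
  qed
qed

section \<open>Thrackles\<close>

definition open_arc :: "nat \<Rightarrow> nat \<Rightarrow> nat set" where
  "open_arc a b = {x. arc a b x \<and> x \<noteq> a \<and> x \<noteq> b}"

text \<open>An edge inside one of the two arcs would have to be met by all others. If there is no such
  edge, an edge at \<open>a\<close> and one at \<open>b\<close> must lead to the same side in order to meet, and then
  every edge meets that side.\<close>

lemma thrackle_meets_arc:
  assumes K: "\<And>E. E \<in> K \<Longrightarrow> \<exists>x y. E = {x, y} \<and> x \<noteq> y" 
    and thr: "\<And>E F. E \<in> K \<Longrightarrow> F \<in> K \<Longrightarrow> \<not> apart E F"
    and ab: "a \<noteq> b" "{a, b} \<notin> K" and A: "A \<in> K" "a \<in> A" and B: "B \<in> K" "b \<in> B"
  shows "(\<forall>E\<in>K. E \<inter> open_arc a b \<noteq> {}) \<or>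
      (\<forall>E\<in>K. E \<inter> open_arc b a \<noteq> {})"
proof -
  obtain x where x: "A = {a, x}" "x \<noteq> a" using K[OF A(1)] A(2) by auto
  obtain y where y: "B = {b, y}" "y \<noteq> b" using K[OF B(1)] B(2) by auto
  have xb: "x \<noteq> b" "y \<noteq> a" using x y A(1) B(1) ab by (auto simp: insert_commute)
  have nAB: "\<not> noncrossing a x b y" using thr[OF A(1) B(1)] apart_iff_noncrossing[of a x b y] x y by auto
  show ?thesis
  proof (rule ccontr)
    assume "\<not> ?thesis"
    then obtain E F where E: "E \<in> K" "E \<inter> open_arc a b = {}" and F: "F \<in> K"
        "F \<inter> open_arc b a = {}" by blast
    obtain e e' where e: "E = {e, e'}" "e \<noteq> e'" using K[OF E(1)] by auto
    obtain g g' where g: "F = {g, g'}" "g \<noteq> g'" using K[OF F(1)] by auto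
    have nab: "{e, e'} \<noteq> {a, b}" "{g, g'} \<noteq> {a, b}" using E(1) F(1) ab(2) e(1) g(1) by auto
    have m: "\<not> (arc a b e \<and> e \<noteq> a \<and> e \<noteq> b)"
        "\<not> (arc a b e' \<and> e' \<noteq> a \<and> e' \<noteq> b)" 
      "\<not> (arc b a g \<and> g \<noteq> a \<and> g \<noteq> b)"
          "\<not> (arc b a g' \<and> g' \<noteq> a \<and> g' \<noteq> b)"
      using E(2) F(2) unfolding e g open_arc_def by auto
    have n: "\<not> noncrossing e e' g g'" "\<not> noncrossing a x e e'" "\<not> noncrossing b y e e'"
        "\<not> noncrossing a x g g'" "\<not> noncrossing b y g g'"
      using thr[OF E(1) F(1)] thr[OF A(1) E(1)] thr[OF B(1) E(1)] thr[OF A(1) F(1)] thr[OF B(1) F(1)]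
        apart_iff_noncrossing e g x y by metis+
    from m n nAB nab ab(1) x(2) y(2) xb e(2) g(2) show False
      unfolding noncrossing_def arc_def doubleton_eq_iff using [[smt_nat_as_int]] by (smt (z3))
  qed
qed

lemma apart_from_chord:
  assumes "a \<noteq> b" "x \<noteq> y" "x \<in> open_arc a b" "y \<in> open_arc a b"
  shows "apart {a, b} {x, y}"
  using assms unfolding apart_iff_noncrossing[OF assms(1,2)] open_arc_def noncrossing_def by auto

definition cyc4 :: "nat \<Rightarrow> nat \<Rightarrow> nat \<Rightarrow> nat \<Rightarrow> bool" where
  "cyc4 a b c d \<longleftrightarrow> cyc a b c \<and> cyc a c d"

lemma cyc4_cases: "cyc4 a b c d \<Longrightarrow> a < b \<and> b < c \<and> c < d \<or> b < c \<and>
    c < d \<and> d < a \<or> c < d \<and> d < a \<and> a < b \<or> d < a \<and> a < b \<and> b < c"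
  unfolding cyc4_def cyc_def by linarith

lemma cyc4_distinct: "cyc4 a b c d \<Longrightarrow> a \<noteq> b \<and> a \<noteq> c \<and>
    a \<noteq> d \<and> b \<noteq> c \<and> b \<noteq> d \<and> c \<noteq> d"
  using cyc4_cases by fastforce

lemma cdist_bounds:
  assumes "a < b"
  shows "cdist n a b \<le> b - a" "cdist n a b \<le> n - (b - a)"
      "cdist n a b = b - a \<or> cdist n a b = n - (b - a)"
  using assms by (simp_all add: cdist_def min_def)

lemma cdist_sorted:
  assumes "1 \<le> a" "a < b" "b < c" "c < d" "d \<le> n"
  shows "cdist n a b < cdist n a c \<or> cdist n c d < cdist n a c"
      "cdist n a b < cdist n b d \<or> cdist n c d < cdist n b d"
    "cdist n b c < cdist n a c \<or> cdist n a d < cdist n a c"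
        "cdist n b c < cdist n b d \<or> cdist n a d < cdist n b d"
proof -
  have ac: "cdist n a c = c - a \<or> cdist n a c = n - (c - a)" and bd: "cdist n b d = d - b \<or>
      cdist n b d = n - (d - b)"
    using cdist_bounds(3) assms by auto
  have "cdist n a b \<le> b - a" "cdist n b c \<le> c - b" "cdist n c d \<le> d - c"
      "cdist n a d \<le> n - (d - a)"
    using cdist_bounds(1,2) assms by auto
  moreover have "b - a < c - a" "d - c < n - (c - a)" "d - c < d - b" "b - a < n - (d - b)"
      "c - b < c - a" "c - b < d - b"
      "n - (d - a) < n - (c - a)" "n - (d - a) < n - (d - b)"
    using assms by linarith+
  ultimately show "cdist n a b < cdist n a c \<or> cdist n c d < cdist n a c"
      "cdist n a b < cdist n b d \<or> cdist n c d < cdist n b d"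
    "cdist n b c < cdist n a c \<or> cdist n a d < cdist n a c"
        "cdist n b c < cdist n b d \<or> cdist n a d < cdist n b d"
    using ac bd by (metis order_le_less_trans)+
qed

text \<open>The shorter arc over a diagonal of a quadrilateral contains two of its sides, and any two
  adjacent sides include one of each pair of opposite sides.\<close>

lemma cdist_cyc4:
  assumes "cyc4 a b c d" "{a, b, c, d} \<subseteq> {1..n}"
  shows "cdist n a b < cdist n a c \<or> cdist n c d < cdist n a c"
      "cdist n a b < cdist n b d \<or> cdist n c d < cdist n b d"
proof -
  have i: "a \<le> n" "b \<le> n" "c \<le> n" "d \<le> n" "1 \<le> a" "1 \<le> b" "1 \<le> c"
      "1 \<le> d" using assms(2) by auto
  note cc = cdist_commute[of n b a] cdist_commute[of n c a] cdist_commute[of n d a] cdist_commute[of n c b]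
      cdist_commute[of n d b] cdist_commute[of n d c]
  have "(cdist n a b < cdist n a c \<or> cdist n c d < cdist n a c) \<and>
      (cdist n a b < cdist n b d \<or> cdist n c d < cdist n b d)"
    using cyc4_cases[OF assms(1)]
  proof (elim disjE conjE)
    assume "a < b" "b < c" "c < d" 
    then show ?thesis using cdist_sorted(1,2)[of a b c d n] i by blast
  next
    assume "b < c" "c < d" "d < a"
    then show ?thesis using cdist_sorted(3,4)[of b c d a n] i unfolding cc by blast
  next
    assume "c < d" "d < a" "a < b"
    then show ?thesis using cdist_sorted(1,2)[of c d a b n] i unfolding cc by blast
  next
    assume "d < a" "a < b" "b < c"
    then show ?thesis using cdist_sorted(3,4)[of d a b c n] i unfolding cc by blast
  qed
  then show "cdist n a b < cdist n a c \<or> cdist n c d < cdist n a c"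
      "cdist n a b < cdist n b d \<or> cdist n c d < cdist n b d" by auto
qed

lemma edgesI: "a \<in> {1..n} \<Longrightarrow> b \<in> {1..n} \<Longrightarrow>
    a \<noteq> b \<Longrightarrow> {a, b} \<in> edges n"
proof (cases "a < b")
  case True
  then show "a \<in> {1..n} \<Longrightarrow> b \<in> {1..n} \<Longrightarrow>
      ?thesis" unfolding edges_def by auto
next
  case False
  then show "a \<in> {1..n} \<Longrightarrow> b \<in> {1..n} \<Longrightarrow>
      a \<noteq> b \<Longrightarrow> ?thesis" 
    unfolding edges_def mem_Collect_eq by (intro exI[of _ b] exI[of _ a]) auto
qed

lemma edgesE: 
  assumes "E \<in> edges n" obtains a b where "E = {a, b}" "a \<noteq> b" "a \<in> {1..n}" "b \<in> {1..n}"
proof -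
  obtain a b where "E = {a, b}" "1 \<le> a" "a < b" "b \<le> n" using assms unfolding edges_def by blast
  then show ?thesis using that[of a b] by simp
qed

lemma edges_subset: "E \<in> edges n \<Longrightarrow> E \<subseteq> {1..n}"
  by (erule edgesE) simp

lemma finite_edges: "finite (edges n)"
proof -
  have "edges n \<subseteq> Pow {1..n}" by (auto elim!: edgesE)
  then show ?thesis by (rule finite_subset) simp
qed

abbreviation edge_deg :: "nat set \<Rightarrow> nat monomial" where
  "edge_deg E \<equiv> (\<Sum>a\<in>E. single a 1)"

abbreviation edge :: "nat \<Rightarrow> nat \<Rightarrow> nat set monomial" where
  "edge a b \<equiv> single {a, b} 1"

lemma edge_commute: "edge a b = edge b a" by (simp add: insert_commute)

lemma push_edge: "a \<noteq> b \<Longrightarrow> push edge_deg (edge a b) = single a 1 + single b 1"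
  by (simp only: push_single) simp

lemma edge_monomials: "a \<in> {1..n} \<Longrightarrow> b \<in> {1..n} \<Longrightarrow>
    a \<noteq> b \<Longrightarrow> edge a b \<in> monomials (edges n)"
  using edgesI[of a n b] by (simp add: monomials_def)

lemma hypersimplex_map_eq: "hypersimplex_map = substitute (\<lambda>E. single (edge_deg E) 1)"
  by (simp add: hypersimplex_map_def Var_def single_prod)

lemma lookup_push_edge_deg:
  assumes "m \<in> monomials (edges n)"
  shows "lookup (push edge_deg m) v = (\<Sum>E\<in>keys m. lookup m E * (if v \<in> E then 1 else 0))"
  unfolding lookup_push
proof (rule sum.cong[OF refl])
  fix E assume "E \<in> keys m"
  then have "E \<in> edges n" using assms by (auto simp: monomials_def)
  then have "finite E" by (auto elim!: edgesE)
  then show "lookup m E * lookup (edge_deg E) v = lookup m E * (if v \<in> E then 1 else 0)"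
    by (simp add: lookup_sum lookup_single when_def)
qed

lemma arc_degree:
  assumes "m \<in> monomials (edges n)"
  shows "(\<Sum>v\<in>{1..n} \<inter> S. lookup (push edge_deg m) v)
      = (\<Sum>E\<in>keys m. lookup m E * card (E \<inter> S))"
proof -
  have "(\<Sum>v\<in>{1..n} \<inter> S. lookup (push edge_deg m) v) =
      (\<Sum>E\<in>keys m. \<Sum>v\<in>{1..n} \<inter> S. lookup m E * (if v \<in> E then 1 else 0))"
    unfolding lookup_push_edge_deg[OF assms] by (rule sum.swap)
  also have "\<dots> = (\<Sum>E\<in>keys m. lookup m E * card (E \<inter> S))"
  proof (rule sum.cong[OF refl])
    fix E assume "E \<in> keys m"
    then have "E \<in> edges n" using assms by (auto simp: monomials_def)
    then have "E \<subseteq> {1..n}" by (auto elim!: edgesE)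
    then have "{1..n} \<inter> S \<inter> E = E \<inter> S" by blast
    then have "(\<Sum>v\<in>{1..n} \<inter> S. if v \<in> E then 1 else 0) = card (E \<inter> S)"
      by (simp add: sum.If_cases)
    then show "(\<Sum>v\<in>{1..n} \<inter> S. lookup m E * (if v \<in> E then 1 else 0))
        = lookup m E * card (E \<inter> S)"
      unfolding sum_distrib_left[symmetric] by simp
  qed
  finally show ?thesis .
qed

definition total_degree :: "nat set monomial \<Rightarrow> nat" where
  "total_degree m = (\<Sum>E\<in>keys m. lookup m E)"

lemma sum_degrees:
  assumes "m \<in> monomials (edges n)"
  shows "(\<Sum>v\<in>{1..n}. lookup (push edge_deg m) v) = 2 * total_degree m"
proof -
  have "card (E \<inter> UNIV) = 2" if "E \<in> keys m" for E
    using that assms by (auto simp: monomials_def elim!: edgesE)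
  then have "(\<Sum>E\<in>keys m. lookup m E * card (E \<inter> UNIV)) = (\<Sum>E\<in>keys m. lookup m E * 2)"
    by (intro sum.cong) auto
  then show ?thesis using arc_degree[OF assms, of UNIV]
      by (simp add: total_degree_def sum_distrib_left mult.commute)
qed

definition thrackle :: "nat set monomial \<Rightarrow> bool" where
  "thrackle m \<longleftrightarrow> (\<forall>E\<in>keys m. \<forall>F\<in>keys m. \<not> apart E F)"

text \<open>If \<open>{a, b}\<close> is a chord of the thrackle \<open>m\<close>, every other chord of \<open>m\<close> has at most one end in
  either open arc between \<open>a\<close> and \<open>b\<close>, so the degrees in each arc sum to less than the number
  of chords. If \<open>m'\<close> lacked this chord, then by \<open>thrackle_meets_arc\<close> the degrees in one of the
  arcs would sum to at least that number.\<close>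

lemma thrackle_edge_determined:
  assumes m: "m \<in> monomials (edges n)" "thrackle m" and m': "m' \<in> monomials (edges n)" "thrackle m'"
    and eq: "push edge_deg m = push edge_deg m'" and E: "E \<in> keys m"
  shows "E \<in> keys m'"
proof (rule ccontr)
  assume nE: "E \<notin> keys m'"
  have eE: "F \<in> edges n" if "F \<in> keys m \<or> F \<in> keys m'" for F
      using that m m' by (auto simp: monomials_def)
  obtain a b where ab: "E = {a, b}" "a \<noteq> b" "a \<in> {1..n}"
      "b \<in> {1..n}" using eE[of E] E by (auto elim!: edgesE)
  have size: "total_degree m = total_degree m'" using sum_degrees[OF m(1)] sum_degrees[OF m'(1)] eq by simp
  have "\<exists>A\<in>keys m'. c \<in> A" if "c \<in> E" for c
  proof (rule ccontr)
    assume "\<not> (\<exists>A\<in>keys m'. c \<in> A)"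
    then have "lookup (push edge_deg m) c = 0"
        unfolding eq lookup_push_edge_deg[OF m'(1)] by (intro sum.neutral) auto
    then have "\<forall>F\<in>keys m. lookup m F * (if c \<in> F then 1 else 0) = 0"
      unfolding lookup_push_edge_deg[OF m(1)] by simp
    from bspec[OF this E] show False using E that by (simp add: in_keys_iff)
  qed
  then obtain A B where AB: "A \<in> keys m'" "a \<in> A" "B \<in> keys m'" "b \<in> B" using ab(1) by blast
  have K: "\<exists>x y. F = {x, y} \<and> x \<noteq> y" if "F \<in> keys m'" for F
      using eE[of F] that by (auto elim!: edgesE)
  have thr: "\<not> apart F G" if "F \<in> keys m'"
      "G \<in> keys m'" for F G using m'(2) that by (auto simp: thrackle_def)
  obtain x y where xy: "{x, y} = E" "x \<noteq> y" "\<forall>F\<in>keys m'. F \<inter> open_arc x y \<noteq> {}"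
  proof -
    have "{a, b} \<notin> keys m'" using nE ab(1) by simp
    from thrackle_meets_arc[OF K thr ab(2) this AB] show thesis
      using that[of a b] that[of b a] ab(1,2) by (auto simp: insert_commute)
  qed
  let ?S = "open_arc x y"
  have fin: "finite F" if "F \<in> edges n" for F using that by (auto elim!: edgesE)
  have "total_degree m' \<le> (\<Sum>F\<in>keys m'. lookup m' F * card (F \<inter> ?S))"
    unfolding total_degree_def
  proof (rule sum_mono)
    fix F assume F: "F \<in> keys m'"
    then have "0 < card (F \<inter> ?S)" using xy(3) fin[OF eE, of F] by (simp add: card_gt_0_iff)
    then show "lookup m' F \<le> lookup m' F * card (F \<inter> ?S)" by simp
  qed
  also have "\<dots> = (\<Sum>F\<in>keys m. lookup m F * card (F \<inter> ?S))"
    using arc_degree[OF m(1), of ?S] arc_degree[OF m'(1), of ?S] eq by simp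
  also have "\<dots> < total_degree m"
    unfolding total_degree_def
  proof (rule sum_strict_mono_ex1)
    show "\<forall>F\<in>keys m. lookup m F * card (F \<inter> ?S) \<le> lookup m F"
    proof
      fix F assume F: "F \<in> keys m"
      obtain u v where uv: "F = {u, v}" "u \<noteq> v" using eE[of F] F by (auto elim!: edgesE)
      have "\<not> (u \<in> ?S \<and> v \<in> ?S)"
          using apart_from_chord[OF xy(2) uv(2)] m(2) F E uv(1) xy(1) by (auto simp: thrackle_def)
      then have "F \<inter> ?S \<subseteq> {u} \<or> F \<inter> ?S \<subseteq> {v}" using uv(1) by blast
      then have "card (F \<inter> ?S) \<le> 1"
          by (metis card_mono card_1_singleton_iff finite.emptyI finite.insertI One_nat_def)
      then show "lookup m F * card (F \<inter> ?S) \<le> lookup m F" by (metis mult_le_mono2 mult_1_right)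
    qed
    have "E \<inter> ?S = {}" using xy(1) by (auto simp: open_arc_def)
    then show "\<exists>F\<in>keys m. lookup m F * card (F \<inter> ?S) < lookup m F"
      using E by (intro bexI[of _ E]) (auto simp: in_keys_iff)
  qed simp
  finally show False using size by simp
qed

text \<open>Both thrackles have the same chords by \<open>thrackle_edge_determined\<close>, and removing one copy of
  a chord from both preserves the hypotheses.\<close>

lemma thrackle_unique:
  assumes "m \<in> monomials (edges n)" "thrackle m" "m' \<in> monomials (edges n)" "thrackle m'"
      "push edge_deg m = push edge_deg m'"
  shows "m = m'"
  using assms
proof (induction "total_degree m" arbitrary: m m' rule: less_induct)
  case less
  show ?case
  proof (cases "keys m = {}")
    case True
    then have "keys m' = {}" 
      using thrackle_edge_determined[OF less.prems(3,4,1,2) less.prems(5)[symmetric]] by blast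
    with True show ?thesis by simp
  next
    case False
    then obtain E where E: "E \<in> keys m" by blast
    then have E': "E \<in> keys m'" using thrackle_edge_determined less.prems by blast
    let ?e = "single E 1 :: nat set monomial"
    define m1 m1' where "m1 = m - ?e" and "m1' = m' - ?e"
    have m1: "m = m1 + ?e" using E by (intro poly_mapping_eqI) (auto simp: m1_def lookup_add lookup_minus
        lookup_single when_def in_keys_iff)
    have m1': "m' = m1' + ?e" using E' by (intro poly_mapping_eqI) (auto simp: m1'_def lookup_add
        lookup_minus lookup_single when_def in_keys_iff)
    have sub: "keys m1 \<subseteq> keys m" "keys m1' \<subseteq> keys m'"
      by (auto simp: m1 m1' in_keys_iff lookup_add)
    have mon: "m1 \<in> monomials (edges n)" "m1' \<in> monomials (edges n)"
      using less.prems(1,3) monomials_add_iff unfolding m1 m1' by blast+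
    have thr: "thrackle m1" "thrackle m1'" using less.prems(2,4) sub unfolding thrackle_def by blast+
    have p: "push edge_deg m1 = push edge_deg m1'" using less.prems(5) unfolding m1 m1' push_add by simp
    have "2 * total_degree m = 2 * total_degree m1 + (\<Sum>v\<in>{1..n}. lookup (push edge_deg ?e) v)"
      unfolding sum_degrees[OF less.prems(1), symmetric] sum_degrees[OF mon(1), symmetric]
      by (subst (1) m1) (simp add: push_add lookup_add sum.distrib del: push_single)
    moreover have eM: "?e \<in> monomials (edges n)" using less.prems(1) monomials_add_iff unfolding m1 by blast
    moreover have "total_degree ?e = 1" by (simp add: total_degree_def)
    ultimately have "total_degree m1 < total_degree m" using sum_degrees[OF eM] by simp
    from less.hyps[OF this mon(1) thr(1) mon(2) thr(2) p] show ?thesis using m1 m1' by simp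
  qed
qed

lemma finite_bounded_monomials:
  assumes "finite V" shows "finite {m \<in> monomials V. \<forall>v. lookup m v \<le> N}"
proof (rule finite_imageD)
  show "inj_on lookup {m \<in> monomials V. \<forall>v. lookup m v \<le> N}"
    by (auto simp: inj_on_def intro: poly_mapping_eqI)
  have "finite {f. \<forall>x. (x \<in> V \<longrightarrow> f x \<in> {..N}) \<and>
      (x \<notin> V \<longrightarrow> f x = 0)}"
    by (rule finite_set_of_finite_funs) (use assms in auto)
  then show "finite (lookup ` {m \<in> monomials V. \<forall>v. lookup m v \<le> N})"
    by (rule rev_finite_subset) (auto simp: monomials_def in_keys_iff)
qed

lemma finite_fibre: "finite {m \<in> monomials (edges n). push edge_deg m = d}"
proof -
  have "lookup m E \<le> (\<Sum>v\<in>{1..n}. lookup d v)" 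
    if m: "m \<in> monomials (edges n)" "push edge_deg m = d" for m E
  proof (cases "E \<in> keys m")
    case True
    have "lookup m E \<le> total_degree m" unfolding total_degree_def by (rule member_le_sum) (use True in auto)
    also have "\<dots> \<le> 2 * total_degree m" by simp
    finally show ?thesis using sum_degrees[OF m(1)] m(2) by simp
  qed (simp add: in_keys_iff)
  then have "{m \<in> monomials (edges n). push edge_deg m
      = d} \<subseteq> {m \<in> monomials (edges n). \<forall>E. lookup m E \<le> (\<Sum>v\<in>{1..n}.
      lookup d v)}"
    by blast
  then show ?thesis by (rule finite_subset) (rule finite_bounded_monomials[OF finite_edges])
qed

section \<open>Standard monomials of a circular term order\<close>

locale circular =
  fixes n :: nat and r :: "nat set monomial rel"
  assumes n: "2 \<le> n" and circ: "circular_term_order n r"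
begin

lemma term_order: "term_order (edges n) r"
  and crossing_less: "cyc4 a b c d \<Longrightarrow> {a, b, c, d} \<subseteq> {1..n} \<Longrightarrow> 
    (edge a c + edge b d, edge a b + edge c d) \<in> r \<and> edge a c + edge b d \<noteq> edge a b + edge c d"
proof -
  obtain t where tt: "\<And>d. d \<in> {1..n div 2} \<Longrightarrow>
      term_order (edge_class n d) (t d)" "r = block_order (n div 2) (edge_class n) t"
    using circ unfolding circular_term_order_def by blast
  interpret blocks "n div 2" "edge_class n" t by unfold_locales (rule tt(1))
  show "term_order (edges n) r" using block_term_order unfolding tt(2) edge_class_Union[OF n] .
  assume c: "cyc4 a b c d" and in_n: "{a, b, c, d} \<subseteq> {1..n}"
  have i: "a \<in> {1..n}" "b \<in> {1..n}" "c \<in> {1..n}" "d \<in> {1..n}" using in_n by auto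
  have ne: "a \<noteq> b" "a \<noteq> c" "a \<noteq> d" "b \<noteq> c" "b \<noteq> d"
      "c \<noteq> d" using cyc4_distinct[OF c] by auto
  have mon: "edge a b + edge c d \<in> monomials (edges n)" "edge a c + edge b d \<in> monomials (edges n)"
    by (intro monomials_add edge_monomials i ne)+
  have keys: "keys (edge a b + edge c d) = {{a, b}, {c, d}}" 
    by (auto simp: in_keys_iff lookup_add lookup_single when_def split: if_splits)
  have keys': "keys (edge a c + edge b d) \<subseteq> {{a, c}, {b, d}}" 
    by (auto simp: in_keys_iff lookup_add lookup_single when_def split: if_splits)
  have pos: "1 \<le> cdist n x y" if "x \<in> {1..n}" "y \<in> {1..n}" "x \<noteq> y" for x y
    using that unfolding cdist_def by auto
  have less: "\<exists>v\<in>keys (edge a b + edge c d). \<exists>e\<in>{1..<k}. v \<in> edge_class n e"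
    if w: "w \<in> keys (edge a c + edge b d)" and k: "k \<in> {1..n div 2}" "w \<in> edge_class n k" for w k
  proof -
    have ab: "{a, b} \<in> edge_class n (cdist n a b)" "{c, d} \<in> edge_class n (cdist n c d)"
      using edge_class_iff i ne by simp_all
    have p: "1 \<le> cdist n a b" "1 \<le> cdist n c d" using pos i ne by auto
    from w keys' consider "w = {a, c}" | "w = {b, d}" by blast
    then have "cdist n a b < k \<or> cdist n c d < k"
    proof cases
      case 1
      then have "k = cdist n a c" using k(2) edge_class_iff[OF i(1,3) ne(2)] by simp
      then show ?thesis using cdist_cyc4(1)[OF c in_n] by simp
    next
      case 2
      then have "k = cdist n b d" using k(2) edge_class_iff[OF i(2,4) ne(5)] by simp
      then show ?thesis using cdist_cyc4(2)[OF c in_n] by simp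
    qed
    then show ?thesis unfolding keys using ab p by auto
  qed
  have nz: "edge a b + edge c d \<noteq> 0" using keys by (metis insert_not_empty keys_zero)
  show "(edge a c + edge b d, edge a b + edge c d) \<in> r \<and>
      edge a c + edge b d \<noteq> edge a b + edge c d"
    using block_order_greater[of "edge a b + edge c d" "edge a c + edge b d"] mon nz edge_class_disjoint less
    unfolding tt(2) edge_class_Union[OF n] by blast
qed

sublocale toric "edges n" r edge_deg
  by unfold_locales (rule term_order)

lemma toric_ideal_hypersimplex: "(toric_ideal :: (nat set, 'a::field_char_0) mpoly set) = hypersimplex_ideal n"
  unfolding toric_ideal_def hypersimplex_ideal_def a_kernel_def kernel_def hypersimplex_map_eq by simp

lemma cyc4_of_disjoint_arcs: "disjoint_arcs p q u v \<Longrightarrow> p \<noteq> q \<Longrightarrow>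
    u \<noteq> v \<Longrightarrow> cyc4 p q u v"
  unfolding disjoint_arcs_def arc_def cyc4_def cyc_def using [[smt_nat_as_int]] by (smt (z3))

text \<open>Otherwise uncrossed disjoint chords could be replaced by the smaller crossing pair on the
  same points.\<close>

lemma standard_thrackle:
  assumes "standard m" shows "thrackle m"
  unfolding thrackle_def
proof (intro ballI notI)
  fix E F assume EF: "E \<in> keys m" "F \<in> keys m" "apart E F"
  then obtain p q u v where c: "E = {p, q}" "F = {u, v}" "p \<noteq> q" "u \<noteq> v"
      "disjoint_arcs p q u v" unfolding apart_def by blast
  have cy: "cyc4 p q u v" using cyc4_of_disjoint_arcs c by blast
  have ne: "p \<noteq> q" "p \<noteq> u" "p \<noteq> v" "q \<noteq> u" "q \<noteq> v"
      "u \<noteq> v" using cyc4_distinct[OF cy] by auto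
  have mV: "m \<in> monomials (edges n)" using assms by (rule standard_monomials)
  then have "E \<in> edges n" "F \<in> edges n" using EF by (auto simp: monomials_def)
  then have in_n: "{p, q, u, v} \<subseteq> {1..n}" using edges_subset unfolding c by blast
  define w where "w = m - (edge p q + edge u v)"
  have "E \<noteq> F" using ne unfolding c by (auto simp: doubleton_eq_iff)
  have m: "m = (edge p q + edge u v) + w"
  proof (rule poly_mapping_eqI)
    fix x
    have "lookup (edge p q + edge u v) x \<le> lookup m x"
      using EF(1,2) \<open>E \<noteq> F\<close>
          unfolding c by (auto simp: lookup_add lookup_single when_def in_keys_iff)
    then show "lookup m x = lookup ((edge p q + edge u v) + w) x"
      by (simp add: w_def lookup_add[of _ "m - _"] lookup_minus)
  qed
  have wV: "w \<in> monomials (edges n)" using mV monomials_add_iff unfolding m by blast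
  let ?m' = "(edge p u + edge q v) + w"
  have m'V: "?m' \<in> monomials (edges n)" by (intro monomials_add edge_monomials wV) (use in_n ne in auto)
  have "push edge_deg ?m' = push edge_deg m"
    unfolding m push_add push_edge[OF ne(1)] push_edge[OF ne(2)] push_edge[OF ne(5)] push_edge[OF ne(6)] by
        (simp add: ac_simps)
  then have 1: "(m, ?m') \<in> r" using assms m'V unfolding standard_def by blast
  have 2: "(?m', m) \<in> r" using order_add[OF wV] crossing_less[OF cy in_n] unfolding m by blast
  have "?m' = m" using order_antisym[OF 2 1] .
  then show False using crossing_less[OF cy in_n] unfolding m by (metis add_right_cancel)
qed

text \<open>The smallest monomial with the same degrees is a thrackle as well, and a thrackle is
  determined by its degrees.\<close>

lemma thrackle_standard:
  assumes m: "m \<in> monomials (edges n)" "thrackle m" shows "standard m"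
proof -
  let ?S = "{m' \<in> monomials (edges n). push edge_deg m' = push edge_deg m}"
  obtain m0 where m0: "m0 \<in> ?S" "\<forall>m'\<in>?S. (m0, m') \<in> r"
    using finite_min[OF finite_fibre[where d = "push edge_deg m"]] m by blast
  then have s: "standard m0" unfolding standard_def by simp
  have "m0 = m" using thrackle_unique[OF _ standard_thrackle[OF s] m] m0(1) by blast
  with s show ?thesis by simp
qed

lemma bipartite_standard_sum:
  assumes m: "m \<in> monomials (edges n)"
    and C: "\<forall>E\<in>keys m. \<forall>F\<in>keys m. apart E F \<longrightarrow> (E \<in> C) \<noteq>
        (F \<in> C)"
  shows "standard_sum m"
proof -
  let ?m1 = "restrict_monomial C m" and ?m2 = "restrict_monomial (- C) m"
  have k: "keys ?m1 = keys m \<inter> C" "keys ?m2 = keys m - C"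
    by (auto simp: in_keys_iff lookup_restrict split: if_splits)
  have "m = ?m1 + ?m2" by (rule poly_mapping_eqI) (simp add: lookup_add lookup_restrict)
  moreover have "standard ?m1" by (rule thrackle_standard) (use m C in \<open>auto simp: monomials_def
      thrackle_def k\<close>)
  moreover have "standard ?m2" by (rule thrackle_standard) (use m C in \<open>auto simp: monomials_def
      thrackle_def k\<close>)
  ultimately show ?thesis unfolding standard_sum_def by blast
qed

end

section \<open>Cyclic indices\<close>

text \<open>The chord \<open>l\<close> of an admissible pair joins \<open>i l\<close> to \<open>j (opp k l)\<close>. It is convenient to group
  the labels by gaps: gap \<open>l\<close> consists of \<open>i l\<close> and \<open>j (prev k l)\<close>. Then chord \<open>l\<close> joins gap
  \<open>l\<close> to gap \<open>fwd k l\<close>, and as \<open>k\<close> is coprime to \<open>2 k + 1\<close> the chords form one cycle through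
  all gaps.\<close>

definition fwd :: "nat \<Rightarrow> nat \<Rightarrow> nat" where "fwd k l = (l + k) mod (2 * k + 1)"
definition prev :: "nat \<Rightarrow> nat \<Rightarrow> nat" where "prev k l = (l + 2 * k) mod (2 * k + 1)"
definition opp :: "nat \<Rightarrow> nat \<Rightarrow> nat" where "opp k l = (l + k - 1) mod (2 * k + 1)"

lemma fwd_less [simp]: "fwd k l < 2 * k + 1" and prev_less [simp]: "prev k l < 2 * k
    + 1" and opp_less [simp]: "opp k l < 2 * k + 1"
  by (simp_all add: fwd_def prev_def opp_def)

lemma index_less_Suc [simp]: "fwd k l < Suc (2 * k)" "prev k l < Suc (2 * k)" "opp k l < Suc (2 * k)"
  using fwd_less[of k l] prev_less[of k l] opp_less[of k l] by simp_all

lemma mod_add_if: "l < 2 * k + 1 \<Longrightarrow> x \<le> 2 * k + 1 \<Longrightarrow>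
    (l + x) mod (2 * k + 1) = (if l + x < 2 * k + 1 then l + x else l + x - (2 * k + 1))" for l k x :: nat
  by (simp add: mod_if)

lemma fwd_if: "l < 2 * k + 1 \<Longrightarrow> fwd k l = (if l \<le> k then l + k else l - k - 1)"
  unfolding fwd_def by (subst mod_add_if) auto

lemma prev_if: "l < 2 * k + 1 \<Longrightarrow> prev k l = (if l = 0 then 2 * k else l - 1)"
  unfolding prev_def by (subst mod_add_if) auto

lemma opp_prev: "1 \<le> k \<Longrightarrow> l < 2 * k + 1 \<Longrightarrow> opp k l = prev k (fwd k l)"
proof -
  assume k: "1 \<le> k" "l < 2 * k + 1"
  have "opp k l = (l + (k - 1)) mod (2 * k + 1)" using k by (simp add: opp_def)
  also have "\<dots> = (if l + (k - 1) < 2 * k + 1 then l + (k - 1) else l + (k - 1) - (2 * k + 1))"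
      by (rule mod_add_if) (use k in auto)
  finally show ?thesis using k by (auto simp: fwd_if prev_if)
qed

lemma fwd_inj: "inj_on (fwd k) {..<2 * k + 1}"
  by (rule inj_onI) (auto simp: fwd_if split: if_splits)

lemma fwd_bij: "bij_betw (fwd k) {..<2 * k + 1} {..<2 * k + 1}"
proof -
  have "fwd k ` {..<2 * k + 1} = {..<2 * k + 1}"
    by (rule endo_inj_surj[OF finite_lessThan _ fwd_inj]) (intro image_subsetI, simp only: lessThan_iff
        fwd_less)
  then show ?thesis using fwd_inj by (simp add: bij_betw_def)
qed

lemma prev_inj: "inj_on (prev k) {..<2 * k + 1}"
  by (rule inj_onI) (auto simp: prev_if split: if_splits)

section \<open>The swap group\<close>

definition gap_swap :: "nat \<Rightarrow> nat \<Rightarrow> label \<Rightarrow> label" where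
  "gap_swap k l = transpose (Li l) (Lj (prev k l))"

text \<open>The product of the transpositions of the gaps in \<open>S\<close>.\<close>

fun swap_set :: "nat \<Rightarrow> nat set \<Rightarrow> label \<Rightarrow> label" where
  "swap_set k S (Li l) = (if l \<in> S then Lj (prev k l) else Li l)"
| "swap_set k S (Lj l) = (if l < 2 * k + 1 \<and>
    (l + 1) mod (2 * k + 1) \<in> S then Li ((l + 1) mod (2 * k + 1)) else Lj l)"

lemma next_prev: "l < 2 * k + 1 \<Longrightarrow> (prev k l + 1) mod (2 * k + 1) = l"
  by (auto simp: prev_if)

lemma prev_next: "l < 2 * k + 1 \<Longrightarrow> prev k ((l + 1) mod (2 * k + 1)) = l"
proof -
  assume l: "l < 2 * k + 1"
  have "(l + 1) mod (2 * k + 1) = (if l = 2 * k then 0 else l + 1)" using l by auto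
  then show ?thesis using l by (auto simp: prev_if)
qed

lemma Lj_prev_eq: "l < 2 * k + 1 \<Longrightarrow> m < 2 * k + 1 \<Longrightarrow>
    m = prev k l \<longleftrightarrow> (m + 1) mod (2 * k + 1) = l"
  using next_prev prev_next by metis

lemma swap_set_empty: "swap_set k {} = id"
proof
  fix x show "swap_set k {} x = id x" by (cases x) auto
qed

lemma swap_set_insert:
  assumes "S \<subseteq> {..<2 * k + 1}" "l < 2 * k + 1" "l \<notin> S"
  shows "swap_set k (insert l S) = gap_swap k l \<circ> swap_set k S"
proof
  fix x
  show "swap_set k (insert l S) x = (gap_swap k l \<circ> swap_set k S) x"
  proof (cases x)
    case (Li m)
    show ?thesis
    proof (cases "m \<in> S")
      case True
      then have m: "m < 2 * k + 1" "m \<noteq> l" using assms by auto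
      then have "prev k m \<noteq> prev k l" using prev_inj assms(2) by (auto simp: inj_on_def)
      then show ?thesis using True m by (simp add: Li gap_swap_def transpose_def)
    next
      case False
      then show ?thesis by (auto simp: Li gap_swap_def transpose_def)
    qed
  next
    case (Lj m)
    let ?m = "(m + 1) mod (2 * k + 1)"
    show ?thesis
    proof (cases "m < 2 * k + 1")
      case True
      then have "m = prev k l \<longleftrightarrow> ?m = l" using Lj_prev_eq assms(2) by blast
      then show ?thesis using True assms(3) by (auto simp: Lj gap_swap_def transpose_def)
    next
      case False
      then have "m \<noteq> prev k l" using prev_less[of k l] by auto
      then show ?thesis using False by (auto simp: Lj gap_swap_def transpose_def)
    qed
  qed
qed

lemma swap_set_in: "S \<subseteq> {..<2 * k + 1} \<Longrightarrow> x \<in> labels k \<Longrightarrow>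
    swap_set k S x \<in> labels k"
proof (cases x)
  case (Li l)
  assume "S \<subseteq> {..<2 * k + 1}" "x \<in> labels k"
  then show ?thesis using prev_less[of k l] by (auto simp: Li labels_def)
next
  case (Lj l)
  assume "S \<subseteq> {..<2 * k + 1}" "x \<in> labels k"
  then show ?thesis by (auto simp: Lj labels_def)
qed

lemma gap_swap_labels: "l < 2 * k + 1 \<Longrightarrow> gap_swap k l permutes labels k"
  unfolding gap_swap_def using prev_less[of k l] by (intro permutes_swap_id) (auto simp: labels_def)

lemma gap_swap_gens: "{transpose (Li l) (Lj ((l + 2 * k) mod (2 * k + 1))) | l. l < 2 * k + 1}
    = gap_swap k ` {..<2 * k + 1}"
  by (auto simp: gap_swap_def prev_def)

lemma swap_set_involution: 
  assumes "S \<subseteq> {..<2 * k + 1}" shows "swap_set k S (swap_set k S x) = x"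
proof (cases x)
  case (Li l)
  then show ?thesis using assms next_prev[of l k] prev_less[of k l] by (cases "l \<in> S") auto
next
  case (Lj l)
  then show ?thesis using prev_next[of l k] by auto
qed

lemma swap_set_gap_swap:
  assumes "S \<subseteq> {..<2 * k + 1}" "l < 2 * k + 1"
  shows "\<exists>T \<subseteq> {..<2 * k + 1}. gap_swap k l \<circ> swap_set k S = swap_set k T"
proof (cases "l \<in> S")
  case False
  then show ?thesis using swap_set_insert[of S k l] assms by (intro exI[of _ "insert l S"]) auto
next
  case True
  then have S: "S = insert l (S - {l})" by auto
  have "swap_set k S = gap_swap k l \<circ> swap_set k (S - {l})"
    using swap_set_insert[of "S - {l}" k l] assms S by auto
  then have "gap_swap k l \<circ> swap_set k S = swap_set k (S - {l})"
    by (simp add: gap_swap_def fun_eq_iff)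
  then show ?thesis using assms by (intro exI[of _ "S - {l}"]) auto
qed

lemma sym_group_simps:
  "x \<otimes>\<^bsub>label_sym_group k\<^esub> y = x \<circ> y" "\<one>\<^bsub>label_sym_group k\<^esub> = id"
  by (simp_all add: label_sym_group_def)

text \<open>The gap transpositions are disjoint involutions, so the elements of the group they generate
  correspond to sets of gaps.\<close>

lemma swap_group_eq: "swap_group k = swap_set k ` Pow {..<2 * k + 1}"
proof -
  let ?G = "label_sym_group k"
  have G: "Group.group ?G"
  proof (rule groupI)
    show "x \<otimes>\<^bsub>?G\<^esub> y \<in> carrier ?G" if "x \<in> carrier ?G" "y \<in> carrier ?G" for x y
      using that by (simp add: label_sym_group_def permutes_compose)
    show "\<one>\<^bsub>?G\<^esub> \<in> carrier ?G" by (simp add: label_sym_group_def permutes_id)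
    show "\<exists>y\<in>carrier ?G. y \<otimes>\<^bsub>?G\<^esub> x = \<one>\<^bsub>?G\<^esub>"
        if "x \<in> carrier ?G" for x
      using that permutes_inv permutes_inv_o by (fastforce simp: label_sym_group_def)
  qed (auto simp: label_sym_group_def comp_assoc)
  interpret Group.group ?G by (rule G)
  have gc: "gap_swap k ` {..<2 * k + 1} \<subseteq> carrier ?G"
      by (auto simp: label_sym_group_def gap_swap_labels)
  have inverse: "inv\<^bsub>?G\<^esub> (gap_swap k l) = gap_swap k l" if "l < 2 * k + 1" for l
    by (rule inv_equality) (use that gc in \<open>auto simp: label_sym_group_def gap_swap_def\<close>)
  have "swap_set k S \<in> swap_group k" if "S \<subseteq> {..<2 * k + 1}" for S
  proof -
    have "finite S" using that finite_subset by blast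
    then show ?thesis using that
    proof (induction S rule: finite_induct)
      case empty
      have "\<one>\<^bsub>?G\<^esub> \<in> swap_group k" unfolding swap_group_def by (rule generate.one)
      then show ?case unfolding sym_group_simps swap_set_empty .
    next
      case (insert l S)
      then have "gap_swap k l \<in> swap_group k" "swap_set k S \<in> swap_group k"
        unfolding swap_group_def gap_swap_gens by (auto intro: generate.incl)
      then have "gap_swap k l \<otimes>\<^bsub>?G\<^esub> swap_set k S \<in> swap_group k"
          unfolding swap_group_def by (rule generate.eng)
      moreover have "swap_set k (insert l S) = gap_swap k l \<circ> swap_set k S"
        by (rule swap_set_insert) (use insert in auto)
      ultimately show ?case unfolding sym_group_simps by (simp only:)
    qed
  qed
  moreover have "x \<in> swap_set k ` Pow {..<2 * k + 1}" if x: "x \<in> swap_group k" for x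
  proof -
    have "\<forall>S\<subseteq>{..<2 * k + 1}. x \<circ> swap_set k S \<in> swap_set k ` Pow {..<2 * k + 1}"
      using x unfolding swap_group_def gap_swap_gens
    proof (induction rule: generate.induct)
      case one
      then show ?case by (auto simp: label_sym_group_def)
    next
      case (incl h)
      then show ?case using swap_set_gap_swap by blast
    next
      case (inv h)
      then obtain l where l: "l < 2 * k + 1" "h = gap_swap k l" by blast
      have "inv\<^bsub>?G\<^esub> h = gap_swap k l" unfolding l(2) by (rule inverse[OF l(1)])
      then show ?case using swap_set_gap_swap[OF _ l(1)] by (simp only:) blast
    next
      case (eng h1 h2)
      show ?case
      proof (intro allI impI)
        fix S assume "S \<subseteq> {..<2 * k + 1}"
        then obtain T where T: "T \<subseteq> {..<2 * k + 1}"
            "h2 \<circ> swap_set k S = swap_set k T" using eng.IH(2) by blast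
        have "h1 \<otimes>\<^bsub>?G\<^esub> h2 \<circ> swap_set k S = h1 \<circ> swap_set k T"
          unfolding sym_group_simps comp_assoc T(2) ..
        then show "h1 \<otimes>\<^bsub>?G\<^esub> h2 \<circ> swap_set k S \<in> swap_set k ` Pow {..<2 * k
            + 1}" using eng.IH(1) T(1) by (simp only:)
      qed
    qed
    then have "x \<circ> swap_set k {} \<in> swap_set k ` Pow {..<2 * k + 1}" by blast
    then show ?thesis by (simp add: swap_set_empty)
  qed
  ultimately show ?thesis by blast
qed

lemma swap_set_inj: "inj_on (swap_set k) (Pow {..<2 * k + 1})"
proof (rule inj_onI)
  fix S T assume "S \<in> Pow {..<2 * k + 1}" "T \<in> Pow {..<2 * k + 1}" and e: "swap_set k S = swap_set k T"
  have "l \<in> S \<longleftrightarrow> l \<in> T" for l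
      using fun_cong[OF e, of "Li l"] by (auto split: if_splits)
  then show "S = T" by blast
qed

lemma swap_set_permutation: "S \<subseteq> {..<2 * k + 1} \<Longrightarrow>
    permutation (swap_set k S) \<and> sign (swap_set k S) = (-1) ^ card S"
proof (induction S rule: infinite_finite_induct)
  case (infinite A)
  then show ?case using finite_subset by blast
next
  case empty
  then show ?case by (simp add: swap_set_empty)
next
  case (insert l S)
  then have s: "swap_set k (insert l S) = gap_swap k l \<circ> swap_set k S" by (intro swap_set_insert) auto
  have p: "permutation (gap_swap k l)" "sign (gap_swap k l) = - 1"
    unfolding gap_swap_def by (simp_all add: permutation_swap_id sign_swap_id)
  have IH: "permutation (swap_set k S)" "sign (swap_set k S) = (-1) ^ card S" using insert by auto
  show ?case unfolding s sign_compose[OF p(1) IH(1)] p(2) IH(2) card_insert_disjoint[OF insert(1,2)]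
    using permutation_compose[OF p(1) IH(1)] by (simp only: power_Suc)
qed

lemma opp_inj: "1 \<le> k \<Longrightarrow> inj_on (opp k) {..<2 * k + 1}"
proof -
  assume k: "1 \<le> k"
  have "inj_on (prev k \<circ> fwd k) {..<2 * k + 1}"
    by (rule comp_inj_on[OF fwd_inj]) (simp only: bij_betw_imp_surj_on[OF fwd_bij] prev_inj)
  then show ?thesis by (auto simp: inj_on_def opp_prev[OF k])
qed

lemma foldr_transpose:
  assumes "distinct ls" "inj_on f (set ls)" 
  shows "l \<in> set ls \<Longrightarrow> foldr (\<circ>) (map (\<lambda>l. transpose (Li l) (Lj (f l)))
      ls) id (Li l) = Lj (f l)"
    "l \<in> set ls \<Longrightarrow> foldr (\<circ>) (map (\<lambda>l. transpose (Li l) (Lj (f l))) ls) id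
        (Lj (f l)) = Li l"
    "l \<notin> set ls \<Longrightarrow> foldr (\<circ>) (map (\<lambda>l. transpose (Li l) (Lj (f l))) ls)
        id (Li l) = Li l"
    "l \<notin> f ` set ls \<Longrightarrow> foldr (\<circ>) (map (\<lambda>l. transpose (Li l) (Lj (f l)))
        ls) id (Lj l) = Lj l"
  using assms
proof (induction ls arbitrary: l)
  case (Cons a ls)
  {
    case 1
    show ?case
    proof (cases "l = a")
      case True
      then show ?thesis using 1 Cons.IH(3)[of l] by (auto simp: transpose_def)
    next
      case False
      then have "f l \<noteq> f a" using 1 by (auto simp: inj_on_def)
      then show ?thesis using 1 False Cons.IH(1)[of l] by (auto simp: transpose_def)
    qed
  next
    case 2
    then show ?case using Cons.IH(2)[of l] Cons.IH(4)[of "f l"] by (cases "l = a") (auto simp: transpose_def)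
  next
    case 3
    then show ?case using Cons.IH(3)[of l] by (auto simp: transpose_def)
  next
    case 4
    then show ?case using Cons.IH(4)[of l] by (auto simp: transpose_def)
  }
qed auto

lemma base_involution:
  assumes "1 \<le> k" "l < 2 * k + 1"
  shows "base_involution k (Li l) = Lj (opp k l)" "base_involution k (Lj (opp k l)) = Li l"
  using foldr_transpose(1,2)[of "[0..<2 * k + 1]" "opp k" l] opp_inj[OF assms(1)] assms(2)
  by (simp_all add: base_involution_def opp_def atLeast0LessThan del: upt_Suc)

lemma labels_cases:
  assumes "1 \<le> k" "x \<in> labels k"
  obtains l where "l < 2 * k + 1" "x = Li l" | l where "l < 2 * k + 1" "x = Lj (opp k l)"
proof -
  have "opp k ` {..<2 * k + 1} = {..<2 * k + 1}"
    by (rule endo_inj_surj[OF finite_lessThan _ opp_inj[OF assms(1)]]) (intro image_subsetI, simp only: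
        lessThan_iff opp_less)
  then show ?thesis using assms(2) that unfolding labels_def by blast
qed

lemma two_cycles_eq:
  assumes k: "1 \<le> k" and S: "S \<subseteq> {..<2 * k + 1}"
  shows "two_cycles k (swap_set k S \<circ> base_involution k \<circ> inv_into UNIV (swap_set k S)) =
    (\<lambda>l. {swap_set k S (Li l), swap_set k S (Lj (opp k l))}) ` {..<2 * k + 1}"
proof -
  let ?s = "swap_set k S"
  have inv: "inv_into UNIV ?s = ?s" by (rule inv_equality) (auto simp: swap_set_involution[OF S])
  let ?t = "?s \<circ> base_involution k \<circ> inv_into UNIV ?s"
  have inj: "?s x = ?s y \<Longrightarrow> x = y" for x y using swap_set_involution[OF S] by metis
  have t: "?t (?s x) = ?s (base_involution k x)" for x by (simp add: inv swap_set_involution[OF S])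
  show ?thesis
  proof (intro equalityI subsetI)
    fix E assume "E \<in> two_cycles k ?t"
    then obtain a where a: "E = {a, ?t a}" "a \<in> labels k" unfolding two_cycles_def by blast
    have b: "?s a \<in> labels k" using swap_set_in[OF S a(2)] .
    have e: "E = {?s (?s a), ?s (base_involution k (?s a))}"
        using a(1) t[of "?s a"] by (simp add: swap_set_involution[OF S])
    from k b show "E \<in> (\<lambda>l. {?s (Li l), ?s (Lj (opp k l))}) ` {..<2 * k + 1}"
    proof (cases rule: labels_cases)
      case (1 l)
      then show ?thesis using e base_involution(1)[OF k] by auto
    next
      case (2 l)
      then show ?thesis using e base_involution(2)[OF k] by auto
    qed
  next
    fix E assume "E \<in> (\<lambda>l. {?s (Li l), ?s (Lj (opp k l))}) ` {..<2 * k + 1}"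
    then obtain l where l: "l < 2 * k + 1" "E = {?s (Li l), ?s (Lj (opp k l))}" by blast
    have "?t (?s (Li l)) = ?s (Lj (opp k l))" unfolding t base_involution(1)[OF k l(1)] ..
    moreover have "?s (Lj (opp k l)) \<noteq> ?s (Li l)" using inj by blast
    moreover have "?s (Li l) \<in> labels k"
        by (rule swap_set_in[OF S]) (use l in \<open>simp add: labels_def\<close>)
    ultimately show "E \<in> two_cycles k ?t"
        unfolding two_cycles_def l(2) by (intro CollectI exI[of _ "?s (Li l)"]) auto
  qed
qed

lemma two_cycles_inj:
  assumes k: "1 \<le> k" and S: "S \<subseteq> {..<2 * k + 1}"
  shows "inj_on (\<lambda>l. {swap_set k S (Li l), swap_set k S (Lj (opp k l))}) {..<2 * k + 1}"
proof (rule inj_onI)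
  fix l l'
  have inj: "swap_set k S x = swap_set k S y \<longleftrightarrow> x = y" for x y
      using swap_set_involution[OF S] by metis
  assume "{swap_set k S (Li l), swap_set k S (Lj (opp k l))}
      = {swap_set k S (Li l'), swap_set k S (Lj (opp k l'))}"
  then show "l = l'" unfolding doubleton_eq_iff inj by auto
qed

section \<open>Expansion of master polynomials\<close>

text \<open>The end in gap \<open>l\<close> of the chord that starts there, after the labels of the gaps in \<open>S\<close> have
  been exchanged. The other label of the gap is \<open>snd_end\<close>, the end of the chord that arrives.\<close>

definition fst_end :: "nat \<Rightarrow> (nat \<Rightarrow> nat) \<Rightarrow> (nat \<Rightarrow> nat)
    \<Rightarrow> nat set \<Rightarrow> nat \<Rightarrow> nat" where
  "fst_end k i j S l = (if l \<in> S then j (prev k l) else i l)"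

definition snd_end :: "nat \<Rightarrow> (nat \<Rightarrow> nat) \<Rightarrow> (nat \<Rightarrow> nat)
    \<Rightarrow> nat set \<Rightarrow> nat \<Rightarrow> nat" where
  "snd_end k i j S l = (if l \<in> S then i l else j (prev k l))"

text \<open>Conjugation by a product of gap transpositions relabels the two-cycles of the base
  involution, whose cycles are the chords between the gaps \<open>l\<close> and \<open>fwd k l\<close>.\<close>

lemma master_poly_eq:
  assumes k: "1 \<le> k"
  shows "(master_poly k i j :: (nat set, 'a::comm_ring_1) mpoly)
      = (\<Sum>S\<in>Pow {..<2 * k + 1}. (-1) ^ card S * (\<Prod>l<2 * k
      + 1. Var {fst_end k i j S l, snd_end k i j S (fwd k l)}))"
proof -
  let ?L = "2 * k + 1"
  have v: "label_value i j ` {swap_set k S (Li l), swap_set k S (Lj (opp k l))}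
      = {fst_end k i j S l, snd_end k i j S (fwd k l)}"
    if l: "l < ?L" for S l
  proof -
    have "(opp k l + 1) mod ?L = fwd k l" using next_prev[of "fwd k l" k] opp_prev[OF k l] by simp
    then show ?thesis by (simp add: label_value_def fst_end_def snd_end_def opp_prev[OF k l])
  qed
  have "formal_master_poly k = (\<Sum>S\<in>Pow {..<?L}. of_int (sign (swap_set k S)) *
      (\<Prod>E\<in>two_cycles k (swap_set k S \<circ> base_involution k \<circ> inv_into UNIV (swap_set k
          S)). Var E))"
    unfolding formal_master_poly_def swap_group_eq by (simp only: sum.reindex[OF swap_set_inj] o_def)
  also have "\<dots> = (\<Sum>S\<in>Pow {..<?L}. (-1) ^ card S * (\<Prod>l<?L. Var {swap_set k S (Li l),
      swap_set k S (Lj (opp k l))}))"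
  proof (rule sum.cong[OF refl])
    fix S assume "S \<in> Pow {..<?L}"
    then have S: "S \<subseteq> {..<?L}" by simp
    show "of_int (sign (swap_set k S)) * (\<Prod>E\<in>two_cycles k (swap_set k S \<circ> base_involution k
        \<circ> inv_into UNIV (swap_set k S)). Var E)
       = (-1) ^ card S * (\<Prod>l<?L. Var {swap_set k S (Li l), swap_set k S (Lj (opp k l))})"
      unfolding two_cycles_eq[OF k S] prod.reindex[OF two_cycles_inj[OF k S]]
          using swap_set_permutation[OF S] by simp
  qed
  finally have formal: "formal_master_poly k
      = (\<Sum>S\<in>Pow {..<?L}. (-1) ^ card S * (\<Prod>l<?L. Var {swap_set k S (Li l), swap_set k S (Lj
      (opp k l))}))" .
  show ?thesis
    unfolding master_poly_def formal substitute_sum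
  proof (rule sum.cong[OF refl])
    fix S
    have "(\<Prod>l<?L. Var (label_value i j ` {swap_set k S (Li l), swap_set k S (Lj (opp k l))}))
        = (\<Prod>l<?L. Var {fst_end k i j S l, snd_end k i j S (fwd k l)} :: (nat set, 'a) mpoly)"
      by (rule prod.cong[OF refl]) (simp only: v lessThan_iff)
    then show "substitute (\<lambda>E. Var (label_value i j ` E) :: (nat set, 'a) mpoly) ((-1) ^ card S *
        (\<Prod>l<?L. Var {swap_set k S (Li l), swap_set k S (Lj (opp k l))}))
        = (-1) ^ card S * (\<Prod>l<?L. Var {fst_end k i j S l, snd_end k i j S (fwd k l)})"
      by (simp only: substitute_mult substitute_power substitute_uminus substitute_1 substitute_prod
          substitute_Var)
  qed
qed

lemma base_ends: "l < 2 * k + 1 \<Longrightarrow> 1 \<le> k \<Longrightarrow>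
    {fst_end k i j {} l, snd_end k i j {} (fwd k l)} = {i l, j ((l + k - 1) mod (2 * k + 1))}"
  using opp_prev[of k l] by (simp add: fst_end_def snd_end_def opp_def)

lemma fwd_iterate: "(fwd k ^^ t) 0 = (t * k) mod (2 * k + 1)"
  by (induction t) (simp_all add: fwd_def mod_add_right_eq mod_add_left_eq add.commute)

text \<open>The chords form a cycle of odd length.\<close>

lemma no_alternating: "\<exists>l<2 * k + 1. (fwd k l \<in> Q) = (l \<in> Q)"
proof (rule ccontr)
  assume n: "\<not> ?thesis"
  have "((fwd k ^^ t) 0 \<in> Q) = (even t = (0 \<in> Q))" for t
  proof (induction t)
    case (Suc t)
    have "(fwd k ^^ t) 0 < 2 * k + 1" unfolding fwd_iterate by simp
    then have "(fwd k ((fwd k ^^ t) 0) \<in> Q) \<noteq> ((fwd k ^^ t) 0 \<in> Q)" using n by blast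
    then show ?case using Suc by auto
  qed simp
  from this[of "2 * k + 1"] show False unfolding fwd_iterate mod_mult_self1_is_0 by simp
qed

text \<open>Expand each factor and let \<open>Q\<close> be the set of chords for which the first summand is taken.
  For fixed \<open>Q\<close> the alternating sum over \<open>S\<close> is a product over the gaps \<open>l\<close> of \<open>2 \<times> 2\<close>
  determinants in the labels of the gap. If the chords that meet in a gap are both in \<open>Q\<close> or
  both outside, the two rows coincide, and such a gap exists by \<open>no_alternating\<close>.\<close>

lemma alternating_sum_zero:
  fixes y z :: "nat \<Rightarrow> 'a::comm_ring_1"
  shows "(\<Sum>S\<in>Pow {..<2 * k + 1}. (-1) ^ card S * (\<Prod>l<2 * k + 1. 
     y (fst_end k i j S l) * y (snd_end k i j S (fwd k l))
         + z (fst_end k i j S l) * z (snd_end k i j S (fwd k l)))) = 0"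
proof -
  let ?L = "{..<2 * k + 1}"
  define w where "w Q l = (if l \<in> Q then y else z)" for Q and l :: nat
  define g where "g l = inv_into ?L (fwd k) l" for l
  have gf: "g (fwd k l) = l" if "l \<in> ?L" for l unfolding g_def using fwd_inj that by (rule inv_into_f_f)
  have term_eq: "(\<Prod>l\<in>?L. y (fst_end k i j S l) * y (snd_end k i j S (fwd k l))
      + z (fst_end k i j S l) * z (snd_end k i j S (fwd k l)))
    = (\<Sum>Q\<in>Pow ?L. \<Prod>l\<in>?L. w Q l (fst_end k i j S l) * w Q (g l) (snd_end k i j S l))" for S
  proof -
    have "(\<Prod>l\<in>?L. y (fst_end k i j S l) * y (snd_end k i j S (fwd k l))
        + z (fst_end k i j S l) * z (snd_end k i j S (fwd k l)))
      = (\<Sum>Q\<in>Pow ?L. (\<Prod>l\<in>Q. y (fst_end k i j S l) * y (snd_end k i j S (fwd k l))) *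
          (\<Prod>l\<in>?L - Q. z (fst_end k i j S l) * z (snd_end k i j S (fwd k l))))"
      by (rule prod_add) simp
    also have "\<dots> = (\<Sum>Q\<in>Pow ?L. \<Prod>l\<in>?L. w Q l (fst_end k i j S l) * w Q l (snd_end k
        i j S (fwd k l)))"
    proof (rule sum.cong[OF refl])
      fix Q assume "Q \<in> Pow ?L"
      then have Q: "Q \<subseteq> ?L" by simp
      have "(\<Prod>l\<in>?L. w Q l (fst_end k i j S l) * w Q l (snd_end k i j S (fwd k l)))
         = (\<Prod>l\<in>?L - Q. w Q l (fst_end k i j S l) * w Q l (snd_end k i j S (fwd k l))) *
             (\<Prod>l\<in>Q. w Q l (fst_end k i j S l) * w Q l (snd_end k i j S (fwd k l)))"
        by (rule prod.subset_diff[OF Q]) simp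
      then show "(\<Prod>l\<in>Q. y (fst_end k i j S l) * y (snd_end k i j S (fwd k l))) * (\<Prod>l\<in>?L
          - Q. z (fst_end k i j S l) * z (snd_end k i j S (fwd k l)))
         = (\<Prod>l\<in>?L. w Q l (fst_end k i j S l) * w Q l (snd_end k i j S (fwd k l)))"
        by (simp add: w_def mult.commute)
    qed
    also have "\<dots> = (\<Sum>Q\<in>Pow ?L. \<Prod>l\<in>?L. w Q l (fst_end k i j S l) * w Q (g l)
        (snd_end k i j S l))"
    proof (rule sum.cong[OF refl])
      fix Q
      have "(\<Prod>l\<in>?L. w Q l (snd_end k i j S (fwd k l)))
          = (\<Prod>l\<in>?L. w Q (g (fwd k l)) (snd_end k i j S (fwd k l)))"
        by (rule prod.cong) (simp_all add: gf)
      also have "\<dots> = (\<Prod>l\<in>?L. w Q (g l) (snd_end k i j S l))"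
        by (rule prod.reindex_bij_betw[OF fwd_bij])
      finally show "(\<Prod>l\<in>?L. w Q l (fst_end k i j S l) * w Q l (snd_end k i j S (fwd k l)))
          = (\<Prod>l\<in>?L. w Q l (fst_end k i j S l) * w Q (g l) (snd_end k i j S l))"
        by (simp add: prod.distrib)
    qed
    finally show ?thesis .
  qed
  have "(\<Sum>S\<in>Pow ?L. (-1) ^ card S * (\<Prod>l\<in>?L. y (fst_end k i j S l) * y (snd_end k i j S
      (fwd k l)) + z (fst_end k i j S l) * z (snd_end k i j S (fwd k l))))
    = (\<Sum>Q\<in>Pow ?L. \<Sum>S\<in>Pow ?L. (-1) ^ card S * (\<Prod>l\<in>?L. w Q l (fst_end k i j S l)
        * w Q (g l) (snd_end k i j S l)))"
    unfolding term_eq sum_distrib_left by (rule sum.swap)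
  also have "\<dots> = (\<Sum>Q\<in>Pow ?L. \<Prod>l\<in>?L. - (w Q l (j (prev k l)) * w Q (g l) (i l))
      + w Q l (i l) * w Q (g l) (j (prev k l)))"
  proof (rule sum.cong[OF refl])
    fix Q
    have "(\<Prod>l\<in>?L. - (w Q l (j (prev k l)) * w Q (g l) (i l)) + w Q l (i l) * w Q (g l) (j (prev k l)))
      = (\<Sum>S\<in>Pow ?L. (\<Prod>l\<in>S. - (w Q l (j (prev k l)) * w Q (g l) (i l))) *
          (\<Prod>l\<in>?L - S. w Q l (i l) * w Q (g l) (j (prev k l))))"
      by (rule prod_add) simp
    also have "\<dots> = (\<Sum>S\<in>Pow ?L. (-1) ^ card S * (\<Prod>l\<in>?L. w Q l (fst_end k i j S l) *
        w Q (g l) (snd_end k i j S l)))"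
    proof (rule sum.cong[OF refl])
      fix S assume "S \<in> Pow ?L"
      then have S: "S \<subseteq> ?L" by simp
      have 1: "(\<Prod>l\<in>?L. w Q l (fst_end k i j S l) * w Q (g l) (snd_end k i j S l))
         = (\<Prod>l\<in>?L - S. w Q l (fst_end k i j S l) * w Q (g l) (snd_end k i j S l)) *
             (\<Prod>l\<in>S. w Q l (fst_end k i j S l) * w Q (g l) (snd_end k i j S l))"
        by (rule prod.subset_diff[OF S]) simp
      have 2: "(\<Prod>l\<in>?L - S. w Q l (fst_end k i j S l) * w Q (g l) (snd_end k i j S l))
          = (\<Prod>l\<in>?L - S. w Q l (i l) * w Q (g l) (j (prev k l)))"
        by (rule prod.cong) (simp_all add: fst_end_def snd_end_def)
      have 3: "(\<Prod>l\<in>S. w Q l (fst_end k i j S l) * w Q (g l) (snd_end k i j S l))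
          = (\<Prod>l\<in>S. w Q l (j (prev k l)) * w Q (g l) (i l))"
        by (rule prod.cong) (simp_all add: fst_end_def snd_end_def)
      have 4: "(\<Prod>l\<in>S. - (w Q l (j (prev k l)) * w Q (g l) (i l)))
          = (-1) ^ card S * (\<Prod>l\<in>S. w Q l (j (prev k l)) * w Q (g l) (i l))"
        by (rule prod_uminus)
      show "(\<Prod>l\<in>S. - (w Q l (j (prev k l)) * w Q (g l) (i l))) * (\<Prod>l\<in>?L - S. w Q l (i
          l) * w Q (g l) (j (prev k l)))
        = (-1) ^ card S * (\<Prod>l\<in>?L. w Q l (fst_end k i j S l) * w Q (g l) (snd_end k i j S l))"
        unfolding 1 2 3 4 by (simp only: ac_simps)
    qed
    finally show "(\<Sum>S\<in>Pow ?L. (-1) ^ card S * (\<Prod>l\<in>?L. w Q l (fst_end k i j S l) * w Q (g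
        l) (snd_end k i j S l)))
      = (\<Prod>l\<in>?L. - (w Q l (j (prev k l)) * w Q (g l) (i l))
          + w Q l (i l) * w Q (g l) (j (prev k l)))" by simp
  qed
  also have "\<dots> = 0"
  proof (rule sum.neutral, rule ballI)
    fix Q
    obtain l where l: "l < 2 * k + 1" "(fwd k l \<in> Q) = (l \<in> Q)" using no_alternating by blast
    have "w Q (fwd k l) = w Q (g (fwd k l))" using l gf[of l] by (simp add: w_def)
    then have "- (w Q (fwd k l) (j (prev k (fwd k l))) * w Q (g (fwd k l)) (i (fwd k l)))
        + w Q (fwd k l) (i (fwd k l)) * w Q (g (fwd k l)) (j (prev k (fwd k l))) = 0"
      by simp
    then show "(\<Prod>l\<in>?L. - (w Q l (j (prev k l)) * w Q (g l) (i l))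
        + w Q l (i l) * w Q (g l) (j (prev k l))) = 0"
      by (intro prod_zero) (auto intro!: bexI[of _ "fwd k l"])
  qed
  finally show ?thesis .
qed

section \<open>Gaps of an admissible pair\<close>

lemma admissible_unrolled:
  assumes "admissible n k i j"
  obtains a b :: "nat \<Rightarrow> int" where "\<And>l. l < 2 * k + 1 \<Longrightarrow>
      [int (i l) = a l] (mod int n) \<and> [int (j l) = b l] (mod int n)"
    "\<And>l. l < 2 * k + 1 \<Longrightarrow> a l \<le> b l" "\<And>l m. l < m \<Longrightarrow>
        m < 2 * k + 1 \<Longrightarrow> b l < a m" 
    "\<And>l. l < 2 * k + 1 \<Longrightarrow> b l < a 0 + int n"
proof -
  obtain a b :: "nat \<Rightarrow> int" where 1: "\<And>l. l < 2 * k + 1 \<Longrightarrow>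
      [int (i l) = a l] (mod int n) \<and> [int (j l) = b l] (mod int n)"
    and 2: "\<And>l. l < 2 * k + 1 \<Longrightarrow> a l \<le> b l" and 3: "\<And>l. l < 2 * k
        \<Longrightarrow> b l < a (l + 1)" and 4: "b (2 * k) < a 0 + int n"
    using assms unfolding admissible_def by blast
  have 5: "b l < a m" if "l < m" "m < 2 * k + 1" for l m
    using that
  proof (induction m)
    case (Suc m)
    show ?case
    proof (cases "l = m")
      case True
      then show ?thesis using 3[of m] Suc.prems by simp
    next
      case False
      then have "b l < a m" using Suc by simp
      also have "a m \<le> b m" using 2 Suc.prems by simp
      also have "b m < a (Suc m)" using 3[of m] Suc.prems by simp
      finally show ?thesis .
    qed
  qed simp
  have 6: "b l < a 0 + int n" if "l < 2 * k + 1" for l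
  proof (cases "l = 2 * k")
    case False
    then have "b l < a (2 * k)" using 5[of l "2 * k"] that by simp
    also have "\<dots> \<le> b (2 * k)" using 2 by simp
    finally show ?thesis using 4 by simp
  qed (use 4 in simp)
  show ?thesis using that[of a b] 1 2 5 6 by blast
qed

lemma cyc_of_cong:
  assumes "[int x = a] (mod int n)" "[int y = b] (mod int n)" "[int z = c] (mod int n)"
    "x \<in> {1..n}" "y \<in> {1..n}" "z \<in> {1..n}" 
    and "a < b \<and> b < c \<and> c < a + int n \<or> b < c \<and> c < a \<and>
        a < b + int n \<or> c < a \<and> a < b \<and> b < c + int n"
  shows "cyc x y z"
proof -
  obtain k1 where 1: "a = int x + int n * k1" using assms(1) by (metis cong_iff_lin)
  obtain k2 where 2: "b = int y + int n * k2" using assms(2) by (metis cong_iff_lin)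
  obtain k3 where 3: "c = int z + int n * k3" using assms(3) by (metis cong_iff_lin)
  have rot: "u < v \<and> v < w \<or> v < w \<and> w < u \<or> w < u \<and> u < v"
    if uvw: "int u + int n * p < int v + int n * q" "int v + int n * q < int w + int n * s"
        "int w + int n * s < int u + int n * p + int n"
      "u \<in> {1..n}" "v \<in> {1..n}" "w \<in> {1..n}" for u v w :: nat and p q s
  proof -
    have np: "0 < int n" using uvw by auto
    have "int n * p < int n * (q + 1)" using uvw by (simp add: algebra_simps)
    then have "p \<le> q" using np by (simp add: mult_less_cancel_left_pos)
    have "int n * q < int n * (s + 1)" using uvw by (simp add: algebra_simps)
    then have "q \<le> s" using np by (simp add: mult_less_cancel_left_pos)
    have "int n * s < int n * (p + 2)" using uvw by (simp add: algebra_simps)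
    then have "s \<le> p + 1" using np by (simp add: mult_less_cancel_left_pos)
    then consider "p = q" "q = s" | "p = q" "s = q + 1" | "q = p + 1"
        "s = q" using \<open>p \<le> q\<close> \<open>q \<le> s\<close> by linarith
    then show ?thesis by cases (use uvw in \<open>simp_all add: algebra_simps\<close>)
  qed
  from assms(7) have "x < y \<and> y < z \<or> y < z \<and> z < x \<or> z < x \<and> x < y"
  proof (elim disjE)
    assume "a < b \<and> b < c \<and> c < a + int n"
    then show ?thesis using rot[of x k1 y k2 z k3] assms unfolding 1 2 3 by blast
  next
    assume "b < c \<and> c < a \<and> a < b + int n"
    then show ?thesis using rot[of y k2 z k3 x k1] assms unfolding 1 2 3 by blast
  next
    assume "c < a \<and> a < b \<and> b < c + int n"
    then show ?thesis using rot[of z k3 x k1 y k2] assms unfolding 1 2 3 by blast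
  qed
  then show ?thesis unfolding cyc_def .
qed

lemma eq_of_cong:
  assumes "[int x = a] (mod int n)" "[int y = a] (mod int n)" "x \<in> {1..n}" "y \<in> {1..n}" shows "x = y"
proof -
  have "[int x = int y] (mod int n)" using assms(1,2) cong_sym cong_trans by blast
  then obtain q where q: "int y = int x + int n * q" by (metis cong_iff_lin)
  have np: "0 < int n" using assms by auto
  have "int n * q < int n * 1" "int n * (-1) < int n * q"
      using q assms(3,4) unfolding atLeastAtMost_iff by linarith+
  then have "q < 1" "-1 < q" using np by (simp_all only: mult_less_cancel_left_pos)
  then have "q = 0" by linarith
  then show ?thesis using q by simp
qed

context
  fixes n k i j assumes adm: "admissible n k i j"
begin

lemma admissible_pos: "1 \<le> k" and admissible_range: "l < 2 * k + 1 \<Longrightarrow>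
    i l \<in> {1..n}" "l < 2 * k + 1 \<Longrightarrow> j l \<in> {1..n}"
  and admissible_distinct: "k = 1 \<Longrightarrow> l < 2 * k + 1 \<Longrightarrow> i l \<noteq> j l"
  using adm unfolding admissible_def by auto

end

lemma admissible_rotate1:
  assumes "admissible n k i j"
  shows "admissible n k (\<lambda>t. i ((t + 1) mod (2 * k + 1))) (\<lambda>t. j ((t + 1) mod (2 * k + 1)))"
proof -
  have k: "1 \<le> k" using assms by (simp add: admissible_def)
  obtain a b :: "nat \<Rightarrow> int" where 1: "\<And>l. l < 2 * k + 1 \<Longrightarrow>
      [int (i l) = a l] (mod int n) \<and> [int (j l) = b l] (mod int n)"
    and 2: "\<And>l. l < 2 * k + 1 \<Longrightarrow> a l \<le> b l" and 3: "\<And>l. l < 2 * k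
        \<Longrightarrow> b l < a (l + 1)" and 4: "b (2 * k) < a 0 + int n"
    using assms unfolding admissible_def by blast
  define a' b' where "a' t = (if t < 2 * k then a (t + 1) else a 0 + int n)" and "b' t
      = (if t < 2 * k then b (t + 1) else b 0 + int n)" for t
  have succ: "(t + 1) mod (2 * k + 1) = (if t < 2 * k then t + 1 else 0)" if "t < 2 * k + 1" for t
    using that by (cases "t = 2 * k") auto
  have idx: "(t + 1) mod (2 * k + 1) < 2 * k + 1" for t by simp
  have c0: "[int (i 0) = a 0 + int n] (mod int n)" "[int (j 0) = b 0 + int n] (mod int n)" 
    using 1[of 0] by (simp_all add: cong_def)
  have "\<exists>a b :: nat \<Rightarrow> int.
        (\<forall>t<2 * k + 1. [int (i ((t + 1) mod (2 * k + 1))) = a t] (mod int n) \<and>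
            [int (j ((t + 1) mod (2 * k + 1))) = b t] (mod int n)) \<and>
        (\<forall>t<2 * k + 1. a t \<le> b t) \<and> (\<forall>t<2 * k. b t < a (t + 1)) \<and>
            b (2 * k) < a 0 + int n"
  proof (rule exI[of _ a'], rule exI[of _ b'], intro conjI allI impI)
    fix t assume t: "t < 2 * k + 1"
    show "[int (i ((t + 1) mod (2 * k + 1))) = a' t] (mod int n)"
        "[int (j ((t + 1) mod (2 * k + 1))) = b' t] (mod int n)"
      unfolding succ[OF t] a'_def b'_def using 1[of "t + 1"] c0 by simp_all
    show "a' t \<le> b' t" unfolding a'_def b'_def using 2[of "t + 1"] 2[of 0] by simp
  next
    fix t assume t: "t < 2 * k"
    show "b' t < a' (t + 1)"
    proof (cases "t + 1 = 2 * k")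
      case True
      then show ?thesis unfolding a'_def b'_def using 4 t by simp
    next
      case False
      then show ?thesis unfolding a'_def b'_def using 3[of "t + 1"] t by simp
    qed
  next
    show "b' (2 * k) < a' 0 + int n" unfolding a'_def b'_def using 3[of 0] k by simp
  qed
  moreover have "i ((t + 1) mod (2 * k + 1)) \<in> {1..n} \<and> j ((t + 1) mod (2 * k + 1)) \<in> {1..n}"
    "k = 1 \<longrightarrow> i ((t + 1) mod (2 * k + 1)) \<noteq> j ((t + 1) mod (2 * k + 1))" for t
    using assms idx[of t] unfolding admissible_def by blast+
  ultimately show ?thesis unfolding admissible_def using k by blast
qed

text \<open>The numbering may start at any index, so that gap \<open>0\<close> can stand for an arbitrary gap.\<close>

lemma admissible_rotate:
  assumes "admissible n k i j"
  shows "admissible n k (\<lambda>t. i ((l + t) mod (2 * k + 1))) (\<lambda>t. j ((l + t) mod (2 * k + 1)))"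
proof (induction l)
  case 0
  have "admissible n k i j \<longleftrightarrow> admissible n k (\<lambda>t. i ((0 + t) mod (2 * k
      + 1))) (\<lambda>t. j ((0 + t) mod (2 * k + 1)))"
    unfolding admissible_def by simp
  with assms show ?case by blast
next
  case (Suc l)
  have "(l + (t + 1) mod (2 * k + 1)) mod (2 * k + 1) = (Suc l + t) mod (2 * k + 1)" for t
    by (simp only: mod_add_right_eq) simp
  then show ?case using admissible_rotate1[OF Suc] by (simp only:)
qed

text \<open>Exchanging the labels of gap \<open>0\<close> concerns the chord from \<open>i 0\<close> to a label \<open>x\<close> of gap \<open>k\<close> and
  the chord from a label \<open>w\<close> of gap \<open>k + 1\<close> to \<open>j (2 k)\<close>. These gaps follow each other on the
  circle, but \<open>x\<close> and \<open>w\<close> may be the same point if \<open>i k = j k\<close>. For \<open>k = 1\<close> the strict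
  inequalities at both ends need \<open>i l \<noteq> j l\<close>.\<close>

lemma admissible_cyc4_0:
  assumes adm: "admissible n k i j" and x: "x = j (k - 1) \<or> x = i k" and w: "w = j k \<or> w = i (k + 1)"
  shows "cyc4 (i 0) x w (j (2 * k)) \<or> x = i k \<and> w = j k \<and> x = w"
proof -
  note k = admissible_pos[OF adm]
  obtain a b :: "nat \<Rightarrow> int" where 1: "\<And>l. l < 2 * k + 1 \<Longrightarrow>
      [int (i l) = a l] (mod int n) \<and> [int (j l) = b l] (mod int n)"
    and 2: "\<And>l. l < 2 * k + 1 \<Longrightarrow> a l \<le> b l" and 3: "\<And>l m. l < m
        \<Longrightarrow> m < 2 * k + 1 \<Longrightarrow> b l < a m" 
    and 4: "\<And>l. l < 2 * k + 1 \<Longrightarrow> b l < a 0 + int n"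
    using admissible_unrolled[OF adm] by metis
  have neq: "a l \<noteq> b l" if "k = 1" "l < 2 * k + 1" for l
  proof
    assume "a l = b l"
    then have "i l = j l" using eq_of_cong[of "i l"
        "a l" n "j l"] 1[OF that(2)] admissible_range[OF adm that(2)] by simp
    then show False using admissible_distinct[OF adm that] by simp
  qed
  have first: "a 0 < b (k - 1)"
  proof (cases "k = 1")
    case True
    then show ?thesis using neq[of 0] 2[of 0] by simp
  next
    case False
    then have "b 0 < a (k - 1)" using 3[of 0 "k - 1"] k by simp
    moreover have "a (k - 1) \<le> b (k - 1)" by (rule 2) (use k in linarith)
    ultimately show ?thesis using 2[of 0] by simp
  qed
  have last: "a (k + 1) < b (2 * k)"
  proof (cases "k = 1")
    case True
    then have e: "k + 1 = 2" "2 * k = 2" by simp_all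
    show ?thesis unfolding e using neq[of 2] 2[of 2] True by simp
  next
    case False
    then have "b (k + 1) < a (2 * k)" using 3[of "k + 1" "2 * k"] k by simp
    then show ?thesis using 2[of "k + 1"] 2[of "2 * k"] k by simp
  qed
  have ch: "b (k - 1) < a k" "a k \<le> b k" "b k < a (k + 1)" "b (2 * k) < a 0 + int n" 
    using 3[of "k - 1" k] 2[of k] 3[of k "k + 1"] 4[of "2 * k"] k by simp_all
  obtain X where X: "X = b (k - 1) \<and> x = j (k - 1) \<or> X = a k \<and> x = i k" using x by blast
  obtain W where W: "W = b k \<and> w = j k \<or> W = a (k + 1) \<and> w = i (k + 1)" using w by blast
  have Xc: "[int x = X] (mod int n)" "x \<in> {1..n}" and Wc: "[int w = W] (mod int n)" "w \<in> {1..n}"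
    using X W 1[of "k - 1"] 1[of k] 1[of "k + 1"] admissible_range[OF adm, of k] admissible_range[OF adm,
        of "k - 1"] admissible_range[OF adm, of "k + 1"] k by auto
  have ends: "[int (i 0) = a 0] (mod int n)" "i 0 \<in> {1..n}"
      "[int (j (2 * k)) = b (2 * k)] (mod int n)" "j (2 * k) \<in> {1..n}"
    using 1[of 0] 1[of "2 * k"] admissible_range[OF adm, of 0] admissible_range[OF adm, of "2 * k"] by auto
  have o: "a 0 < X" "X \<le> W" "W < b (2 * k)" using X W first last ch by auto
  show ?thesis
  proof (cases "X = W")
    case True
    then have "X = a k \<and> x = i k" "W = b k \<and> w = j k" using X W ch by auto
    moreover have "x = w" using eq_of_cong Xc Wc True by blast
    ultimately show ?thesis by blast
  next
    case False
    have "cyc (i 0) x w" by (rule cyc_of_cong[OF ends(1) Xc(1) Wc(1)]) (use ends Xc Wc o False ch in auto)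
    moreover have "cyc (i 0) w (j (2 * k))" by (rule cyc_of_cong[OF ends(1) Wc(1) ends(3)]) (use ends Xc Wc
        o False ch in auto)
    ultimately show ?thesis by (simp add: cyc4_def)
  qed
qed

lemma admissible_cyc4_0_strict:
  assumes adm: "admissible n k i j" and "x = j (k - 1) \<or> x = i k" "w = j k \<or> w = i (k + 1)"
      "x = j (k - 1) \<or> w = i (k + 1)"
  shows "cyc4 (i 0) x w (j (2 * k))"
proof -
  obtain a b :: "nat \<Rightarrow> int" where 1: "\<And>l. l < 2 * k + 1 \<Longrightarrow>
      [int (i l) = a l] (mod int n) \<and> [int (j l) = b l] (mod int n)"
    and 2: "\<And>l. l < 2 * k + 1 \<Longrightarrow> a l \<le> b l" and 3: "\<And>l m. l < m
        \<Longrightarrow> m < 2 * k + 1 \<Longrightarrow> b l < a m" 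
    and 4: "\<And>l. l < 2 * k + 1 \<Longrightarrow> b l < a 0 + int n"
    using admissible_unrolled[OF adm] by metis
  note k = admissible_pos[OF adm]
  have 5: "a 0 \<le> a l" if "l < 2 * k + 1" for l
    using 3[of 0 l] 2[of 0] that by (cases "l = 0") auto
  have kk: "k - 1 < 2 * k + 1" using k by linarith
  have far: "u \<noteq> v" if "[int u = A] (mod int n)" "[int v = B] (mod int n)" "A < B"
      "B < A + int n" for u v A B
  proof
    assume "u = v"
    then have "[A = B] (mod int n)" using that cong_sym cong_trans by blast
    then obtain q where q: "B = A + int n * q" by (metis cong_iff_lin)
    have np: "0 < int n" using that by auto
    have "int n * 0 < int n * q" "int n * q < int n * 1" using q that by linarith+
    then have "0 < q" "q < 1" using np by (simp_all only: mult_less_cancel_left_pos)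
    then show False by simp
  qed
  have ji: "j (k - 1) \<noteq> i k" by (rule far[of _ "b (k - 1)" _ "a k"]) (use 1[OF kk] 1[of k] 3[of "k -
      1" k] 2[of k] 4[of k] 2[OF kk] 5[OF kk] k in auto)
  have ij: "j k \<noteq> i (k + 1)" by (rule far[of _ "b k" _ "a (k + 1)"]) (use 1[of k] 1[of "k
      + 1"] 3[of k "k + 1"] 2[of "k + 1"] 4[of "k + 1"] 2[of k] 5[of k] k in auto)
  from admissible_cyc4_0[OF assms(1-3)] show ?thesis using assms(4) ji ij by auto
qed

definition nxt :: "nat \<Rightarrow> nat \<Rightarrow> nat" where "nxt k l = (l + (k + 1)) mod (2 * k + 1)"

lemma nxt_less: "nxt k l < 2 * k + 1" by (simp add: nxt_def)

lemma fwd_nxt: "l < 2 * k + 1 \<Longrightarrow> fwd k (nxt k l) = l"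
proof -
  assume l: "l < 2 * k + 1"
  have "fwd k (nxt k l) = (l + (k + 1) + k) mod (2 * k + 1)" unfolding fwd_def nxt_def by (rule mod_add_left_eq)
  also have "l + (k + 1) + k = l + (2 * k + 1)" by simp
  also have "(l + (2 * k + 1)) mod (2 * k + 1) = l" using l by (simp only: mod_add_self2 mod_less)
  finally show ?thesis .
qed

lemma prev_nxt: "prev k (nxt k l) = fwd k l"
proof -
  have "prev k (nxt k l) = (l + (k + 1) + 2 * k) mod (2 * k + 1)"
      unfolding prev_def nxt_def by (rule mod_add_left_eq)
  also have "l + (k + 1) + 2 * k = l + k + (2 * k + 1)" by simp
  also have "(l + k + (2 * k + 1)) mod (2 * k + 1) = fwd k l" unfolding fwd_def by (rule mod_add_self2)
  finally show ?thesis .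
qed

lemma fwd_neq: "1 \<le> k \<Longrightarrow> l < 2 * k + 1 \<Longrightarrow> fwd k l \<noteq> l"
  by (auto simp: fwd_if)

context
  fixes n k i j assumes adm: "admissible n k i j"
begin

lemma gap_cyc4:
  assumes l: "l < 2 * k + 1" and x: "x = j (prev k (fwd k l)) \<or>
      x = i (fwd k l)" and w: "w = j (fwd k l) \<or> w = i (nxt k l)"
  shows "cyc4 (i l) x w (j (prev k l)) \<or> x = w"
    and "x = j (prev k (fwd k l)) \<or> w = i (nxt k l) \<Longrightarrow> cyc4 (i l) x w (j (prev k l))"
proof -
  note k = admissible_pos[OF adm]
  have e: "i ((l + 0) mod (2 * k + 1)) = i l" "j ((l + 2 * k) mod (2 * k + 1)) = j (prev k l)"
    "j ((l + (k - 1)) mod (2 * k + 1)) = j (prev k (fwd k l))" "i ((l + k) mod (2 * k + 1)) = i (fwd k l)"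
    "j ((l + k) mod (2 * k + 1)) = j (fwd k l)" "i ((l + (k + 1)) mod (2 * k + 1)) = i (nxt k l)"
    using l k opp_prev[OF k l] by (simp_all add: fwd_def prev_def nxt_def opp_def)
  show "cyc4 (i l) x w (j (prev k l)) \<or> x = w"
    using admissible_cyc4_0[OF admissible_rotate[OF adm, of l], of x w] x w unfolding e by blast
  show "cyc4 (i l) x w (j (prev k l))" if "x = j (prev k (fwd k l)) \<or> w = i (nxt k l)"
    using admissible_cyc4_0_strict[OF admissible_rotate[OF adm, of l], of x w] x w that unfolding e by blast
qed

lemma ends_in: "l < 2 * k + 1 \<Longrightarrow> fst_end k i j S l \<in> {1..n}"
    "l < 2 * k + 1 \<Longrightarrow> snd_end k i j S l \<in> {1..n}"
  unfolding fst_end_def snd_end_def using admissible_range[OF adm] prev_less[of k l] by presburger+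

lemma ends_neq: 
  assumes "l < 2 * k + 1" shows "fst_end k i j S l \<noteq> snd_end k i j S (fwd k l)"
proof -
  have "cyc4 (i l) (snd_end k i j S (fwd k l)) (i (nxt k l)) (j (prev k l))"
    by (rule gap_cyc4(2)[OF assms]) (auto simp: snd_end_def)
  from cyc4_distinct[OF this] show ?thesis unfolding fst_end_def by auto
qed

definition term_mono :: "nat set \<Rightarrow> nat set monomial" where
  "term_mono S = (\<Sum>l<2 * k + 1. edge (fst_end k i j S l) (snd_end k i j S (fwd k l)))"

lemma term_mono_monomials: "term_mono S \<in> monomials (edges n)"
proof -
  have "(\<Sum>l\<in>A. edge (fst_end k i j S l) (snd_end k i j S (fwd k l))) \<in> monomials (edges n)"
      if "A \<subseteq> {..<2 * k + 1}" for A
    using that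
  proof (induction A rule: infinite_finite_induct)
    case (insert l A)
    then have "edge (fst_end k i j S l) (snd_end k i j S (fwd k l)) \<in> monomials (edges n)"
      by (intro edge_monomials ends_in ends_neq fwd_less) auto
    then show ?case using insert by (simp add: monomials_add del: One_nat_def)
  qed auto
  then show ?thesis unfolding term_mono_def by blast
qed

text \<open>Exchanging the labels of gap \<open>l\<close> only affects the chord that starts there and the one that
  arrives there, which starts in gap \<open>nxt k l\<close>.\<close>

lemma term_mono_insert:
  assumes l: "l < 2 * k + 1" "l \<notin> S"
  shows "\<exists>u x w. u \<in> monomials (edges n) \<and>
    (x = j (prev k (fwd k l)) \<or> x = i (fwd k l)) \<and> (w = j (fwd k l) \<or> w = i (nxt k l)) \<and>
    (S = {} \<longrightarrow> x = j (prev k (fwd k l))) \<and>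
    term_mono S = edge (i l) x + edge w (j (prev k l)) + u \<and>
    term_mono (insert l S) = edge (j (prev k l)) x + edge w (i l) + u"
proof -
  note k = admissible_pos[OF adm]
  \<comment> \<open>the chord that arrives in gap \<open>l\<close> starts in gap \<open>?l'\<close>\<close>
  let ?L = "{..<2 * k + 1}" and ?l' = "nxt k l"
  let ?e = "\<lambda>S l. edge (fst_end k i j S l) (snd_end k i j S (fwd k l))"
  have l': "?l' < 2 * k + 1" "?l' \<noteq> l"
      "fwd k ?l' = l" using nxt_less fwd_nxt[OF l(1)] fwd_neq[OF k, of ?l'] fwd_neq[OF k l(1)] by auto
  have s: "term_mono T = ?e T l + ?e T ?l' + (\<Sum>t\<in>?L - {l} - {?l'}. ?e T t)" for T
  proof -
    have "term_mono T = ?e T l + (\<Sum>t\<in>?L - {l}. ?e T t)"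
        unfolding term_mono_def by (rule sum.remove) (use l in auto)
    also have "(\<Sum>t\<in>?L - {l}. ?e T t) = ?e T ?l' + (\<Sum>t\<in>?L - {l} - {?l'}. ?e T t)"
        by (rule sum.remove) (use l' in auto)
    finally show ?thesis by (simp only: add.assoc)
  qed
  have r: "(\<Sum>t\<in>?L - {l} - {?l'}. ?e (insert l S) t) = (\<Sum>t\<in>?L - {l} - {?l'}. ?e S t)"
  proof (rule sum.cong[OF refl])
    fix t assume t: "t \<in> ?L - {l} - {?l'}"
    then have "fwd k t \<noteq> l" using fwd_inj l' by (metis Diff_iff inj_onD insertI1 lessThan_iff)
    then show "?e (insert l S) t = ?e S t" using t by (simp add: fst_end_def snd_end_def)
  qed
  let ?u = "(\<Sum>t\<in>?L - {l} - {?l'}. ?e S t)"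
  let ?x = "snd_end k i j S (fwd k l)" and ?w = "fst_end k i j S ?l'"
  show ?thesis
  proof (rule exI[of _ ?u], rule exI[of _ ?x], rule exI[of _ ?w], intro conjI impI)
    show "?u \<in> monomials (edges n)" using term_mono_monomials[of S] monomials_add_iff unfolding s by blast
    show "?x = j (prev k (fwd k l)) \<or> ?x = i (fwd k l)" by (auto simp: snd_end_def)
    show "?w = j (fwd k l) \<or> ?w = i (nxt k l)" by (auto simp: fst_end_def prev_nxt)
    show "?x = j (prev k (fwd k l))" if "S = {}" using that by (simp add: snd_end_def)
    show "term_mono S = edge (i l) ?x + edge ?w (j (prev k l)) + ?u"
      unfolding s l'(3) using l by (simp add: fst_end_def snd_end_def)
    show "term_mono (insert l S) = edge (j (prev k l)) ?x + edge ?w (i l) + ?u"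
      unfolding s r l'(3) using l l' fwd_neq[OF k l(1)] by (simp add: fst_end_def snd_end_def)
  qed
qed

lemma master_poly_monomials: 
  "(master_poly k i j :: (nat set, 'a::comm_ring_1) mpoly)
      = (\<Sum>S\<in>Pow {..<2 * k + 1}. single (term_mono S) ((-1) ^ card S))"
  unfolding master_poly_eq[OF admissible_pos[OF adm]]
proof (rule sum.cong[OF refl])
  fix S
  have "(\<Prod>l<2 * k + 1. Var {fst_end k i j S l, snd_end k i j S (fwd k l)} :: (nat set, 'a) mpoly)
      = single (term_mono S) 1"
    unfolding Var_def single_prod term_mono_def ..
  moreover have "(-1) ^ c * single m 1 = (single m ((-1) ^ c) :: (nat set, 'a) mpoly)" for c m
    by (cases "even c") (simp_all add: single_uminus)
  ultimately show "(-1) ^ card S * (\<Prod>l<2 * k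
      + 1. Var {fst_end k i j S l, snd_end k i j S (fwd k l)})
      = (single (term_mono S) ((-1) ^ card S) :: (nat set, 'a) mpoly)"
    by (simp only:)
qed

end

lemma keys_sum: "keys (\<Sum>x\<in>A. f x) \<subseteq> (\<Union>x\<in>A. keys (f x))"
proof (induction A rule: infinite_finite_induct)
  case (insert x A)
  then show ?case using Poly_Mapping.keys_add[of "f x" "\<Sum>x\<in>A. f x"] by auto
qed auto

section \<open>Master polynomials in the secant ideal\<close>

context circular
begin

definition below :: "nat set monomial \<Rightarrow> nat set monomial \<Rightarrow> bool" where
  "below m m' \<longleftrightarrow> (m, m') \<in> r \<and> m \<noteq> m'"

lemma below_trans: "below a b \<Longrightarrow> below b c \<Longrightarrow> below a c"
  unfolding below_def using order_trans order_antisym by metis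

lemma below_swap: "cyc4 a b c d \<Longrightarrow> {a, b, c, d} \<subseteq> {1..n} \<Longrightarrow>
    u \<in> monomials (edges n) \<Longrightarrow> 
    below (edge a c + edge b d + u) (edge a b + edge c d + u)"
  unfolding below_def using crossing_less[of a b c d] order_add[of u] by auto

lemma lead_of_sum:
  fixes g :: "(nat set, 'a::field) mpoly"
  assumes "m \<in> monomials (edges n)" "c \<noteq> 0" "\<And>m'. m' \<in> keys g \<Longrightarrow> below m' m"
  shows "lead_monomial r (single m c + g) = m" "single m c + g \<noteq> 0"
proof -
  have "m \<notin> keys g" using assms(3) by (auto simp: below_def)
  then have "lookup (single m c + g) m \<noteq> 0" using assms(2) by (simp add: lookup_add in_keys_iff)
  then have k: "m \<in> keys (single m c + g)" by (simp add: in_keys_iff)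
  show "lead_monomial r (single m c + g) = m"
  proof (rule lead_monomialI[OF k])
    fix m' assume "m' \<in> keys (single m c + g)"
    then have "m' = m \<or> m' \<in> keys g"
        using Poly_Mapping.keys_add[of "single m c" g] by (auto split: if_splits)
    then show "(m', m) \<in> r" using assms(1,3) order_refl by (auto simp: below_def)
  qed
  show "single m c + g \<noteq> 0" using k by auto
qed

text \<open>Each exchange crosses two chords and so decreases the monomial, unless the two chords share
  an end and the exchange has no effect.\<close>

lemma term_mono_le:
  assumes adm: "admissible n k i j" and "finite T" "T \<subseteq> {..<2 * k + 1}" "S \<inter> T = {}"
  shows "(term_mono k i j (T \<union> S), term_mono k i j S) \<in> r"
  using assms(2-4)
proof (induction T rule: finite_induct)
  case empty
  then show ?case using order_refl term_mono_monomials[OF adm] by simp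
next
  case (insert l T)
  have l: "l < 2 * k + 1" "l \<notin> T \<union> S" using insert by auto
  obtain u x w where u: "u \<in> monomials (edges n)" 
    and x: "x = j (prev k (fwd k l)) \<or> x = i (fwd k l)" and w: "w = j (fwd k l) \<or> w = i (nxt k l)"
    and e: "term_mono k i j (T \<union> S) = edge (i l) x + edge w (j (prev k l)) + u"
    "term_mono k i j (insert l (T \<union> S)) = edge (j (prev k l)) x + edge w (i l) + u"
    using term_mono_insert[OF adm l] by (elim exE conjE) (rule that)
  have "(term_mono k i j (insert l (T \<union> S)), term_mono k i j (T \<union> S)) \<in> r"
  proof (cases "x = w")
    case True
    then have "term_mono k i j (insert l (T \<union> S)) = term_mono k i j (T \<union> S)"
      unfolding e by (simp add: insert_commute add.commute)
    then show ?thesis using order_refl term_mono_monomials[OF adm] by simp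
  next
    case False
    then have c: "cyc4 (i l) x w (j (prev k l))" using gap_cyc4(1)[OF adm l(1) x w] by blast
    have "x \<in> {1..n}" "w \<in> {1..n}" using x w admissible_range[OF adm fwd_less] admissible_range[OF
        adm prev_less] admissible_range[OF adm nxt_less] by auto
    then have "{i l, x, w, j (prev k l)} \<subseteq> {1..n}"
        using admissible_range[OF adm l(1)] admissible_range[OF adm prev_less] by auto
    from below_swap[OF c this u] show ?thesis
        unfolding e below_def edge_commute[of "j (prev k l)" x] edge_commute[of w "i l"]
        by (simp only: ac_simps)
  qed
  then show ?case using insert order_trans by auto
qed

text \<open>The first exchange is performed on the original chords, where it crosses two disjoint chords
  and is strict.\<close>

lemma term_mono_below:
  assumes adm: "admissible n k i j" and S: "S \<subseteq> {..<2 * k + 1}" "S \<noteq> {}"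
  shows "below (term_mono k i j S) (term_mono k i j {})"
proof -
  obtain l where l: "l \<in> S" using S by blast
  have l1: "l < 2 * k + 1" "l \<notin> {}" using l S by auto
  obtain u x w where u: "u \<in> monomials (edges n)" 
    and x: "x = j (prev k (fwd k l)) \<or> x = i (fwd k l)" and w: "w = j (fwd k l) \<or> w = i (nxt k l)"
    and x': "x = j (prev k (fwd k l))"
    and e: "term_mono k i j {} = edge (i l) x + edge w (j (prev k l)) + u"
    "term_mono k i j {l} = edge (j (prev k l)) x + edge w (i l) + u"
    using term_mono_insert[OF adm l1] by (elim exE conjE) (rule that; simp)
  have c: "cyc4 (i l) x w (j (prev k l))" using gap_cyc4(2)[OF adm l1(1) x w] x' by blast
  have "x \<in> {1..n}" "w \<in> {1..n}" using x w admissible_range[OF adm fwd_less] admissible_range[OF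
      adm prev_less] admissible_range[OF adm nxt_less] by auto
  then have "{i l, x, w, j (prev k l)} \<subseteq> {1..n}"
      using admissible_range[OF adm l1(1)] admissible_range[OF adm prev_less] by auto
  from below_swap[OF c this u] have b: "below (term_mono k i j {l}) (term_mono k i j {})"
    unfolding e edge_commute[of "j (prev k l)" x] edge_commute[of w "i l"] by (simp only: ac_simps)
  have "finite (S - {l})" using S finite_subset by blast
  from term_mono_le[OF adm this, of "{l}"] S l have "(term_mono k i j S, term_mono k i j {l}) \<in> r"
    by (simp add: insert_absorb subset_iff)
  then show ?thesis using b order_trans order_antisym unfolding below_def by metis
qed

lemma lead_master:
  assumes adm: "admissible n k i j"
  shows "lead_monomial r (master_poly k i j :: (nat set, 'a::field) mpoly) = term_mono k i j {}"
    "(master_poly k i j :: (nat set, 'a::field) mpoly) \<noteq> 0"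
proof -
  let ?P = "Pow {..<2 * k + 1}"
  let ?g = "\<Sum>S\<in>?P - {{}}. single (term_mono k i j S) ((-1) ^ card S) :: (nat set, 'a) mpoly"
  have m: "(master_poly k i j :: (nat set, 'a) mpoly)
      = single (term_mono k i j {}) ((-1) ^ card ({} :: nat set)) + ?g"
    unfolding master_poly_monomials[OF adm] by (rule sum.remove) auto
  have g: "below m' (term_mono k i j {})" if m': "m' \<in> keys ?g" for m'
  proof -
    have "m' \<in> (\<Union>S\<in>?P - {{}}. keys (single (term_mono k i j S) ((-1) ^ card S) :: (nat set,
        'a) mpoly))"
      by (rule subsetD[OF keys_sum m'])
    then obtain S where "S \<in> ?P - {{}}" "m' \<in> keys (single (term_mono k i j S) ((-1) ^ card S) ::
        (nat set, 'a) mpoly)"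
      by blast
    then show ?thesis using term_mono_below[OF adm] by (auto split: if_splits)
  qed
  show "lead_monomial r (master_poly k i j :: (nat set, 'a::field) mpoly) = term_mono k i j {}"
    "(master_poly k i j :: (nat set, 'a::field) mpoly) \<noteq> 0"
    unfolding m using lead_of_sum[OF term_mono_monomials[OF adm] _ g, of "(-1) ^ card ({} :: nat set)"] by
        simp_all
qed

lemma secant_map_Var:
  assumes "u \<noteq> v"
  shows "secant_map (Var {u, v} :: (nat set, 'a::field_char_0) mpoly) = 
    Var (Y u) * Var (Y v) + Var (Z u) * Var (Z v)"
proof -
  have e: "edge_deg {u, v} = single u 1 + single v 1" using assms by simp
  have "pair_mono (edge_deg {u, v}) 0 = single (Y u) 1 + single (Y v) 1"
    "pair_mono 0 (edge_deg {u, v}) = single (Z u) 1 + single (Z v) 1"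
    unfolding e pair_mono_single[symmetric] by (simp_all only: pair_mono_add add_0)
  then show ?thesis by (simp add: Var_def[of "Y _"] Var_def[of "Z _"] mult_single del: sum.insert)
qed

lemma master_in_secant:
  assumes adm: "admissible n k i j"
  shows "(master_poly k i j :: (nat set, 'a::field_char_0) mpoly) \<in> secant_ideal (edges n) toric_ideal"
  unfolding secant_toric_iff
proof
  show "(master_poly k i j :: (nat set, 'a) mpoly) \<in> carrier (poly_ring (edges n))"
    unfolding master_poly_monomials[OF adm] by (intro carrier_sum carrier_closed term_mono_monomials[OF adm])
  have p: "(\<Prod>l<2 * k + 1. secant_map (Var {fst_end k i j S l, snd_end k i j S (fwd k l)} :: (nat set,
      'a) mpoly)) =
    (\<Prod>l<2 * k + 1. Var (Y (fst_end k i j S l)) * Var (Y (snd_end k i j S (fwd k l)))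
        + Var (Z (fst_end k i j S l)) * Var (Z (snd_end k i j S (fwd k l))))" for S
    by (rule prod.cong[OF refl]) (rule secant_map_Var, rule ends_neq[OF adm], simp only: lessThan_iff)
  show "secant_map (master_poly k i j :: (nat set, 'a) mpoly) = 0"
    unfolding master_poly_eq[OF admissible_pos[OF adm]] substitute_sum substitute_mult substitute_power
        substitute_uminus substitute_1 substitute_prod p
    by (rule alternating_sum_zero)
qed

end

section \<open>Off-diagonal minors and the leading monomials\<close>

lemma det_mat_2: "det (mat 2 2 f) = f (0, 0) * f (1, 1) - f (0, 1) * f (1, 0 :: nat)" for f :: "nat
    \<times> nat \<Rightarrow> 'a::comm_ring_1"
proof -
  let ?A = "mat 2 2 f"
  have d: "mat_delete ?A 0 j \<in> carrier_mat 1 1" for j unfolding mat_delete_def by simp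
  have "det ?A = (\<Sum>j<2. ?A $$ (0, j) * cofactor ?A 0 j)"
    by (rule laplace_expansion_row[of ?A 2 0]) simp_all
  also have "\<dots> = f (0, 0) * det (mat_delete ?A 0 0) - f (0, 1) * det (mat_delete ?A 0 1)"
    by (simp add: cofactor_def numeral_2_eq_2)
  also have "det (mat_delete ?A 0 0) = f (1, 1)" unfolding det_single[OF d] by (simp add: mat_delete_def)
  also have "det (mat_delete ?A 0 1) = f (1, 0)" unfolding det_single[OF d] by (simp add: mat_delete_def)
  finally show ?thesis .
qed

definition det3 :: "('b \<Rightarrow> 'b \<Rightarrow> 'a::comm_ring_1) \<Rightarrow> 'b \<Rightarrow> 'b
    \<Rightarrow> 'b \<Rightarrow> 'b \<Rightarrow> 'b \<Rightarrow> 'b \<Rightarrow> 'a" where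
  "det3 x r0 r1 r2 c0 c1 c2 = x r0 c0 * x r1 c1 * x r2 c2 - x r0 c0 * x r1 c2 * x r2 c1 - x r0 c1 * x r1 c0
      * x r2 c2
     + x r0 c1 * x r1 c2 * x r2 c0 + x r0 c2 * x r1 c0 * x r2 c1 - x r0 c2 * x r1 c1 * x r2 c0"

lemma det_mat_3: "det (mat 3 3 f) = det3 (\<lambda>p q. f (p, q)) 0 1 2 0 1 (2 :: nat)" for f :: "nat
    \<times> nat \<Rightarrow> 'a::comm_ring_1"
proof -
  let ?A = "mat 3 3 f"
  have d: "mat_delete ?A 0 0 = mat 2 2 (\<lambda>(p, q). f (p + 1, q + 1))" 
    "mat_delete ?A 0 1 = mat 2 2 (\<lambda>(p, q). f (p + 1, if q = 0 then 0 else 2))"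
    "mat_delete ?A 0 2 = mat 2 2 (\<lambda>(p, q). f (p + 1, q))"
    unfolding mat_delete_def by (rule eq_matI; auto simp: less_Suc_eq numeral_3_eq_3 numeral_2_eq_2)+
  have "det ?A = (\<Sum>j<3. ?A $$ (0, j) * cofactor ?A 0 j)"
    by (rule laplace_expansion_row[of ?A 3 0]) simp_all
  also have "\<dots> = f (0, 0) * det (mat_delete ?A 0 0) - f (0, 1) * det (mat_delete ?A 0 1)
      + f (0, 2) * det (mat_delete ?A 0 2)"
    by (simp add: cofactor_def numeral_3_eq_3) (simp add: numeral_2_eq_2)
  finally show ?thesis unfolding d det_mat_2 det3_def by (simp add: algebra_simps numeral_2_eq_2)
qed

text \<open>The minors list rows and columns in increasing order, whereas the chords come in circular
  order. The two orders differ by permutations, which only affect the sign.\<close>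

lemma det3_sign:
  assumes "{r0, r1, r2} = {a0, a1, a2}" "distinct [r0, r1, r2]" "{c0, c1, c2} = {b0, b1, b2}"
      "distinct [c0, c1, c2]" 
  shows "det3 x r0 r1 r2 c0 c1 c2 = det3 x a0 a1 a2 b0 b1 b2 \<or>
      det3 x r0 r1 r2 c0 c1 c2 = - det3 x a0 a1 a2 b0 b1 b2"
proof -
  have perm: "(r0, r1, r2) \<in> {(a0, a1, a2), (a0, a2, a1), (a1, a0, a2), (a1, a2, a0), (a2, a0, a1),
      (a2, a1, a0)}"
    if "{r0, r1, r2} = {a0, a1, a2}" "distinct [r0, r1, r2]" for r0 r1 r2 a0 a1 a2 :: 'a
  proof -
    have "r0 \<in> {a0, a1, a2}" "r1 \<in> {a0, a1, a2}" "r2 \<in> {a0, a1, a2}" using that(1) by blast+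
    then show ?thesis using that(2) by auto
  qed
  have rows: "det3 x r0 r1 r2 c0 c1 c2 = det3 x a0 a1 a2 c0 c1 c2 \<or>
      det3 x r0 r1 r2 c0 c1 c2 = - det3 x a0 a1 a2 c0 c1 c2"
    using perm[OF assms(1,2)] by (elim insertE emptyE; clarsimp) (auto simp: det3_def algebra_simps)
  have cols: "det3 x a0 a1 a2 c0 c1 c2 = det3 x a0 a1 a2 b0 b1 b2 \<or>
      det3 x a0 a1 a2 c0 c1 c2 = - det3 x a0 a1 a2 b0 b1 b2"
    using perm[OF assms(3,4)] by (elim insertE emptyE; clarsimp) (auto simp: det3_def algebra_simps)
  from rows cols show ?thesis by (metis minus_minus)
qed

lemma sorted_list_3:
  assumes "card R = 3" 
  shows "distinct [sorted_list_of_set R ! 0, sorted_list_of_set R ! 1, sorted_list_of_set R ! 2]"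
    "{sorted_list_of_set R ! 0, sorted_list_of_set R ! 1, sorted_list_of_set R ! 2} = (R :: nat set)"
proof -
  have f: "finite R" using assms card.infinite by fastforce
  let ?l = "sorted_list_of_set R"
  have l: "length ?l = 3" "distinct ?l" "set ?l = R" using assms f by simp_all
  have "\<exists>x y z. l = [x, y, z]" if "length l = 3" for l :: "nat list"
    using that by (auto simp: length_Suc_conv numeral_3_eq_3)
  then obtain x y z where xyz: "?l = [x, y, z]" using l(1) by blast
  then show "distinct [?l ! 0, ?l ! 1, ?l ! 2]" "{?l ! 0, ?l ! 1, ?l ! 2} = R" using l by auto
qed

lemma off_diagonal_minor_det3:
  "off_diagonal_minor R C = (let r = (!) (sorted_list_of_set R); c = (!) (sorted_list_of_set C) in
     det3 (\<lambda>a b. Var {a, b}) (r 0) (r 1) (r 2) (c 0) (c 1) (c 2))"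
  unfolding off_diagonal_minor_def det_mat_3 by (simp add: det3_def Let_def)

lemma det3_rank_2: "det3 (\<lambda>a b. y a * y b + z a * z b) r0 r1 r2 c0 c1 c2 = 0"
  by (simp add: det3_def algebra_simps)

context circular
begin

lemma minor_in_secant:
  assumes RC: "R \<subseteq> {1..n}" "C \<subseteq> {1..n}" "R \<inter> C = {}" "card R = 3" "card C = 3"
  shows "(off_diagonal_minor R C :: (nat set, 'a::field_char_0) mpoly) \<in> secant_ideal (edges n) toric_ideal"
proof -
  obtain r0 r1 r2 c0 c1 c2 where rc: "{r0, r1, r2} = R" "{c0, c1, c2} = C"
    and m: "(off_diagonal_minor R C :: (nat set, 'a) mpoly) = det3 (\<lambda>a b. Var {a, b}) r0 r1 r2 c0 c1 c2"
    using sorted_list_3(2)[OF RC(4)] sorted_list_3(2)[OF RC(5)] off_diagonal_minor_det3[of R C]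
        by (simp add: Let_def)
  have ne: "a \<noteq> b" "{a, b} \<in> edges n" if "a \<in> {r0, r1, r2}" "b \<in> {c0, c1, c2}" for a b
    using that RC(1-3) edgesI[of a n b] unfolding rc by blast+
  have v: "(Var {a, b} :: (nat set, 'a) mpoly) \<in> carrier (poly_ring (edges n))"
      if "a \<in> {r0, r1, r2}" "b \<in> {c0, c1, c2}" for a b
    using ne(2)[OF that] by (rule carrier_closed)
  have s: "secant_map (Var {a, b} :: (nat set, 'a) mpoly) = Var (Y a) * Var (Y b) + Var (Z a) * Var (Z b)"
    if "a \<in> {r0, r1, r2}" "b \<in> {c0, c1, c2}" for a b
    using ne(1)[OF that] by (rule secant_map_Var)
  have "secant_map (off_diagonal_minor R C :: (nat set, 'a) mpoly)
      = det3 (\<lambda>a b. Var (Y a) * Var (Y b) + Var (Z a) * Var (Z b)) r0 r1 r2 c0 c1 c2"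
    unfolding m det3_def substitute_add substitute_diff substitute_mult by (simp only: s insertI1 insertI2)
  also have "\<dots> = 0" by (rule det3_rank_2)
  finally have "secant_map (off_diagonal_minor R C :: (nat set, 'a) mpoly) = 0" .
  moreover have "(off_diagonal_minor R C :: (nat set, 'a) mpoly) \<in> carrier (poly_ring (edges n))"
    unfolding m det3_def by (intro carrier_closed(3-5) v) auto
  ultimately show ?thesis unfolding secant_toric_iff by blast
qed

text \<open>The six terms are reached from the product of the parallel chords by successively crossing
  pairs of chords.\<close>

lemma lead_minor:
  assumes c: "cyc6 a0 a1 a2 b2 b1 b0" and in_n: "{a0, a1, a2, b2, b1, b0} \<subseteq> {1..n}"
  shows "off_diagonal_minor {a0, a1, a2} {b0, b1, b2} \<in> (off_diagonal_minors n :: (nat set, 'a::field)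
      mpoly set)"
    "(off_diagonal_minor {a0, a1, a2} {b0, b1, b2} :: (nat set, 'a) mpoly) \<noteq> 0"
    "lead_monomial r (off_diagonal_minor {a0, a1, a2} {b0, b1, b2} :: (nat set, 'a) mpoly)
        = edge a0 b0 + edge a1 b1 + edge a2 b2"
proof -
  have dist: "a0 \<noteq> a1" "a0 \<noteq> a2" "a1 \<noteq> a2" "b0 \<noteq> b1" "b0 \<noteq> b2"
      "b1 \<noteq> b2"
    "a0 \<noteq> b0" "a0 \<noteq> b1" "a0 \<noteq> b2" "a1 \<noteq> b0" "a1 \<noteq> b1" "a1 \<noteq> b2"
        "a2 \<noteq> b0" "a2 \<noteq> b1" "a2 \<noteq> b2"
    using c unfolding cyc6_def cyc_def by linarith+
  let ?R = "{a0, a1, a2}" and ?C = "{b0, b1, b2}"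
  have card: "card ?R = 3" "card ?C = 3" using dist by simp_all
  have disj: "?R \<inter> ?C = {}" using dist by auto
  show "off_diagonal_minor ?R ?C \<in> (off_diagonal_minors n :: (nat set, 'a) mpoly set)"
    unfolding off_diagonal_minors_def using card disj in_n by blast
  let ?f = "off_diagonal_minor ?R ?C :: (nat set, 'a) mpoly"
  let ?x = "\<lambda>a b. Var {a, b} :: (nat set, 'a) mpoly"
  have "?f = det3 ?x a0 a1 a2 b0 b1 b2 \<or> ?f = - det3 ?x a0 a1 a2 b0 b1 b2"
    unfolding off_diagonal_minor_det3 Let_def
    by (rule det3_sign[OF sorted_list_3(2)[OF card(1)] sorted_list_3(1)[OF card(1)] sorted_list_3(2)[OF
        card(2)] sorted_list_3(1)[OF card(2)]])
  then obtain s :: 'a where s: "s \<noteq> 0" "?f = single 0 s * det3 ?x a0 a1 a2 b0 b1 b2"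
  proof
    assume "?f = det3 ?x a0 a1 a2 b0 b1 b2" then show thesis using that[of 1] by simp
  next
    assume "?f = - det3 ?x a0 a1 a2 b0 b1 b2" then show thesis using that[of "-1"] by (simp add: single_uminus)
  qed
  let ?m = "\<lambda>u v w. edge a0 u + edge a1 v + edge a2 w"
  have mon: "?m u v w \<in> monomials (edges n)" if "u \<in> ?C" "v \<in> ?C" "w \<in> ?C" for u v w
    using that in_n dist by (intro monomials_add edge_monomials) auto
  have emon: "edge a b \<in> monomials (edges n)" if "a \<in> ?R" "b \<in> ?C" for a b
    using that in_n dist by (intro edge_monomials) auto
  have cy: "cyc4 b0 a0 a1 b1" "cyc4 b1 a1 a2 b2" "cyc4 b0 a1 a2 b2" "cyc4 b0 a0 a1 b2" "cyc4 b1 a0 a1 b2"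
    using c unfolding cyc6_def cyc4_def cyc_def using [[smt_nat_as_int]] by (smt (z3))+
  have b1: "below (?m b1 b0 b2) (?m b0 b1 b2)"
    using below_swap[OF cy(1) _ emon[of a2 b2]] in_n by (simp add: insert_commute add_ac)
  have b2: "below (?m b0 b2 b1) (?m b0 b1 b2)"
    using below_swap[OF cy(2) _ emon[of a0 b0]] in_n by (simp add: insert_commute add_ac)
  have b3: "below (?m b1 b2 b0) (?m b0 b1 b2)"
    using below_trans[OF _ b1] below_swap[OF cy(3) _ emon[of a0 b1]] in_n by (simp add: insert_commute add_ac)
  have b4: "below (?m b2 b0 b1) (?m b0 b1 b2)"
    using below_trans[OF _ b2] below_swap[OF cy(4) _ emon[of a2 b1]] in_n by (simp add: insert_commute add_ac)
  have b5: "below (?m b2 b1 b0) (?m b0 b1 b2)"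
    using below_trans[OF _ b3] below_swap[OF cy(5) _ emon[of a2 b0]] in_n by (simp add: insert_commute add_ac)
  let ?S = "single :: nat set monomial \<Rightarrow> 'a \<Rightarrow> _"
  let ?g = "?S (?m b0 b2 b1) (- s) + ?S (?m b1 b0 b2) (- s) + ?S (?m b1 b2 b0) s + ?S (?m b2 b0 b1) s
      + ?S (?m b2 b1 b0) (- s)"
  have f: "?f = ?S (?m b0 b1 b2) s + ?g"
    unfolding s(2) det3_def Var_def mult_single single_uminus by (simp add: algebra_simps mult_single)
  have g: "below m' (?m b0 b1 b2)" if m': "m' \<in> keys ?g" for m'
  proof -
    have "m' \<in> {?m b0 b2 b1, ?m b1 b0 b2, ?m b1 b2 b0, ?m b2 b0 b1, ?m b2 b1 b0}"
      using m' by (auto dest!: subsetD[OF Poly_Mapping.keys_add] split: if_splits)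
    then show ?thesis using b1 b2 b3 b4 b5 by blast
  qed
  show "?f \<noteq> 0" "lead_monomial r ?f = ?m b0 b1 b2"
    unfolding f using lead_of_sum[OF mon[of b0 b1 b2] s(1) g] by simp_all
qed

lemma finite_master_polys: "finite (master_polys n :: (nat set, 'a::field) mpoly set)"
proof -
  let ?M = "(\<lambda>(k, i, j). master_poly k i j) ` (SIGMA k:{..n}. ({..<2 * k
      + 1} \<rightarrow>\<^sub>E {1..n}) \<times> ({..<2 * k + 1} \<rightarrow>\<^sub>E {1..n}))"
  have "master_polys n \<subseteq> (?M :: (nat set, 'a) mpoly set)"
  proof
    fix f :: "(nat set, 'a) mpoly" assume "f \<in> master_polys n"
    then obtain k i j where f: "f = master_poly k i j" and adm: "admissible n k i j"
        unfolding master_polys_def by blast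
    let ?i = "restrict i {..<2 * k + 1}" and ?j = "restrict j {..<2 * k + 1}"
    have m: "master_poly k i j = (master_poly k ?i ?j :: (nat set, 'a) mpoly)"
      unfolding master_poly_eq[OF admissible_pos[OF adm]]
    proof (intro sum.cong refl arg_cong2[where f = "(*)"] prod.cong)
      fix S l assume "l \<in> {..<2 * k + 1}"
      then show "(Var {fst_end k i j S l, snd_end k i j S (fwd k l)} :: (nat set, 'a) mpoly)
          = Var {fst_end k ?i ?j S l, snd_end k ?i ?j S (fwd k l)}"
        by (simp add: fst_end_def snd_end_def)
    qed
    have "k \<le> n"
    proof -
      obtain a b :: "nat \<Rightarrow> int" where 2: "\<And>l. l < 2 * k + 1 \<Longrightarrow>
          a l \<le> b l" and 3: "\<And>l m. l < m \<Longrightarrow> m < 2 * k + 1 \<Longrightarrow> b l < a m" 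
        and 4: "\<And>l. l < 2 * k + 1 \<Longrightarrow> b l < a 0 + int n"
        using admissible_unrolled[OF adm] by metis
      have "a 0 + int l \<le> a l" if "l < 2 * k + 1" for l
        using that
      proof (induction l)
        case (Suc l)
        then show ?case using 2[of l] 3[of l "Suc l"] by simp
      qed simp
      from this[of "2 * k"] 2[of "2 * k"] 4[of "2 * k"] show ?thesis by simp
    qed
    then have "(k, ?i, ?j) \<in> (SIGMA k:{..n}. ({..<2 * k
        + 1} \<rightarrow>\<^sub>E {1..n}) \<times> ({..<2 * k + 1} \<rightarrow>\<^sub>E {1..n}))"
      using admissible_range[OF adm] by (auto simp: restrict_def PiE_iff extensional_def)
    then show "f \<in> ?M" unfolding f m by (metis (mono_tags, lifting) case_prod_conv image_eqI)
  qed
  moreover have "finite ?M" by (intro finite_imageI finite_SigmaI finite_cartesian_product finite_PiE) auto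
  ultimately show ?thesis by (rule finite_subset)
qed

lemma finite_off_diagonal_minors: "finite (off_diagonal_minors n)"
proof -
  have "off_diagonal_minors n \<subseteq> (\<lambda>(R, C). off_diagonal_minor R C) ` (Pow {1..n} \<times>
      Pow {1..n})"
    unfolding off_diagonal_minors_def by auto
  then show ?thesis by (rule finite_subset) simp
qed

lemma dvd_of_edges:
  assumes "finite A" "inj_on e A" "\<And>l. l \<in> A \<Longrightarrow> e l \<in> keys m"
  shows "\<exists>u. m = u + (\<Sum>l\<in>A. single (e l) (1::nat))"
proof -
  let ?s = "\<Sum>l\<in>A. single (e l) (1::nat)"
  have "lookup ?s x \<le> lookup m x" for x
  proof -
    have "lookup ?s x = card {l\<in>A. e l = x}"
      by (subst lookup_sum_single[OF assms(1)]) simp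
    moreover have "card {l\<in>A. e l = x} \<le> 1"
    proof -
      have "{l\<in>A. e l = x} \<subseteq> {the_inv_into A e x}" using the_inv_into_f_f[OF assms(2)] by auto
      then show ?thesis using card_mono[of "{the_inv_into A e x}"] by simp
    qed
    moreover have "1 \<le> lookup m x" if "{l\<in>A. e l = x} \<noteq> {}"
        using that assms(3) by (auto simp: in_keys_iff Suc_le_eq)
    ultimately show ?thesis by (cases "{l\<in>A. e l = x} = {}") auto
  qed
  then have "m = (m - ?s) + ?s" by (intro poly_mapping_eqI) (simp add: lookup_add lookup_minus)
  then show ?thesis ..
qed

text \<open>If a monomial is not a product of two thrackles, its chords contain one of the
  configurations of \<open>not_bipartite_cases\<close>, and the product of these chords divides it.\<close>

lemma leading_cover:
  assumes m: "m \<in> monomials (edges n)" "\<not> standard_sum m"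
  shows "\<exists>g\<in>master_polys n \<union> off_diagonal_minors n :: (nat set, 'a::field) mpoly set. g
      \<noteq> 0 \<and> (\<exists>u. m = u + lead_monomial r g)"
proof -
  have W: "keys m \<subseteq> edges n" using m by (simp add: monomials_def)
  have nb: "\<not> (\<exists>C. \<forall>E\<in>keys m. \<forall>F\<in>keys m. apart E F \<longrightarrow>
      (E \<in> C) \<noteq> (F \<in> C))"
    using bipartite_standard_sum[OF m(1)] m(2) by blast
  show ?thesis
  proof (rule not_bipartite_cases[OF W nb])
    fix k i j assume adm: "admissible n k i j" and inj: "inj_on (\<lambda>l. {i l, j ((l
        + k - 1) mod (2 * k + 1))}) {..<2 * k + 1}"
      and K: "\<And>l. l < 2 * k + 1 \<Longrightarrow> {i l, j ((l + k - 1) mod (2 * k + 1))} \<in> keys m"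
    let ?g = "master_poly k i j :: (nat set, 'a) mpoly"
    have "lead_monomial r ?g = (\<Sum>l<2 * k + 1. single {i l, j ((l + k - 1) mod (2 * k + 1))} 1)"
      unfolding lead_master[OF adm] term_mono_def[OF adm]
      by (rule sum.cong[OF refl]) (simp only: base_ends[OF _ admissible_pos[OF adm]] lessThan_iff)
    then have "\<exists>u. m = u + lead_monomial r ?g"
        using dvd_of_edges[OF finite_lessThan inj, of m] K by (simp only: lessThan_iff)
    moreover have "?g \<in> master_polys n" using adm unfolding master_polys_def by blast
    ultimately show ?thesis using lead_master(2)[OF adm] by blast
  next
    fix a0 a1 a2 b2 b1 b0 assume c: "cyc6 a0 a1 a2 b2 b1 b0" and K: "{a0, b0} \<in> keys m"
        "{a1, b1} \<in> keys m" "{a2, b2} \<in> keys m"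
    have in_n: "{a0, a1, a2, b2, b1, b0} \<subseteq> {1..n}" using K W edges_subset by blast
    let ?e = "\<lambda>l::nat. if l = 0 then {a0, b0} else if l = 1 then {a1, b1} else {a2, b2}"
    have ne: "a1 \<notin> {a0, b0}" "a2 \<notin> {a0, b0}" "a2 \<notin> {a1, b1}"
    proof -
      have "a1 \<noteq> a0" "a1 \<noteq> b0" "a2 \<noteq> a0" "a2 \<noteq> b0" "a2 \<noteq> a1"
          "a2 \<noteq> b1" using c unfolding cyc6_def cyc_def by linarith+
      then show "a1 \<notin> {a0, b0}" "a2 \<notin> {a0, b0}" "a2 \<notin> {a1, b1}" by simp_all
    qed
    have "inj_on ?e {0, 1, 2}" by (rule inj_on_three) (use ne in auto)
    then have "\<exists>u. m = u + (\<Sum>l\<in>{0, 1, 2}. single (?e l) (1::nat))"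
      by (intro dvd_of_edges) (use K in auto)
    then have "\<exists>u. m = u + (edge a0 b0 + edge a1 b1 + edge a2 b2)" by (simp add: add.assoc)
    then show ?thesis using lead_minor[OF c in_n, where 'a = 'a] by (metis UnCI)
  qed
qed

end

section \<open>The Groebner basis\<close>

theorem theorem3p1:
  fixes n :: nat and r :: "nat set monomial rel"
  assumes "n \<ge> 2"
    and "circular_term_order n r"
  shows "delightful2 (edges n) r (hypersimplex_ideal n :: (nat set, complex) mpoly set) \<and>
    groebner_basis (edges n) r (master_polys n \<union> off_diagonal_minors n)
      (secant_ideal (edges n) (hypersimplex_ideal n :: (nat set, complex) mpoly set))"
proof -
  interpret circular n r by unfold_locales (rule assms)+
  let ?G = "master_polys n \<union> off_diagonal_minors n :: (nat set, complex) mpoly set"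
  have "finite ?G" using finite_master_polys finite_off_diagonal_minors by blast
  moreover have "?G \<subseteq> secant_ideal (edges n) toric_ideal"
    using master_in_secant minor_in_secant unfolding master_polys_def off_diagonal_minors_def by blast
  ultimately show ?thesis
    using delightful_groebner[OF _ _ leading_cover] unfolding toric_ideal_hypersimplex[symmetric] by blast
qed

end
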